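(* Let $\mathbb F$ be the completed natural filtration of a Poisson process $N$ with intensity $\lambda>0$, let $M_t=N_t-\lambda t$, let $\tau$ be a random time independent of $\mathbb F$, and let $\mathbb G$ be the progressive enlargement of $\mathbb F$ with $\tau$. Then for every bounded $\mathbb F$-predictable process $h$ having a limit at $+\infty$, the $\mathbb G$-martingale $Y^h_t=\mathbb E(h_\tau\mid\mathcal G_t)$ satisfies $$dY^h_t=\frac{Z_{t-}}{Z_{t-}-\Delta A^p_t}\Big(h_t-\frac{X^h_{t-}}{Z_{t-}}\Big)dM^{(\tau)}_t+\frac{1-A_{t-}}{Z_{t-}}\,\phi^h_t\,dM_t ,$$ where $A,Z,A^p,X^h,\phi^h,M^{(\tau)}$ are as defined in the context.
   Context: Setting. $(\Omega,\mathcal G,\mathbb P)$ is a probability space carrying a Poisson process $N$ with intensity $\lambda>0$; $\mathbb F=(\mathcal F_t)_{t\ge0}$ is the completed filtration generated by $N$. A random time $\tau$ is a $[0,\infty]$-valued random variable; $A_t:=\mathbf 1_{\{\tau\le t\}}$ (with $A_{0-}:=0$). $\mathbb G=(\mathcal G_t)_{t\ge 0}$, the progressive enlargement of $\mathbb F$ with $\tau$, is the smallest right-continuous $\mathbb P$-complete filtration containing $\mathbb F$ for which $\tau$ is a stopping time. $Z_t:=\mathbb P(\tau>t\mid\mathcal F_t)$ (càdlàg version), $Z_{0-}:=1$, $Z_\infty:=\lim_{t\to\infty}Z_t$. $A^p$ is the dual $\mathbb F$-predictable projection of $A$. It is known that $Z_->0$ on $[\![0,\tau]\!]$. For a bounded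 $\mathbb F$-predictable process $h$ with limit $h_\infty$ at $+\infty$ (so $h_\tau=h_\infty$ on $\{\tau=\infty\}$), set $$X^h_t:=\mathbb E\Big(\int_t^\infty h_s\,dA^p_s+h_\infty Z_\infty\,\Big|\,\mathcal F_t\Big)=\mu^h_t-\int_0^th_s\,dA^p_s,\qquad \mu^h_t:=\mathbb E\Big(\int_0^\infty h_s\,dA^p_s+h_\infty Z_\infty\,\Big|\,\mathcal F_t\Big),$$ and let $\phi^h$ be the $\mathbb F$-predictable process with $\mu^h_t=\mu^h_0+\int_0^t\phi^h_s\,dM_s$ (it exists by the predictable representation property of $M$ in $\mathbb F$). Moreover $$M^{(\tau)}_t:=A_t-\int_0^{t\wedge\tau}\frac{dA^p_s}{Z_{s-}},$$ which is a $\mathbb G$-martingale stopped at $\tau$. Conventions: $\int_t^s=\int_{(t,s]}$; $\Delta V_t=V_t-V_{t-}$; all integrals are implicitly assumed to be well defined; integrands only matter on $[\![0,\tau]\!]$. The quotient with denominator $Z_{t-}-\Delta A^p_t$ is set to $0$ where this denominator vanishes (this set is not charged by $M^{(\tau)}$). *)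

theory Defs
  imports "HOL-Probability.Probability"
begin

text \<open>
  Processes and filtrations are indexed by real times, of which only those \<open>t \<ge> 0\<close> matter.
  Completeness of a \<open>\<sigma>\<close>-algebra is understood relative to \<open>null_sets M\<close>, which consists of all
  negligible sets as soon as \<open>M\<close> itself is complete.
\<close>

subsection \<open>Filtrations\<close>

definition usual_filtration :: "'a measure \<Rightarrow> (real \<Rightarrow> 'a measure) \<Rightarrow> bool" where
  "usual_filtration M H \<longleftrightarrow>
     (\<forall>t\<ge>0. subalgebra M (H t)) \<and>
     (\<forall>s t. 0 \<le> s \<and> s \<le> t \<longrightarrow> sets (H s) \<subseteq> sets (H t)) \<and>
     (\<forall>t\<ge>0. sets (H t) = (\<Inter>s\<in>{t<..}. sets (H s))) \<and>
     (\<forall>t\<ge>0. null_sets M \<subseteq> sets (H t))"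

definition natural_filtration :: "'a measure \<Rightarrow> (real \<Rightarrow> 'a \<Rightarrow> nat) \<Rightarrow> real \<Rightarrow> 'a measure" where
  "natural_filtration M N t = sigma (space M) {N u -` B \<inter> space M | u B. 0 \<le> u \<and> u \<le> t}"

definition completed_natural_filtration ::
    "'a measure \<Rightarrow> (real \<Rightarrow> 'a \<Rightarrow> nat) \<Rightarrow> real \<Rightarrow> 'a measure" where
  "completed_natural_filtration M N t =
     sigma (space M) (sets (natural_filtration M N t) \<union> null_sets M)"

text \<open>
  The family of filtrations over which the intersection is taken contains the constant
  filtration \<open>\<lambda>t. M\<close>, and it is closed under intersections, so that this is its smallest element.
  The library's \<open>stopping_time\<close> is not applicable, since \<open>\<tau>\<close> may be infinite while the time index
  is finite.
\<close>

definition progressive_enlargement ::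
    "'a measure \<Rightarrow> (real \<Rightarrow> 'a measure) \<Rightarrow> ('a \<Rightarrow> ennreal) \<Rightarrow> real \<Rightarrow> 'a measure" where
  "progressive_enlargement M F \<tau> t = sigma (space M)
     (\<Inter>{sets (H t) | H. usual_filtration M H \<and>
                      (\<forall>s\<ge>0. sets (F s) \<subseteq> sets (H s)) \<and>
                      (\<forall>s\<ge>0. {\<omega> \<in> space M. \<tau> \<omega> \<le> ennreal s} \<in> sets (H s))})"

definition predictable_sigma :: "'a measure \<Rightarrow> (real \<Rightarrow> 'a measure) \<Rightarrow> (real \<times> 'a) measure" where
  "predictable_sigma M F = sigma ({0..} \<times> space M)
     ({{0} \<times> B | B. B \<in> sets (F 0)} \<union>
      {{s<..t} \<times> B | s t B. 0 \<le> s \<and> s < t \<and> B \<in> sets (F s)})"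

definition predictable_process ::
    "'a measure \<Rightarrow> (real \<Rightarrow> 'a measure) \<Rightarrow> (real \<Rightarrow> 'a \<Rightarrow> real) \<Rightarrow> bool" where
  "predictable_process M F h \<longleftrightarrow> (\<lambda>(t, \<omega>). h t \<omega>) \<in> borel_measurable (predictable_sigma M F)"


subsection \<open>Paths and Lebesgue--Stieltjes integrals\<close>

definition left_lim :: "(real \<Rightarrow> real) \<Rightarrow> real \<Rightarrow> real" where
  "left_lim f t = Lim (at_left t) f"

definition cadlag :: "(real \<Rightarrow> real) \<Rightarrow> bool" where
  "cadlag f \<longleftrightarrow> (\<forall>t\<ge>0. continuous (at_right t) f) \<and> (\<forall>t>0. \<exists>l. (f \<longlongrightarrow> l) (at_left t))"

definition increasing_path :: "(real \<Rightarrow> real) \<Rightarrow> bool" where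
  "increasing_path V \<longleftrightarrow> 0 \<le> V 0 \<and> mono_on {0..} V \<and> (\<forall>t\<ge>0. continuous (at_right t) V)"

text \<open>
  The measure \<open>dV\<close> on \<open>[0,\<infinity>)\<close> of an increasing path, with the convention that the path vanishes
  before time \<open>0\<close>; thus \<open>V 0\<close> is the mass of \<open>{0}\<close>.
\<close>

definition LS_measure :: "(real \<Rightarrow> real) \<Rightarrow> real measure" where
  "LS_measure V = interval_measure (\<lambda>t. if t < 0 then 0 else V t)"

text \<open>
  \<open>has_LS_integral V H t I\<close>: the path \<open>V\<close> is of locally finite variation, \<open>H\<close> is integrable with
  respect to \<open>dV\<close> over \<open>(0,t]\<close>, and the integral is \<open>I\<close>. The value does not depend on the
  decomposition \<open>V = P - Q\<close>; a decomposition with \<open>H\<close> integrable for both parts exists iff \<open>H\<close> is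
  integrable with respect to the total variation measure.
\<close>

definition has_LS_integral ::
    "(real \<Rightarrow> real) \<Rightarrow> (real \<Rightarrow> real) \<Rightarrow> real \<Rightarrow> real \<Rightarrow> bool" where
  "has_LS_integral V H t I \<longleftrightarrow>
     (\<exists>P Q. increasing_path P \<and> increasing_path Q \<and> (\<forall>s\<ge>0. V s = P s - Q s) \<and>
            set_integrable (LS_measure P) {0<..t} H \<and>
            set_integrable (LS_measure Q) {0<..t} H \<and>
            I = (LINT s:{0<..t}|LS_measure P. H s) - (LINT s:{0<..t}|LS_measure Q. H s))"


subsection \<open>Processes\<close>

definition poisson_process :: "'a measure \<Rightarrow> (real \<Rightarrow> 'a \<Rightarrow> nat) \<Rightarrow> real \<Rightarrow> bool" where
  "poisson_process M N rate \<longleftrightarrow>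
     (\<forall>t\<ge>0. N t \<in> measurable M (count_space UNIV)) \<and>
     (\<forall>\<omega>\<in>space M. N 0 \<omega> = 0 \<and> increasing_path (\<lambda>t. real (N t \<omega>))) \<and>
     (\<forall>s t. 0 \<le> s \<and> s < t \<longrightarrow>
        distr M (count_space UNIV) (\<lambda>\<omega>. N t \<omega> - N s \<omega>) = measure_pmf (poisson_pmf (rate * (t - s))) \<and>
        prob_space.indep_set M (sets (natural_filtration M N s))
          {(\<lambda>\<omega>. N t \<omega> - N s \<omega>) -` B \<inter> space M | B. True})"

definition indep_of_filtration :: "'a measure \<Rightarrow> (real \<Rightarrow> 'a measure) \<Rightarrow> ('a \<Rightarrow> ennreal) \<Rightarrow> bool" where
  "indep_of_filtration M F \<tau> \<longleftrightarrow>
     prob_space.indep_set M (sigma_sets (space M) (\<Union>t\<in>{0..}. sets (F t)))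
       {\<tau> -` B \<inter> space M | B. B \<in> sets borel}"

text \<open>\<open>X\<close> is a cadlag version of the process with value \<open>E(\<xi> t | F t)\<close> at time \<open>t\<close>.\<close>

definition cadlag_cond_exp ::
    "'a measure \<Rightarrow> (real \<Rightarrow> 'a measure) \<Rightarrow> (real \<Rightarrow> 'a \<Rightarrow> real) \<Rightarrow> (real \<Rightarrow> 'a \<Rightarrow> real) \<Rightarrow> bool" where
  "cadlag_cond_exp M F \<xi> X \<longleftrightarrow>
     (\<forall>t\<ge>0. X t \<in> borel_measurable (F t) \<and> (AE \<omega> in M. X t \<omega> = real_cond_exp M (F t) (\<xi> t) \<omega>)) \<and>
     (AE \<omega> in M. cadlag (\<lambda>t. X t \<omega>))"

text \<open>
  Both integrals are over \<open>[0,\<infinity>)\<close> and include the masses at \<open>0\<close>, in accordance with the values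
  \<open>0\<close> of the processes at time \<open>0-\<close>.
\<close>

definition dual_predictable_projection ::
    "'a measure \<Rightarrow> (real \<Rightarrow> 'a measure) \<Rightarrow> (real \<Rightarrow> 'a \<Rightarrow> real) \<Rightarrow> (real \<Rightarrow> 'a \<Rightarrow> real) \<Rightarrow> bool" where
  "dual_predictable_projection M F V Vp \<longleftrightarrow>
     predictable_process M F Vp \<and>
     (\<forall>\<omega>\<in>space M. increasing_path (\<lambda>t. Vp t \<omega>)) \<and>
     (\<forall>K :: real \<times> 'a \<Rightarrow> ennreal. K \<in> borel_measurable (predictable_sigma M F) \<longrightarrow>
        (\<integral>\<^sup>+\<omega>. (\<integral>\<^sup>+s\<in>{0..}. K (s, \<omega>) \<partial>LS_measure (\<lambda>t. V t \<omega>)) \<partial>M) =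
        (\<integral>\<^sup>+\<omega>. (\<integral>\<^sup>+s\<in>{0..}. K (s, \<omega>) \<partial>LS_measure (\<lambda>t. Vp t \<omega>)) \<partial>M))"

definition jump_process :: "('a \<Rightarrow> ennreal) \<Rightarrow> real \<Rightarrow> 'a \<Rightarrow> real" where
  "jump_process \<tau> t \<omega> = of_bool (0 \<le> t \<and> \<tau> \<omega> \<le> ennreal t)"

definition compensated_poisson :: "(real \<Rightarrow> 'a \<Rightarrow> nat) \<Rightarrow> real \<Rightarrow> real \<Rightarrow> 'a \<Rightarrow> real" where
  "compensated_poisson N rate t \<omega> = real (N t \<omega>) - rate * t"

text \<open>The arguments \<open>Z\<close> and \<open>Ap\<close> are the survival process of \<open>\<tau>\<close> and the dual predictable
  projection of its jump process.\<close>

definition compensated_jump ::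
    "('a \<Rightarrow> ennreal) \<Rightarrow> (real \<Rightarrow> 'a \<Rightarrow> real) \<Rightarrow> (real \<Rightarrow> 'a \<Rightarrow> real) \<Rightarrow> real \<Rightarrow> 'a \<Rightarrow> real" where
  "compensated_jump \<tau> Z Ap t \<omega> = jump_process \<tau> t \<omega> -
     (LINT s:{s. 0 < s \<and> s \<le> t \<and> ennreal s \<le> \<tau> \<omega>}|LS_measure (\<lambda>u. Ap u \<omega>).
        1 / left_lim (\<lambda>u. Z u \<omega>) s)"

definition value_at ::
    "(real \<Rightarrow> 'a \<Rightarrow> real) \<Rightarrow> ('a \<Rightarrow> real) \<Rightarrow> ('a \<Rightarrow> ennreal) \<Rightarrow> 'a \<Rightarrow> real" where
  "value_at h h_inf \<tau> \<omega> = (if \<tau> \<omega> = \<infinity> then h_inf \<omega> else h (enn2real (\<tau> \<omega>)) \<omega>)"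

end

theory Submission
  imports Defs
begin

text \<open>
  Since \<open>\<tau>\<close> is independent of \<open>F\<close>, both \<open>Z = z\<close> and \<open>Ap = a = 1 - z\<close> are deterministic, with
  \<open>a t = P(\<tau> \<le> t)\<close>. The traces on \<open>{t < \<tau>}\<close> of the enlarged \<open>\<sigma>\<close>-algebra and of \<open>F\<close> (made
  right-continuous) agree, which gives \<open>Y t = h \<tau>\<close> on \<open>{\<tau> \<le> t}\<close> and \<open>Y t = X t / z t\<close> on
  \<open>{t < \<tau>}\<close>. Almost surely the Poisson process jumps neither at \<open>\<tau>\<close> nor on a set charged by
  \<open>da\<close>, so that \<open>X s = X(s-) - h s \<Delta>a s\<close> for \<open>da\<close>-almost all \<open>s\<close>. The claim is then a pathwise
  partial integration of \<open>X \<cdot> (1/z)\<close> with \<open>d(1/z) = da / (z z\<^sub>-)\<close>, together with the comparison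
  of the jump of \<open>Y\<close> at \<open>\<tau>\<close>.
\<close>

section \<open>Lebesgue--Stieltjes measures\<close>

text \<open>Partial integration is therefore used only at times where \<open>z\<close> is positive,
  a left limit is taken at \<open>\<tau>\<close>, and the contributions of the single time
  \<open>\<tau>\<close> are computed by hand; on the last atom both \<open>X\<close> and the
  integrand \<open>H\<close> are 0, the latter because division by 0 gives 0. The value
  \<open>X / z\<close> before \<open>\<tau>\<close> rests on independence: integrating
  \<open>X\<close> over \<open>B \<inter> {t < \<tau>}\<close> produces the factor
  \<open>z t\<close>. Since right-continuity of \<open>F\<close> is not at hand, \<open>B\<close>
  has to range over \<open>F_{t+}\<close>, and right-continuity of \<open>X\<close> carries its
  conditional expectation property over to \<open>F_{t+}\<close>. The final claim concerns all times
  outside one null set. Each identity between processes is hence obtained at fixed times first and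
  then moved to all times by right-continuity and a countable dense set of times.\<close>

lemma sets_LS_measure [simp, measurable_cong]: "sets (LS_measure V) = sets borel"
  and space_LS_measure [simp]: "space (LS_measure V) = UNIV"
  by (simp_all add: LS_measure_def)

lemma LS_measure_cong: "(\<And>t. 0 \<le> t \<Longrightarrow> V t = W t) \<Longrightarrow> LS_measure V = LS_measure W"
  unfolding LS_measure_def by (intro arg_cong[where f = interval_measure] ext) auto

lemma increasing_pathD:
  assumes "increasing_path V"
  shows "0 \<le> t \<Longrightarrow> 0 \<le> V t" "0 \<le> s \<Longrightarrow> s \<le> t \<Longrightarrow> V s \<le> V t"
    "0 \<le> t \<Longrightarrow> (V \<longlongrightarrow> V t) (at_right t)"
  using assms unfolding increasing_path_def mono_on_def continuous_within
  by (auto intro: order_trans)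

text \<open>These are the properties that the facts about \<open>interval_measure\<close> ask for.
  Setting the path to 0 at negative times turns its value at 0 into a jump, hence into an atom of
  \<open>LS_measure\<close> at 0.\<close>

lemma increasing_path_extension:
  assumes "increasing_path V"
  defines "W \<equiv> \<lambda>t. if t < 0 then 0 else V t"
  shows "x \<le> y \<Longrightarrow> W x \<le> W y" "continuous (at_right t) W" "(W \<longlongrightarrow> 0) at_bot" "0 \<le> W t"
proof -
  show "x \<le> y \<Longrightarrow> W x \<le> W y" "0 \<le> W t"
    using increasing_pathD(1,2)[OF assms(1)] by (auto simp: W_def)
  have "(W \<longlongrightarrow> 0) at_bot \<longleftrightarrow> ((\<lambda>_::real. 0::real) \<longlongrightarrow> 0) at_bot"
    by (intro tendsto_cong) (auto simp: W_def eventually_at_bot_linorder intro!: exI[of _ "-1"])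
  thus "(W \<longlongrightarrow> 0) at_bot" by simp
  show "continuous (at_right t) W"
  proof (cases "t < 0")
    case True
    have "(W \<longlongrightarrow> 0) (at_right t) \<longleftrightarrow> ((\<lambda>_. 0::real) \<longlongrightarrow> 0) (at_right t)"
      by (intro tendsto_cong) (use True in \<open>auto simp: W_def eventually_at_right[of t 0] intro!: exI[of _ 0]\<close>)
    thus ?thesis using True by (simp add: continuous_within W_def)
  next
    case False
    have "(W \<longlongrightarrow> V t) (at_right t) \<longleftrightarrow> (V \<longlongrightarrow> V t) (at_right t)"
      by (intro tendsto_cong) (use False in \<open>auto simp: W_def eventually_at_right[of t "t + 1"] intro!: exI[of _ "t + 1"]\<close>)
    thus ?thesis using False increasing_pathD(3)[OF assms(1)] by (simp add: continuous_within W_def)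
  qed
qed

lemma emeasure_LS_measure_atMost:
  assumes "increasing_path V"
  shows "emeasure (LS_measure V) {..t} = (if t < 0 then 0 else ennreal (V t))"
  unfolding LS_measure_def
  by (subst emeasure_interval_measure_Iic) (use increasing_path_extension[OF assms] in auto)

lemma emeasure_LS_measure_Ioc:
  assumes "increasing_path V" "0 \<le> s" "s \<le> t"
  shows "emeasure (LS_measure V) {s<..t} = ennreal (V t - V s)"
  unfolding LS_measure_def
  by (subst emeasure_interval_measure_Ioc) (use increasing_path_extension[OF assms(1)] assms in auto)

lemma sigma_finite_LS_measure:
  "increasing_path V \<Longrightarrow> sigma_finite_measure (LS_measure V)"
  unfolding LS_measure_def
  by (rule sigma_finite_interval_measure) (use increasing_path_extension in auto)

text \<open>The extended path is 0 on each half-line \<open>{..-1/(n+1)}\<close>, and these exhaust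
  the negative times.\<close>

lemma LS_measure_neg_null:
  assumes "increasing_path V"
  shows "{..<0} \<in> null_sets (LS_measure V)"
proof -
  have "(\<Union>n::nat. {..- (1 / (n + 1))}) \<in> null_sets (LS_measure V)"
    by (intro null_sets_UN null_setsI)
      (auto simp: emeasure_LS_measure_atMost[OF assms])
  moreover have "(\<Union>n::nat. {..- (1 / (n + 1))}) = {..<0::real}"
  proof (intro set_eqI iffI)
    fix x :: real assume "x \<in> {..<0}"
    then obtain n :: nat where "1 / real (Suc n) < - x" using nat_approx_posE[of "-x"] by auto
    thus "x \<in> (\<Union>n::nat. {..- (1 / (n + 1))})" by (auto simp: add.commute intro!: exI[of _ n])
  next
    fix x :: real assume "x \<in> (\<Union>n::nat. {..- (1 / (n + 1))})"
    then obtain n :: nat where "x \<le> - (1 / (real n + 1))" by (auto simp: add.commute)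
    also have "\<dots> < 0" by simp
    finally show "x \<in> {..<0}" by simp
  qed
  ultimately show ?thesis by simp
qed

lemma AE_LS_measure_nonneg: "increasing_path V \<Longrightarrow> AE s in LS_measure V. 0 \<le> s"
  by (rule AE_I'[OF LS_measure_neg_null]) auto

lemma emeasure_LS_measure_Icc:
  assumes "increasing_path V" "0 \<le> t"
  shows "emeasure (LS_measure V) {0..t} = ennreal (V t)"
proof -
  have "emeasure (LS_measure V) {0..t} = emeasure (LS_measure V) {..t}"
    by (intro emeasure_eq_AE, use AE_LS_measure_nonneg[OF assms(1)] in eventually_elim) auto
  thus ?thesis using assms by (simp add: emeasure_LS_measure_atMost)
qed

lemma emeasure_LS_measure_finite:
  assumes "increasing_path V" "A \<subseteq> {..t}"
  shows "emeasure (LS_measure V) A < \<infinity>"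
proof -
  have "emeasure (LS_measure V) A \<le> emeasure (LS_measure V) {..t}"
    using assms by (intro emeasure_mono) auto
  also have "\<dots> < \<infinity>" by (simp add: emeasure_LS_measure_atMost[OF assms(1)])
  finally show ?thesis .
qed

lemma emeasure_LS_measure_0:
  assumes "increasing_path V"
  shows "emeasure (LS_measure V) {0} = ennreal (V 0)"
  using emeasure_LS_measure_Icc[OF assms, of 0] by simp

lemma tendsto_at_left_seq:
  fixes f :: "real \<Rightarrow> real"
  assumes "(f \<longlongrightarrow> l) (at_left t)"
  shows "(\<lambda>n. f (t - 1 / real (Suc n))) \<longlonglongrightarrow> l"
proof -
  have "filterlim (\<lambda>n. t - 1 / real (Suc n)) (at_left t) sequentially"
    unfolding filterlim_at
    using tendsto_diff[OF tendsto_const[of t] LIMSEQ_inverse_real_of_nat] by (auto simp: inverse_eq_divide)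
  thus ?thesis using assms by (rule filterlim_compose[rotated])
qed

lemma left_lim_eq: "(f \<longlongrightarrow> l) (at_left t) \<Longrightarrow> left_lim f t = l"
  unfolding left_lim_def by (rule tendsto_Lim) auto

lemma left_lim_cong:
  assumes "0 < t" "\<And>s. 0 \<le> s \<Longrightarrow> s < t \<Longrightarrow> f s = g s"
  shows "left_lim f t = left_lim g t"
proof -
  have "(f \<longlongrightarrow> l) (at_left t) = (g \<longlongrightarrow> l) (at_left t)" for l
    by (intro tendsto_cong) (use assms in \<open>auto simp: eventually_at_left[OF assms(1)] intro!: exI[of _ 0]\<close>)
  thus ?thesis by (simp add: left_lim_def Topological_Spaces.Lim_def)
qed

text \<open>Monotonicity makes the left limit a supremum. As \<open>left_lim\<close> is meaningful
  only where a limit exists, existence has to precede every use of it.\<close>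

lemma increasing_path_left_limit:
  assumes "increasing_path V" "0 < t"
  shows "(V \<longlongrightarrow> left_lim V t) (at_left t)"
    and "\<And>s. 0 \<le> s \<Longrightarrow> s < t \<Longrightarrow> V s \<le> left_lim V t" "left_lim V t \<le> V t" "0 \<le> left_lim V t"
proof -
  note V = increasing_pathD[OF assms(1)]
  define W where "W s = (if s < 0 then 0 else V s)" for s
  \<comment> \<open>The supremum runs over the extended path, whose value at -1 is 0: the set is
    nonempty and its supremum nonnegative.\<close>
  define l where "l = Sup (W ` {..<t})"
  have W: "x \<le> y \<Longrightarrow> W x \<le> W y" for x y using V by (auto simp: W_def)
  have bdd: "bdd_above (W ` {..<t})" using W by (intro bdd_aboveI2[of _ _ "W t"]) auto
  have up: "W s \<le> l" if "s < t" for s unfolding l_def using that bdd by (intro cSUP_upper) auto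
  have "(W \<longlongrightarrow> l) (at_left t)"
  proof (rule order_tendstoI)
    fix a assume "a < l"
    then obtain s where s: "s < t" "a < W s"
      using less_cSUP_iff[OF _ bdd, of a] by (auto simp: l_def)
    thus "\<forall>\<^sub>F x in at_left t. a < W x"
      unfolding eventually_at_left[OF s(1)] using W by (intro exI[of _ s]) (auto intro: less_le_trans)
  next
    fix a assume "l < a"
    thus "\<forall>\<^sub>F x in at_left t. W x < a"
      unfolding eventually_at_left[OF assms(2)] using up assms(2) by (intro exI[of _ 0]) (auto intro: le_less_trans)
  qed
  moreover have "(W \<longlongrightarrow> l) (at_left t) = (V \<longlongrightarrow> l) (at_left t)"
    by (intro tendsto_cong) (use assms in \<open>auto simp: W_def eventually_at_left[OF assms(2)] intro!: exI[of _ 0]\<close>)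
  ultimately have l: "(V \<longlongrightarrow> l) (at_left t)" by simp
  hence eq: "left_lim V t = l" by (rule left_lim_eq)
  show "(V \<longlongrightarrow> left_lim V t) (at_left t)" using l eq by simp
  show "V s \<le> left_lim V t" if "0 \<le> s" "s < t" for s using up[OF that(2)] that by (simp add: eq W_def)
  show "0 \<le> left_lim V t" using up[of "-1"] assms by (simp add: eq W_def)
  have "l \<le> W t" unfolding l_def using W by (intro cSUP_least) auto
  thus "left_lim V t \<le> V t" using assms by (simp add: eq W_def)
qed

text \<open>Continuity from below along the half-lines ending at \<open>t - 1/(n+1)\<close>;
  negative times are null.\<close>

lemma emeasure_LS_measure_Ico:
  assumes "increasing_path V" "0 < t"
  shows "emeasure (LS_measure V) {0..<t} = ennreal (left_lim V t)"
proof -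
  have "(\<lambda>n. emeasure (LS_measure V) {..t - 1 / real (Suc n)}) \<longlonglongrightarrow> emeasure (LS_measure V) (\<Union>n. {..t - 1 / real (Suc n)})"
    by (intro Lim_emeasure_incseq incseq_SucI) (auto intro: order_trans simp: frac_le)
  moreover have "(\<Union>n. {..t - 1 / real (Suc n)}) = {..<t}"
  proof (intro set_eqI iffI)
    fix x :: real assume "x \<in> {..<t}"
    then obtain n :: nat where "1 / real (Suc n) < t - x" using nat_approx_posE[of "t - x"] by auto
    thus "x \<in> (\<Union>n. {..t - 1 / real (Suc n)})" by (auto intro!: exI[of _ n])
  next
    fix x :: real assume "x \<in> (\<Union>n. {..t - 1 / real (Suc n)})"
    then obtain n :: nat where "x \<le> t - 1 / real (Suc n)" by auto
    also have "\<dots> < t" by simp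
    finally show "x \<in> {..<t}" by simp
  qed
  moreover have "(\<lambda>n. emeasure (LS_measure V) {..t - 1 / real (Suc n)}) \<longlonglongrightarrow> ennreal (left_lim V t)"
  proof -
    have "(\<lambda>n. ennreal (V (t - 1 / real (Suc n)))) \<longlonglongrightarrow> ennreal (left_lim V t)"
      by (intro tendsto_ennrealI tendsto_at_left_seq increasing_path_left_limit assms)
    \<comment> \<open>For such \<open>n\<close> the end point is positive, so that the mass of the
      half-line is given by \<open>V\<close> and not by the zero extension.\<close>
    moreover have "\<forall>\<^sub>F n in sequentially. 1 / real (Suc n) < t"
      using order_tendstoD(2)[OF LIMSEQ_inverse_real_of_nat assms(2)] by (simp add: inverse_eq_divide)
    hence "\<forall>\<^sub>F n in sequentially. emeasure (LS_measure V) {..t - 1 / real (Suc n)} = ennreal (V (t - 1 / real (Suc n)))"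
      by eventually_elim (simp add: emeasure_LS_measure_atMost[OF assms(1)])
    ultimately show ?thesis by (simp add: tendsto_cong)
  qed
  moreover have "emeasure (LS_measure V) {0..<t} = emeasure (LS_measure V) {..<t}"
    by (intro emeasure_eq_AE, use AE_LS_measure_nonneg[OF assms(1)] in eventually_elim) auto
  ultimately show ?thesis using LIMSEQ_unique by metis
qed

lemma measure_LS_measure_singleton:
  assumes "increasing_path V" "0 < t"
  shows "measure (LS_measure V) {t} = V t - left_lim V t"
proof -
  have "{t} = {0..t} - {0..<t}" using assms by auto
  moreover have "measure (LS_measure V) ({0..t} - {0..<t}) = measure (LS_measure V) {0..t} - measure (LS_measure V) {0..<t}"
    by (rule measure_Diff) (use emeasure_LS_measure_finite[OF assms(1), of "{0..t}" t] in auto)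
  ultimately have "measure (LS_measure V) {t} = measure (LS_measure V) {0..t} - measure (LS_measure V) {0..<t}"
    by simp
  also have "\<dots> = V t - left_lim V t"
    using emeasure_LS_measure_Ico[OF assms] emeasure_LS_measure_Icc[OF assms(1), of t]
      increasing_path_left_limit(4)[OF assms] assms increasing_pathD(1)[OF assms(1), of t]
    by (simp add: measure_def)
  finally show ?thesis .
qed

text \<open>Half-lines are stable under intersection and generate the Borel sets. This later
  identifies the Dirac mass at \<open>\<tau>\<close>, the law of \<open>\<tau>\<close>, and the
  measure of the compensator \<open>B\<close>.\<close>

lemma LS_measure_unique:
  assumes "increasing_path V" and sets: "sets \<mu> = sets borel"
    and "\<And>t. emeasure \<mu> {..t} = (if t < 0 then 0 else ennreal (V t))"
  shows "\<mu> = LS_measure V"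
proof (rule measure_eqI_generator_eq[where E = "range (\<lambda>t. {..t})" and \<Omega> = UNIV and A = "\<lambda>n. {..real n}"])
  show "Int_stable (range (\<lambda>t::real. {..t}))"
    by (auto simp: Int_stable_def intro!: exI[of _ "min _ _"])
  show "sets \<mu> = sigma_sets UNIV (range (\<lambda>t. {..t}))"
    "sets (LS_measure V) = sigma_sets UNIV (range (\<lambda>t. {..t}))"
    using sets by (simp_all add: borel_eq_atMost)
  show "(\<Union>n. {..real n}) = UNIV" using real_arch_simple by auto
qed (use assms in \<open>auto simp: emeasure_LS_measure_atMost\<close>)

lemma has_LS_integral_cong:
  assumes "\<And>s. 0 \<le> s \<Longrightarrow> V s = W s" "\<And>s. 0 < s \<Longrightarrow> s \<le> t \<Longrightarrow> H s = K s"
  shows "has_LS_integral V H t I \<longleftrightarrow> has_LS_integral W K t I"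
proof -
  have 1: "set_integrable \<mu> {0<..t} H \<longleftrightarrow> set_integrable \<mu> {0<..t} K" for \<mu> :: "real measure"
    unfolding set_integrable_def by (intro Bochner_Integration.integrable_cong) (use assms(2) in \<open>auto simp: indicator_def\<close>)
  have 2: "(LINT s:{0<..t}|\<mu>. H s) = (LINT s:{0<..t}|\<mu>. K s)" for \<mu> :: "real measure"
    unfolding set_lebesgue_integral_def by (intro Bochner_Integration.integral_cong) (use assms(2) in \<open>auto simp: indicator_def\<close>)
  show ?thesis unfolding has_LS_integral_def 1 2 using assms(1) by auto
qed

section \<open>Sums of Stieltjes measures and independence of the integral from the
  decomposition\<close>

definition sum_measure :: "'b measure \<Rightarrow> 'b measure \<Rightarrow> 'b measure" where
  "sum_measure \<mu> \<nu> = measure_of (space \<mu>) (sets \<mu>) (\<lambda>A. emeasure \<mu> A + emeasure \<nu> A)"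

lemma sets_sum_measure [simp, measurable_cong]: "sets (sum_measure \<mu> \<nu>) = sets \<mu>"
  and space_sum_measure [simp]: "space (sum_measure \<mu> \<nu>) = space \<mu>"
  by (simp_all add: sum_measure_def)

lemma emeasure_sum_measure:
  assumes "sets \<nu> = sets \<mu>" "A \<in> sets \<mu>"
  shows "emeasure (sum_measure \<mu> \<nu>) A = emeasure \<mu> A + emeasure \<nu> A"
proof (rule emeasure_measure_of[OF sum_measure_def])
  show "countably_additive (sets (sum_measure \<mu> \<nu>)) (\<lambda>A. emeasure \<mu> A + emeasure \<nu> A)"
  proof (rule countably_additiveI)
    fix A :: "nat \<Rightarrow> _" assume A: "range A \<subseteq> sets (sum_measure \<mu> \<nu>)" "disjoint_family A"
    have "(\<Sum>i. emeasure \<mu> (A i) + emeasure \<nu> (A i)) = (\<Sum>i. emeasure \<mu> (A i)) + (\<Sum>i. emeasure \<nu> (A i))"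
      by (simp add: suminf_add)
    also have "\<dots> = emeasure \<mu> (\<Union> (range A)) + emeasure \<nu> (\<Union> (range A))"
      using A assms(1) by (subst (1 2) suminf_emeasure) auto
    finally show "(\<Sum>i. emeasure \<mu> (A i) + emeasure \<nu> (A i)) = emeasure \<mu> (\<Union> (range A)) + emeasure \<nu> (\<Union> (range A))" .
  qed
qed (use assms sets.space_closed in \<open>auto simp: positive_def\<close>)

lemma nn_integral_sum_measure:
  assumes "sets \<nu> = sets \<mu>" "f \<in> borel_measurable \<mu>"
  shows "(\<integral>\<^sup>+x. f x \<partial>sum_measure \<mu> \<nu>) = (\<integral>\<^sup>+x. f x \<partial>\<mu>) + (\<integral>\<^sup>+x. f x \<partial>\<nu>)"
  using assms(2)
proof (induction rule: borel_measurable_induct)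
  case (cong f g)
  have "space \<nu> = space \<mu>" using assms(1) by (rule sets_eq_imp_space_eq)
  hence "(\<integral>\<^sup>+x. f x \<partial>\<mu>) = (\<integral>\<^sup>+x. g x \<partial>\<mu>)" "(\<integral>\<^sup>+x. f x \<partial>\<nu>) = (\<integral>\<^sup>+x. g x \<partial>\<nu>)"
    "(\<integral>\<^sup>+x. f x \<partial>sum_measure \<mu> \<nu>) = (\<integral>\<^sup>+x. g x \<partial>sum_measure \<mu> \<nu>)"
    using cong(3) by (auto intro!: nn_integral_cong)
  thus ?case using cong(4) by simp
next
  case (set A)
  thus ?case using assms(1) by (simp add: emeasure_sum_measure)
next
  case (mult u c)
  hence [measurable]: "u \<in> borel_measurable \<nu>" using assms(1) by (simp cong: measurable_cong_sets)
  show ?case using mult by (simp add: nn_integral_cmult distrib_left)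
next
  case (add u v)
  hence [measurable]: "u \<in> borel_measurable \<nu>" "v \<in> borel_measurable \<nu>"
    using assms(1) by (simp_all cong: measurable_cong_sets)
  show ?case using add by (simp add: nn_integral_add)
next
  case (seq U)
  hence [measurable]: "\<And>i. U i \<in> borel_measurable \<nu>"
    using assms(1) by (simp_all cong: measurable_cong_sets)
  have inc: "incseq (\<lambda>i. \<integral>\<^sup>+x. U i x \<partial>\<mu>)" "incseq (\<lambda>i. \<integral>\<^sup>+x. U i x \<partial>\<nu>)"
    using incseqD[OF \<open>incseq U\<close>] unfolding incseq_def
    by (intro allI impI nn_integral_mono; blast dest: le_funD)+
  have f: "\<Squnion> (range U) = (\<lambda>x. SUP i. U i x)" by (rule ext) (simp only: SUP_apply)
  have "(\<integral>\<^sup>+x. (SUP i. U i x) \<partial>\<kappa>) = (SUP i. \<integral>\<^sup>+x. U i x \<partial>\<kappa>)"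
    if "sets \<kappa> = sets \<mu>" for \<kappa>
    using \<open>incseq U\<close> seq(1) that
    by (intro nn_integral_monotone_convergence_SUP) (auto cong: measurable_cong_sets)
  thus ?case unfolding f using seq.IH assms(1) by (simp add: ennreal_SUP_add[OF inc])
qed

lemma integral_sum_measure:
  fixes f :: "'b \<Rightarrow> real"
  assumes sets: "sets \<nu> = sets \<mu>" and i: "integrable \<mu> f" "integrable \<nu> f"
  shows "integrable (sum_measure \<mu> \<nu>) f"
    and "(\<integral>x. f x \<partial>sum_measure \<mu> \<nu>) = (\<integral>x. f x \<partial>\<mu>) + (\<integral>x. f x \<partial>\<nu>)"
proof -
  note [measurable] = borel_measurable_integrable[OF i(1)]
  show s: "integrable (sum_measure \<mu> \<nu>) f"
    using i by (auto simp: integrable_iff_bounded nn_integral_sum_measure[OF sets])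
  show "(\<integral>x. f x \<partial>sum_measure \<mu> \<nu>) = (\<integral>x. f x \<partial>\<mu>) + (\<integral>x. f x \<partial>\<nu>)"
    using i unfolding real_lebesgue_integral_def[OF s] real_lebesgue_integral_def[OF i(1)]
      real_lebesgue_integral_def[OF i(2)] real_integrable_def
    by (simp add: nn_integral_sum_measure[OF sets] enn2real_plus less_top)
qed

lemma increasing_path_add:
  assumes "increasing_path P" "increasing_path Q"
  shows "increasing_path (\<lambda>s. P s + Q s)"
  using assms unfolding increasing_path_def by (auto intro!: monotone_onI add_mono continuous_intros dest: monotone_onD)

lemma LS_measure_add:
  assumes "increasing_path P" "increasing_path Q"
  shows "LS_measure (\<lambda>s. P s + Q s) = sum_measure (LS_measure P) (LS_measure Q)"
  by (rule LS_measure_unique[symmetric])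
    (use assms increasing_pathD(1)[OF assms(1)] increasing_pathD(1)[OF assms(2)] in
      \<open>auto simp: increasing_path_add emeasure_sum_measure emeasure_LS_measure_atMost\<close>)

text \<open>\<open>P + Q' = P' + Q\<close> is an identity between increasing paths, hence between
  their measures; integrating \<open>H\<close> against both sides and rearranging gives the
  claim.\<close>

lemma LS_integral_decomposition_unique:
  fixes H :: "real \<Rightarrow> real"
  assumes inc: "increasing_path P" "increasing_path Q" "increasing_path P'" "increasing_path Q'"
    and eq: "\<And>s. 0 \<le> s \<Longrightarrow> P s - Q s = P' s - Q' s"
    and int: "set_integrable (LS_measure P) A H" "set_integrable (LS_measure Q) A H"
      "set_integrable (LS_measure P') A H" "set_integrable (LS_measure Q') A H"
  shows "(LINT s:A|LS_measure P. H s) - (LINT s:A|LS_measure Q. H s) =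
    (LINT s:A|LS_measure P'. H s) - (LINT s:A|LS_measure Q'. H s)"
proof -
  have "LS_measure (\<lambda>s. P s + Q' s) = LS_measure (\<lambda>s. P' s + Q s)"
    using eq by (intro LS_measure_cong) (simp add: algebra_simps)
  hence "sum_measure (LS_measure P) (LS_measure Q') = sum_measure (LS_measure P') (LS_measure Q)"
    using inc by (simp add: LS_measure_add)
  moreover have "(LINT s:A|sum_measure \<mu> \<nu>. H s) = (LINT s:A|\<mu>. H s) + (LINT s:A|\<nu>. H s)"
    if "sets \<nu> = sets \<mu>" "set_integrable \<mu> A H" "set_integrable \<nu> A H" for \<mu> \<nu>
    using that unfolding set_lebesgue_integral_def set_integrable_def by (rule integral_sum_measure(2))
  from this[OF _ int(1,4)] this[OF _ int(3,2)]
  have "(LINT s:A|sum_measure (LS_measure P) (LS_measure Q'). H s) =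
      (LINT s:A|LS_measure P. H s) + (LINT s:A|LS_measure Q'. H s)"
    "(LINT s:A|sum_measure (LS_measure P') (LS_measure Q). H s) =
      (LINT s:A|LS_measure P'. H s) + (LINT s:A|LS_measure Q. H s)" by simp_all
  ultimately show ?thesis by simp
qed

text \<open>The representation of \<open>\<mu>\<close> supplies a decomposition for each time
  separately. One that serves at time \<open>t\<close> serves at every earlier \<open>u\<close>, so
  that a single pair \<open>P\<close>, \<open>Q\<close> describes the path on all of
  \<open>(0,t]\<close>.\<close>

lemma has_LS_integral_decomposition:
  assumes I: "has_LS_integral V H u I"
    and inc: "increasing_path P" "increasing_path Q" and V: "\<And>s. 0 \<le> s \<Longrightarrow> V s = P s - Q s"
    and int: "set_integrable (LS_measure P) {0<..t} H" "set_integrable (LS_measure Q) {0<..t} H"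
    and ut: "u \<le> t"
  shows "I = (LINT s:{0<..u}|LS_measure P. H s) - (LINT s:{0<..u}|LS_measure Q. H s)"
proof -
  obtain P' Q' where *: "increasing_path P'" "increasing_path Q'" "\<And>s. 0 \<le> s \<Longrightarrow> V s = P' s - Q' s"
    "set_integrable (LS_measure P') {0<..u} H" "set_integrable (LS_measure Q') {0<..u} H"
    "I = (LINT s:{0<..u}|LS_measure P'. H s) - (LINT s:{0<..u}|LS_measure Q'. H s)"
    using I unfolding has_LS_integral_def by blast
  have "set_integrable (LS_measure P) {0<..u} H" "set_integrable (LS_measure Q) {0<..u} H"
    by (rule set_integrable_subset[OF int(1)] set_integrable_subset[OF int(2)]; use ut in auto)+
  thus ?thesis using * V inc by (simp add: LS_integral_decomposition_unique[of P' Q' P Q "{0<..u}" H])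
qed

text \<open>Integration by parts for a product of distribution functions: the square is cut along
  its diagonal, which goes to the second term. Hence one factor enters with its left limit
  \<open>{0..<s}\<close> and the other with its full value \<open>{0..s}\<close>.\<close>

lemma emeasure_square_split:
  fixes \<mu> \<nu> :: "real measure"
  assumes [measurable_cong]: "sets \<mu> = sets borel" "sets \<nu> = sets borel"
    and "sigma_finite_measure \<mu>" "sigma_finite_measure \<nu>"
  shows "emeasure \<mu> {0..u} * emeasure \<nu> {0..u} =
    (\<integral>\<^sup>+s\<in>{0..u}. emeasure \<mu> {0..<s} \<partial>\<nu>) + (\<integral>\<^sup>+s\<in>{0..u}. emeasure \<nu> {0..s} \<partial>\<mu>)"
proof -
  interpret pair_sigma_finite \<mu> \<nu> using assms(3,4) by (simp add: pair_sigma_finite_def)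
  define f :: "real \<times> real \<Rightarrow> ennreal" where "f = indicator {(x, y). 0 \<le> x \<and> x < y \<and> y \<le> u}"
  define g :: "real \<times> real \<Rightarrow> ennreal" where "g = indicator {(x, y). 0 \<le> y \<and> y \<le> x \<and> x \<le> u}"
  have sp: "space \<mu> = UNIV" "space \<nu> = UNIV" using assms(1,2)[THEN sets_eq_imp_space_eq] by auto
  have "{(x, y). 0 \<le> x \<and> x < y \<and> y \<le> u} = {p\<in>space (\<mu> \<Otimes>\<^sub>M \<nu>). 0 \<le> fst p \<and> fst p < snd p \<and> snd p \<le> u}"
    "{(x, y). 0 \<le> y \<and> y \<le> x \<and> x \<le> u} = {p\<in>space (\<mu> \<Otimes>\<^sub>M \<nu>). 0 \<le> snd p \<and> snd p \<le> fst p \<and> fst p \<le> u}"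
    by (auto simp: space_pair_measure sp)
  moreover have "{p\<in>space (\<mu> \<Otimes>\<^sub>M \<nu>). 0 \<le> fst p \<and> fst p < snd p \<and> snd p \<le> u} \<in> sets (\<mu> \<Otimes>\<^sub>M \<nu>)"
    "{p\<in>space (\<mu> \<Otimes>\<^sub>M \<nu>). 0 \<le> snd p \<and> snd p \<le> fst p \<and> fst p \<le> u} \<in> sets (\<mu> \<Otimes>\<^sub>M \<nu>)"
    by measurable
  ultimately have [measurable]: "f \<in> borel_measurable (\<mu> \<Otimes>\<^sub>M \<nu>)" "g \<in> borel_measurable (\<mu> \<Otimes>\<^sub>M \<nu>)"
    unfolding f_def g_def by auto
  have "emeasure \<mu> {0..u} * emeasure \<nu> {0..u} = (\<integral>\<^sup>+p. indicator ({0..u} \<times> {0..u}) p \<partial>(\<mu> \<Otimes>\<^sub>M \<nu>))"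
    by (subst nn_integral_indicator) (auto simp: M2.emeasure_pair_measure_Times)
  also have "\<dots> = (\<integral>\<^sup>+p. f p + g p \<partial>(\<mu> \<Otimes>\<^sub>M \<nu>))"
    by (intro nn_integral_cong) (auto simp: f_def g_def indicator_def)
  also have "\<dots> = (\<integral>\<^sup>+p. f p \<partial>(\<mu> \<Otimes>\<^sub>M \<nu>)) + (\<integral>\<^sup>+p. g p \<partial>(\<mu> \<Otimes>\<^sub>M \<nu>))"
    by (rule nn_integral_add) auto
  also have "(\<integral>\<^sup>+p. f p \<partial>(\<mu> \<Otimes>\<^sub>M \<nu>)) = (\<integral>\<^sup>+y. \<integral>\<^sup>+x. f (x, y) \<partial>\<mu> \<partial>\<nu>)"
    using nn_integral_snd[of f] by simp
  also have "\<dots> = (\<integral>\<^sup>+s\<in>{0..u}. emeasure \<mu> {0..<s} \<partial>\<nu>)"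
  proof (rule nn_integral_cong)
    fix y
    have "(\<integral>\<^sup>+x. f (x, y) \<partial>\<mu>) = (\<integral>\<^sup>+x. indicator {0..<y} x * indicator {0..u} y \<partial>\<mu>)"
      by (intro nn_integral_cong) (auto simp: f_def indicator_def)
    thus "(\<integral>\<^sup>+x. f (x, y) \<partial>\<mu>) = emeasure \<mu> {0..<y} * indicator {0..u} y"
      by (simp add: nn_integral_multc)
  qed
  also have "(\<integral>\<^sup>+p. g p \<partial>(\<mu> \<Otimes>\<^sub>M \<nu>)) = (\<integral>\<^sup>+x. \<integral>\<^sup>+y. g (x, y) \<partial>\<nu> \<partial>\<mu>)"
    using M2.nn_integral_fst[of g \<mu>] by simp
  also have "\<dots> = (\<integral>\<^sup>+s\<in>{0..u}. emeasure \<nu> {0..s} \<partial>\<mu>)"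
  proof (rule nn_integral_cong)
    fix y
    have "(\<integral>\<^sup>+x. g (y, x) \<partial>\<nu>) = (\<integral>\<^sup>+x. indicator {0..y} x * indicator {0..u} y \<partial>\<nu>)"
      by (intro nn_integral_cong) (auto simp: g_def indicator_def)
    thus "(\<integral>\<^sup>+x. g (y, x) \<partial>\<nu>) = emeasure \<nu> {0..y} * indicator {0..u} y"
      by (simp add: nn_integral_multc)
  qed
  finally show ?thesis .
qed

section \<open>Partial integration against the reciprocal survival function\<close>

locale sub_distribution =
  fixes a :: "real \<Rightarrow> real"
  assumes inc: "increasing_path a" and le1: "\<And>t. 0 \<le> t \<Longrightarrow> a t \<le> 1"
begin

definition z where "z t = 1 - a t"

text \<open>A left limit written as a mass: it is monotone and hence Borel without any question of
  existence, and it equals 1 at \<open>s = 0\<close>, in accordance with the convention for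
  \<open>Z\<close> at time \<open>0-\<close>.\<close>

definition z_left where "z_left s = 1 - measure (LS_measure a) {0..<s}"

lemma a_nonneg: "0 \<le> t \<Longrightarrow> 0 \<le> a t" using increasing_pathD(1)[OF inc] .
lemma z_nonneg: "0 \<le> t \<Longrightarrow> 0 \<le> z t" using le1 by (simp add: z_def)
lemma z_le1: "0 \<le> t \<Longrightarrow> z t \<le> 1" using a_nonneg by (simp add: z_def)
lemma z_antimono: "0 \<le> s \<Longrightarrow> s \<le> t \<Longrightarrow> z t \<le> z s"
  using increasing_pathD(2)[OF inc] by (simp add: z_def)

lemma measure_Ico: "measure (LS_measure a) {0..<s} = (if 0 < s then left_lim a s else 0)"
  using emeasure_LS_measure_Ico[OF inc] increasing_path_left_limit(4)[OF inc]
  by (auto simp: measure_def)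

lemma z_left_eq: "0 < s \<Longrightarrow> z_left s = 1 - left_lim a s"
  by (simp add: z_left_def measure_Ico)

lemma z_tendsto_left: "0 < s \<Longrightarrow> (z \<longlongrightarrow> z_left s) (at_left s)"
  unfolding z_def z_left_eq by (intro tendsto_intros increasing_path_left_limit(1)[OF inc])

lemma left_lim_z: "0 < s \<Longrightarrow> left_lim z s = z_left s"
  by (rule left_lim_eq[OF z_tendsto_left])

text \<open>Equivalently, \<open>z_left\<close> without the atom of \<open>a\<close> is
  \<open>z\<close>; this is why the denominator \<open>Z_- - \<Delta>A^p\<close> of the theorem
  appears as \<open>z\<close> in \<open>H\<close> below.\<close>

lemma z_left_eq_plus: "0 < s \<Longrightarrow> z_left s = z s + measure (LS_measure a) {s}"
  by (simp add: z_left_eq z_def measure_LS_measure_singleton[OF inc])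

lemma z_le_z_left: "0 < s \<Longrightarrow> z s \<le> z_left s"
  by (simp add: z_left_eq_plus)

lemma z_left_le_z: "0 \<le> u \<Longrightarrow> u < s \<Longrightarrow> z_left s \<le> z u"
  using increasing_path_left_limit(2)[OF inc, of s u] by (simp add: z_left_eq z_def)

lemma z_left_nonneg: "0 < s \<Longrightarrow> 0 \<le> z_left s"
  using z_le_z_left[of s] z_nonneg[of s] by simp

lemma z_left_le1: "z_left s \<le> 1" by (simp add: z_left_def)

lemma z_left_ge:
  assumes "0 < s" "\<And>u. 0 \<le> u \<Longrightarrow> u < s \<Longrightarrow> c \<le> z u"
  shows "c \<le> z_left s"
  by (rule tendsto_lowerbound[OF z_tendsto_left[OF assms(1)]])
    (use assms in \<open>auto simp: eventually_at_left[OF assms(1)] intro!: exI[of _ 0]\<close>)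

lemma borel_measurable_z_left [measurable]: "z_left \<in> borel_measurable borel"
proof -
  have "mono (\<lambda>s. measure (LS_measure a) {0..<s})"
  proof (intro monoI)
    fix s t :: real assume st: "s \<le> t"
    show "measure (LS_measure a) {0..<s} \<le> measure (LS_measure a) {0..<t}"
    proof (rule measure_mono_fmeasurable)
      show "{0..<t} \<in> fmeasurable (LS_measure a)"
        using emeasure_LS_measure_finite[OF inc, of "{0..<t}" t] by (auto intro: fmeasurableI simp: subset_eq)
    qed (use st in auto)
  qed
  hence "(\<lambda>s. measure (LS_measure a) {0..<s}) \<in> borel_measurable borel" by (rule borel_measurable_mono)
  thus ?thesis unfolding z_left_def[abs_def] by measurable
qed

end

text \<open>\<open>v\<close> is \<open>1/z\<close> frozen at a time \<open>T\<close> where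
  \<open>z\<close> is still positive. Freezing keeps it finite and increasing on the whole half-line
  even if \<open>z\<close> reaches 0 later, so that \<open>LS_measure v\<close> makes sense.\<close>

locale sub_distribution_at = sub_distribution +
  fixes T :: real
  assumes T: "0 \<le> T" "0 < z T"
begin

definition v where "v t = 1 / z (min t T)"

lemma z_ge: "0 \<le> t \<Longrightarrow> z T \<le> z (min t T)"
  using T by (intro z_antimono) auto

lemma z_pos: "0 \<le> t \<Longrightarrow> 0 < z (min t T)" using z_ge[of t] T by linarith

lemma z_left_ge_z: "s \<le> T \<Longrightarrow> z T \<le> z_left s"
proof (cases "0 < s")
  case True
  assume "s \<le> T"
  hence "z T \<le> z s" using True by (intro z_antimono) auto
  thus ?thesis using z_le_z_left[OF True] by simp
next
  case False
  thus ?thesis using z_le1[OF T(1)] by (simp add: z_left_def)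
qed

lemma inc_v: "increasing_path v"
  unfolding increasing_path_def
proof (intro conjI allI impI)
  show "0 \<le> v 0" using z_nonneg[of 0] T by (simp add: v_def)
  show "mono_on {0..} v"
  proof (rule monotone_onI)
    fix s t :: real assume st: "s \<in> {0..}" "t \<in> {0..}" "s \<le> t"
    show "v s \<le> v t" unfolding v_def
      using st T z_pos[of t] z_pos[of s] by (intro divide_left_mono z_antimono mult_pos_pos) auto
  qed
  fix t :: real assume t: "0 \<le> t"
  have "(a \<longlongrightarrow> a s) (at_right s)" if "0 \<le> s" for s by (rule increasing_pathD(3)[OF inc that])
  hence z: "(z \<longlongrightarrow> z s) (at_right s)" if "0 \<le> s" for s unfolding z_def using that by (intro tendsto_intros)
  have "(v \<longlongrightarrow> v t) (at_right t)"
  proof (cases "t < T")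
    case True
    have "(v \<longlongrightarrow> v t) (at_right t) \<longleftrightarrow> ((\<lambda>t. 1 / z t) \<longlongrightarrow> 1 / z t) (at_right t)"
      unfolding v_def using True
      by (simp, intro tendsto_cong) (auto simp: eventually_at_right[OF True] intro!: exI[of _ T])
    thus ?thesis using z[OF t] z_pos[OF t] True by (auto intro!: tendsto_intros)
  next
    case False
    have "(v \<longlongrightarrow> v t) (at_right t) \<longleftrightarrow> ((\<lambda>_. v t) \<longlongrightarrow> v t) (at_right t)"
      by (intro tendsto_cong) (use False in \<open>auto simp: v_def eventually_at_right[of t "t + 1"] intro!: exI[of _ "t + 1"]\<close>)
    thus ?thesis by simp
  qed
  thus "continuous (at_right t) v" by (simp add: continuous_within)
qed

lemma v_nonneg: "0 \<le> t \<Longrightarrow> 0 \<le> v t" using z_pos[of t] by (simp add: v_def)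

lemma borel_measurable_v': "(\<lambda>s. if s < 0 then 0 else v s) \<in> borel_measurable borel"
  by (rule borel_measurable_mono) (use increasing_path_extension(1)[OF inc_v] in \<open>auto simp: mono_def\<close>)

text \<open>The relation \<open>z_- dv = v da\<close> in integrated form; the summand 1 is the
  constant value of \<open>v z\<close>. From \<open>v = 1 + a v\<close> and the splitting of
  \<open>a v\<close> along the diagonal one obtains integrals of \<open>a_-\<close> against
  \<open>dv\<close> and of \<open>v\<close> against \<open>da\<close>, and
  \<open>a_- = 1 - z_-\<close> does the rest.\<close>

lemma reciprocal_Icc:
  assumes u: "0 \<le> u" "u \<le> T"
  shows "(\<integral>\<^sup>+s\<in>{0..u}. ennreal (z_left s) \<partial>LS_measure v) = 1 + (\<integral>\<^sup>+s\<in>{0..u}. ennreal (v s) \<partial>LS_measure a)"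
proof -
  note [measurable] = borel_measurable_v'
  define al where "al s = measure (LS_measure a) {0..<s}" for s
  have al: "al s = 1 - z_left s" for s by (simp add: al_def z_left_def)
  have [measurable]: "al \<in> borel_measurable borel" unfolding al[abs_def] by measurable
  have em: "emeasure (LS_measure a) {0..<s} = ennreal (al s)" for s
    using emeasure_LS_measure_finite[OF inc, of "{0..<s}" s] unfolding al_def
    by (subst emeasure_eq_ennreal_measure) (auto simp: subset_eq)
  have au: "emeasure (LS_measure a) {0..u} = ennreal (a u)" and vu: "emeasure (LS_measure v) {0..u} = ennreal (v u)"
    using u by (simp_all add: emeasure_LS_measure_Icc inc inc_v)
  have 1: "ennreal (a u) * ennreal (v u) =
      (\<integral>\<^sup>+s\<in>{0..u}. ennreal (al s) \<partial>LS_measure v) + (\<integral>\<^sup>+s\<in>{0..u}. ennreal (v s) \<partial>LS_measure a)" (is "_ = ?A + ?B")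
  proof -
    have "ennreal (a u) * ennreal (v u) = (\<integral>\<^sup>+s\<in>{0..u}. emeasure (LS_measure a) {0..<s} \<partial>LS_measure v) +
      (\<integral>\<^sup>+s\<in>{0..u}. emeasure (LS_measure v) {0..s} \<partial>LS_measure a)"
      using emeasure_square_split[of "LS_measure a" "LS_measure v" u] inc inc_v
      by (simp add: sigma_finite_LS_measure au vu)
    also have "(\<integral>\<^sup>+s\<in>{0..u}. emeasure (LS_measure v) {0..s} \<partial>LS_measure a) = ?B"
      by (intro nn_integral_cong) (auto simp: emeasure_LS_measure_Icc[OF inc_v] indicator_def)
    finally show ?thesis by (simp add: em)
  qed
  have 2: "(\<integral>\<^sup>+s\<in>{0..u}. ennreal (z_left s) \<partial>LS_measure v) + ?A = ennreal (v u)"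
  proof -
    have "(\<integral>\<^sup>+s\<in>{0..u}. ennreal (z_left s) \<partial>LS_measure v) + ?A =
       (\<integral>\<^sup>+s. ennreal (z_left s) * indicator {0..u} s + ennreal (al s) * indicator {0..u} s \<partial>LS_measure v)"
      by (rule nn_integral_add[symmetric]) auto
    also have "\<dots> = (\<integral>\<^sup>+s. indicator {0..u} s \<partial>LS_measure v)"
    proof (intro nn_integral_cong)
      fix s
      have "ennreal (z_left s) + ennreal (al s) = 1" if "s \<le> u"
        using z_left_ge_z[of s] that u T unfolding al
        by (subst ennreal_plus[symmetric]) (auto simp: z_left_le1)
      thus "ennreal (z_left s) * indicator {0..u} s + ennreal (al s) * indicator {0..u} s = indicator {0..u} s"
        by (auto simp: indicator_def)
    qed
    finally show ?thesis using vu by simp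
  qed
  have "z u > 0" using z_pos[of u] u by simp
  hence "v u * z u = 1" using u by (simp add: v_def)
  hence "v u = 1 + a u * v u" by (simp only: z_def right_diff_distrib) (simp add: mult.commute)
  moreover have "ennreal (1 + a u * v u) = 1 + ennreal (a u) * ennreal (v u)"
    using u a_nonneg[of u] v_nonneg[of u] by (simp add: ennreal_mult)
  ultimately have 3: "ennreal (v u) = 1 + ennreal (a u) * ennreal (v u)" by simp
  have "?A \<le> ennreal (v u)" unfolding 2[symmetric] by (rule add_increasing) auto
  \<comment> \<open>Cancelling the common term \<open>?A\<close> in \<open>ennreal\<close> requires
    it to be finite.\<close>
  hence fin: "?A \<noteq> \<top>" by (rule neq_top_trans[rotated]) simp
  have "(\<integral>\<^sup>+s\<in>{0..u}. ennreal (z_left s) \<partial>LS_measure v) + ?A = (1 + ?B) + ?A"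
    using 1 2 3 by (simp add: ac_simps)
  thus ?thesis using fin unfolding add.commute[of _ ?A] by (simp add: ennreal_add_left_cancel)
qed

text \<open>The identity \<open>d(1/z) = da / (z z_-)\<close> on \<open>(0,T]\<close>. Both sides
  are first multiplied by \<open>z_left\<close>, where the previous lemma determines the masses of
  half-lines; the factor is positive up to \<open>T\<close> and can be divided out
  afterwards.\<close>

lemma density_reciprocal:
  "density (LS_measure v) (indicator {0<..T}) =
   density (LS_measure a) (\<lambda>s. ennreal (v s / z_left s) * indicator {0<..T} s)"
proof -
  note [measurable] = borel_measurable_v'
  \<comment> \<open>At negative times \<open>a\<close>, and with it \<open>v\<close>, is arbitrary;
    \<open>w\<close> agrees with \<open>v\<close> on the half-line and is Borel.\<close>
  define w where "w s = (if s < 0 then 0 else v s)" for s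
  have [measurable]: "w \<in> borel_measurable borel" unfolding w_def by measurable
  have w0: "0 \<le> w s" for s using v_nonneg by (simp add: w_def)
  define D1 where "D1 = density (LS_measure v) (\<lambda>s. ennreal (z_left s) * indicator {0<..T} s)"
  define D2 where "D2 = density (LS_measure a) (\<lambda>s. ennreal (w s) * indicator {0<..T} s)"
  have split: "(\<integral>\<^sup>+s\<in>{0..u}. f s \<partial>LS_measure V) = f 0 * ennreal (V 0) + (\<integral>\<^sup>+s\<in>{0<..u}. f s \<partial>LS_measure V)"
    if [measurable]: "f \<in> borel_measurable borel" and "0 \<le> u" "increasing_path V" for f :: "real \<Rightarrow> ennreal" and u V
  proof -
    have "(\<integral>\<^sup>+s\<in>{0..u}. f s \<partial>LS_measure V) = (\<integral>\<^sup>+s. f 0 * indicator {0} s + f s * indicator {0<..u} s \<partial>LS_measure V)"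
      using that by (intro nn_integral_cong) (auto simp: indicator_def)
    also have "\<dots> = f 0 * emeasure (LS_measure V) {0} + (\<integral>\<^sup>+s\<in>{0<..u}. f s \<partial>LS_measure V)"
      by (subst nn_integral_add) (auto simp: nn_integral_cmult_indicator)
    finally show ?thesis using that by (simp add: emeasure_LS_measure_0)
  qed
  have eq: "(\<integral>\<^sup>+s\<in>{0<..u}. ennreal (z_left s) \<partial>LS_measure v) = (\<integral>\<^sup>+s\<in>{0<..u}. ennreal (w s) \<partial>LS_measure a)"
    and fin: "(\<integral>\<^sup>+s\<in>{0<..u}. ennreal (z_left s) \<partial>LS_measure v) < \<infinity>"
    if u: "0 \<le> u" "u \<le> T" for u
  proof -
    have "z 0 > 0" using z_pos[of 0] T by simp
    have z0: "z_left 0 = 1" by (simp add: z_left_def)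
    have wv: "(\<integral>\<^sup>+s\<in>{0..u}. ennreal (v s) \<partial>LS_measure a) = (\<integral>\<^sup>+s\<in>{0..u}. ennreal (w s) \<partial>LS_measure a)"
      by (intro nn_integral_cong) (auto simp: w_def indicator_def)
    \<comment> \<open>The time 0 contributes \<open>v 0\<close> on one side and
      \<open>1 + v 0 * a 0\<close> on the other. These coincide and cancel, so that only
      \<open>(0,u]\<close> remains.\<close>
    have "v 0 * z 0 = 1" using \<open>z 0 > 0\<close> T by (simp add: v_def)
    hence "v 0 = 1 + w 0 * a 0" by (simp only: z_def right_diff_distrib) (simp add: w_def mult.commute)
    moreover have "ennreal (1 + w 0 * a 0) = 1 + ennreal (w 0) * ennreal (a 0)"
      using a_nonneg[of 0] w0[of 0] by (simp add: ennreal_mult)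
    ultimately have "ennreal (v 0) = 1 + ennreal (w 0) * ennreal (a 0)" by simp
    moreover have "ennreal (v 0) + (\<integral>\<^sup>+s\<in>{0<..u}. ennreal (z_left s) \<partial>LS_measure v) =
        1 + ennreal (w 0) * ennreal (a 0) + (\<integral>\<^sup>+s\<in>{0<..u}. ennreal (w s) \<partial>LS_measure a)"
      using reciprocal_Icc[OF u] u z0
      by (simp add: wv split inc inc_v add.assoc)
    ultimately have "ennreal (v 0) + (\<integral>\<^sup>+s\<in>{0<..u}. ennreal (z_left s) \<partial>LS_measure v) =
        ennreal (v 0) + (\<integral>\<^sup>+s\<in>{0<..u}. ennreal (w s) \<partial>LS_measure a)" by simp
    thus "(\<integral>\<^sup>+s\<in>{0<..u}. ennreal (z_left s) \<partial>LS_measure v) = (\<integral>\<^sup>+s\<in>{0<..u}. ennreal (w s) \<partial>LS_measure a)"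
      by (simp add: ennreal_add_left_cancel)
    have "(\<integral>\<^sup>+s\<in>{0<..u}. ennreal (z_left s) \<partial>LS_measure v) \<le> (\<integral>\<^sup>+s. indicator {0<..u} s \<partial>LS_measure v)"
      by (intro nn_integral_mono) (auto simp: indicator_def z_left_le1)
    also have "\<dots> < \<infinity>" using emeasure_LS_measure_finite[OF inc_v, of "{0<..u}" u] by (auto simp: subset_eq)
    finally show "(\<integral>\<^sup>+s\<in>{0<..u}. ennreal (z_left s) \<partial>LS_measure v) < \<infinity>" .
  qed
  have em: "emeasure D1 {..t} = (\<integral>\<^sup>+s\<in>{0<..max 0 (min t T)}. ennreal (z_left s) \<partial>LS_measure v)"
     "emeasure D2 {..t} = (\<integral>\<^sup>+s\<in>{0<..max 0 (min t T)}. ennreal (w s) \<partial>LS_measure a)" for t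
    unfolding D1_def D2_def by (auto simp: emeasure_density intro!: nn_integral_cong split: split_indicator)
  have "D1 = D2"
  proof (rule measure_eqI_generator_eq[where E = "range (\<lambda>t. {..t})" and \<Omega> = UNIV and A = "\<lambda>n. {..real n}"])
    show "Int_stable (range (\<lambda>t::real. {..t}))"
      by (auto simp: Int_stable_def intro!: exI[of _ "min _ _"])
    show "sets D1 = sigma_sets UNIV (range (\<lambda>t. {..t}))" "sets D2 = sigma_sets UNIV (range (\<lambda>t. {..t}))"
      by (simp_all add: borel_eq_atMost D1_def D2_def)
    show "(\<Union>n. {..real n}) = UNIV" using real_arch_simple by auto
    show "emeasure D1 {..real i} \<noteq> \<infinity>" for i using fin T unfolding em by (auto simp: less_top[symmetric])
    show "emeasure D1 X = emeasure D2 X" if "X \<in> range (\<lambda>t. {..t})" for X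
      using that eq T by (auto simp: em)
  qed auto
  show ?thesis
  proof (rule measure_eqI)
    fix A assume "A \<in> sets (density (LS_measure v) (indicator {0<..T}))"
    hence A[measurable]: "A \<in> sets borel" by simp
    have zl: "z_left s > 0" if "s \<le> T" for s using z_left_ge_z[OF that] T by linarith
    have "emeasure (density (LS_measure v) (indicator {0<..T})) A = (\<integral>\<^sup>+s. ennreal (1 / z_left s) * indicator A s \<partial>D1)"
      unfolding D1_def
      apply (auto simp: emeasure_density nn_integral_density intro!: nn_integral_cong)
      by (auto split: split_indicator simp: ennreal_mult[symmetric] zl less_imp_le dest: zl)
    also have "\<dots> = (\<integral>\<^sup>+s. ennreal (1 / z_left s) * indicator A s \<partial>D2)" by (simp add: \<open>D1 = D2\<close>)
    also have "\<dots> = (\<integral>\<^sup>+s. ennreal (v s / z_left s) * indicator {0<..T} s * indicator A s \<partial>LS_measure a)"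
      unfolding D2_def using w0 v_nonneg
      by (auto simp: nn_integral_density w_def ennreal_mult[symmetric] less_imp_le[OF zl]
         intro!: nn_integral_cong split: split_indicator)
    also have "\<dots> = (\<integral>\<^sup>+s. ennreal (w s / z_left s) * indicator {0<..T} s * indicator A s \<partial>LS_measure a)"
      by (intro nn_integral_cong) (auto simp: w_def split: split_indicator)
    also have "\<dots> = emeasure (density (LS_measure a) (\<lambda>s. ennreal (w s / z_left s) * indicator {0<..T} s)) A"
      by (simp add: emeasure_density)
    also have "(\<lambda>s. ennreal (w s / z_left s) * indicator {0<..T} s) = (\<lambda>s. ennreal (v s / z_left s) * indicator {0<..T} s)"
      by (auto simp: fun_eq_iff w_def split: split_indicator)
    finally show "emeasure (density (LS_measure v) (indicator {0<..T})) A =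
      emeasure (density (LS_measure a) (\<lambda>s. ennreal (v s / z_left s) * indicator {0<..T} s)) A" .
  qed auto
qed

end

section \<open>Integrals over varying intervals and partial integration\<close>

lemma set_integral_tendsto_sets:
  fixes g :: "'b \<Rightarrow> real"
  assumes int: "set_integrable \<mu> B g" and [measurable]: "\<And>n. A n \<in> sets \<mu>" "L \<in> sets \<mu>"
    and sub: "\<And>n. A n \<subseteq> B" "L \<subseteq> B"
    and ev: "\<And>x. eventually (\<lambda>n. x \<in> A n \<longleftrightarrow> x \<in> L) sequentially"
  shows "(\<lambda>n. LINT x:A n|\<mu>. g x) \<longlonglongrightarrow> (LINT x:L|\<mu>. g x)"
  unfolding set_lebesgue_integral_def
proof (rule integral_dominated_convergence)
  have "set_integrable \<mu> (A n) g" "set_integrable \<mu> L g" for n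
    by (rule set_integrable_subset[OF int _ sub(1)], simp) (rule set_integrable_subset[OF int _ sub(2)], simp)
  thus "(\<lambda>x. indicat_real (A n) x *\<^sub>R g x) \<in> borel_measurable \<mu>"
    "(\<lambda>x. indicat_real L x *\<^sub>R g x) \<in> borel_measurable \<mu>" for n
    unfolding set_integrable_def by (auto dest: borel_measurable_integrable)
  show "integrable \<mu> (\<lambda>x. norm (indicat_real B x *\<^sub>R g x))"
    using int unfolding set_integrable_def by (rule integrable_norm)
  show "AE x in \<mu>. norm (indicat_real (A n) x *\<^sub>R g x) \<le> norm (indicat_real B x *\<^sub>R g x)" for n
    using sub by (auto split: split_indicator)
  show "AE x in \<mu>. (\<lambda>n. indicat_real (A n) x *\<^sub>R g x) \<longlonglongrightarrow> indicat_real L x *\<^sub>R g x"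
  proof (rule AE_I2, rule tendsto_eventually)
    fix x show "\<forall>\<^sub>F n in sequentially. indicat_real (A n) x *\<^sub>R g x = indicat_real L x *\<^sub>R g x"
      using ev[of x] by eventually_elim (auto split: split_indicator)
  qed
qed

lemma set_integral_Ioc_tendsto_left:
  fixes g :: "real \<Rightarrow> real"
  assumes int: "set_integrable \<mu> {0<..t} g" and sets: "sets \<mu> = sets borel" and s: "0 < s" "s \<le> t"
  shows "((\<lambda>u. LINT x:{0<..u}|\<mu>. g x) \<longlongrightarrow> (LINT x:{0<..<s}|\<mu>. g x)) (at_left s)"
proof (rule tendsto_at_left_sequentially[OF s(1)])
  fix S :: "nat \<Rightarrow> real" assume S: "\<And>n. S n < s" "\<And>n. 0 < S n" "incseq S" "S \<longlonglongrightarrow> s"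
  show "(\<lambda>n. LINT x:{0<..S n}|\<mu>. g x) \<longlonglongrightarrow> (LINT x:{0<..<s}|\<mu>. g x)"
  proof (rule set_integral_tendsto_sets[OF int])
    fix x show "\<forall>\<^sub>F n in sequentially. (x \<in> {0<..S n}) = (x \<in> {0<..<s})"
    proof (cases "x < s")
      case True
      show ?thesis using order_tendstoD(1)[OF S(4) True] by eventually_elim (use S(1) in \<open>auto intro: less_trans\<close>)
    next
      case False
      hence "(x \<in> {0<..S n}) = (x \<in> {0<..<s})" for n using S(1)[of n] by auto
      thus ?thesis by simp
    qed
  next
    show "{0<..S n} \<subseteq> {0<..t}" for n using S(1)[of n] s by auto
  qed (use s sets in auto)
qed

lemma set_integral_Ioc_tendsto_right:
  fixes g :: "real \<Rightarrow> real"
  assumes int: "set_integrable \<mu> {0<..t} g" and sets: "sets \<mu> = sets borel" and s: "0 \<le> s" "s < t"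
  shows "((\<lambda>u. LINT x:{0<..u}|\<mu>. g x) \<longlongrightarrow> (LINT x:{0<..s}|\<mu>. g x)) (at_right s)"
proof (rule tendsto_at_right_sequentially[OF s(2)])
  fix S :: "nat \<Rightarrow> real" assume S: "\<And>n. s < S n" "\<And>n. S n < t" "decseq S" "S \<longlonglongrightarrow> s"
  show "(\<lambda>n. LINT x:{0<..S n}|\<mu>. g x) \<longlonglongrightarrow> (LINT x:{0<..s}|\<mu>. g x)"
  proof (rule set_integral_tendsto_sets[OF int])
    fix x show "\<forall>\<^sub>F n in sequentially. (x \<in> {0<..S n}) = (x \<in> {0<..s})"
    proof (cases "s < x")
      case True
      show ?thesis using order_tendstoD(2)[OF S(4) True] by eventually_elim (use True in auto)
    next
      case False
      hence "(x \<in> {0<..S n}) = (x \<in> {0<..s})" for n using S(1)[of n] by auto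
      thus ?thesis by simp
    qed
  next
    show "{0<..S n} \<subseteq> {0<..t}" for n using S(2)[of n] by auto
  qed (use s sets in auto)
qed

lemma set_integral_insert_right:
  fixes g :: "real \<Rightarrow> real"
  assumes int: "set_integrable \<mu> {0<..s} g" and sets: "sets \<mu> = sets borel" and s: "0 < s"
    and fin: "emeasure \<mu> {s} < \<infinity>"
  shows "(LINT x:{0<..s}|\<mu>. g x) = (LINT x:{0<..<s}|\<mu>. g x) + g s * measure \<mu> {s}"
proof -
  have "set_integrable \<mu> {0<..<s} g" "set_integrable \<mu> {s} g"
    by (rule set_integrable_subset[OF int]; use s sets in auto)+
  hence "(LINT x:{0<..<s} \<union> {s}|\<mu>. g x) = (LINT x:{0<..<s}|\<mu>. g x) + (LINT x:{s}|\<mu>. g x)"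
    by (intro set_integral_Un) auto
  also have "{0<..<s} \<union> {s} = {0<..s}" using s by auto
  also have "(LINT x:{s}|\<mu>. g x) = g s * measure \<mu> {s}"
    by (rule set_integral_at_point[OF \<open>set_integrable \<mu> {s} g\<close>]) (use fin sets in auto)
  finally show ?thesis .
qed

lemma set_integral_abs_le:
  fixes g :: "'b \<Rightarrow> real"
  assumes "set_integrable \<mu> B g" "A \<in> sets \<mu>" "A \<subseteq> B"
  shows "\<bar>LINT x:A|\<mu>. g x\<bar> \<le> (LINT x:B|\<mu>. \<bar>g x\<bar>)"
proof -
  have 1: "set_integrable \<mu> A g" using assms by (rule set_integrable_subset)
  have "\<bar>LINT x:A|\<mu>. g x\<bar> \<le> (\<integral>x. norm (indicat_real A x *\<^sub>R g x) \<partial>\<mu>)"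
    unfolding set_lebesgue_integral_def using integral_norm_bound[of \<mu> "\<lambda>x. indicat_real A x *\<^sub>R g x"] by simp
  also have "\<dots> \<le> (LINT x:B|\<mu>. \<bar>g x\<bar>)"
    unfolding set_lebesgue_integral_def
  proof (rule integral_mono)
    show "integrable \<mu> (\<lambda>x. norm (indicat_real A x *\<^sub>R g x))"
      using 1 unfolding set_integrable_def by (rule integrable_norm)
    show "integrable \<mu> (\<lambda>x. indicat_real B x *\<^sub>R \<bar>g x\<bar>)"
      using set_integrable_abs[OF assms(1)] unfolding set_integrable_def .
  qed (use assms(3) in \<open>auto split: split_indicator\<close>)
  finally show ?thesis .
qed

text \<open>Exchange of the integrations over the triangle \<open>0 < s \<le> r \<le> t\<close>: for
  fixed \<open>s\<close>, the times \<open>r\<close> fill \<open>[s,t]\<close>. The diagonal belongs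
  to the triangle because the inner integral includes its end point.\<close>

lemma Fubini_triangle:
  fixes m \<nu> :: "real measure" and g :: "real \<Rightarrow> real"
  assumes sets [measurable_cong]: "sets m = sets borel" "sets \<nu> = sets borel"
    and "sigma_finite_measure m" "sigma_finite_measure \<nu>"
    and int: "set_integrable m {0<..t} g" and fin: "emeasure \<nu> {0<..t} < \<infinity>"
  shows "set_integrable \<nu> {0<..t} (\<lambda>r. LINT s:{0<..r}|m. g s)"
    and "(LINT r:{0<..t}|\<nu>. LINT s:{0<..r}|m. g s) = (LINT s:{0<..t}|m. g s * measure \<nu> {s..t})"
proof -
  interpret pair_sigma_finite m \<nu> using assms(3,4) by (simp add: pair_sigma_finite_def)
  have sp: "space m = UNIV" "space \<nu> = UNIV" using sets[THEN sets_eq_imp_space_eq] by auto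
  define k where "k s = indicat_real {0<..t} s * g s" for s
  have k: "integrable m k" using int by (simp add: k_def[abs_def] set_integrable_def)
  hence [measurable]: "k \<in> borel_measurable borel"
    using borel_measurable_integrable[OF k] sets(1) by (simp cong: measurable_cong_sets)
  define f :: "real \<Rightarrow> real \<Rightarrow> real" where "f s r = k s * of_bool (s \<le> r \<and> r \<le> t)" for s r
  have fm: "case_prod f \<in> borel_measurable (m \<Otimes>\<^sub>M \<nu>)"
    unfolding f_def[abs_def] split_beta' by measurable
  have fin': "emeasure \<nu> {s..t} < \<infinity>" if "0 < s" for s
    using le_less_trans[OF emeasure_mono[of "{s..t}" "{0<..t}" \<nu>] fin] that sets(2) by (auto simp: subset_eq)
  have inner: "f s r = k s * indicat_real {s..t} r" for s r by (auto simp: f_def indicator_def)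
  have int2: "(\<integral>r. f s r \<partial>\<nu>) = k s * measure \<nu> {s..t}" for s
    unfolding inner using sp sets(2) by simp
  have int2': "integrable \<nu> (\<lambda>r. f s r)" for s
  proof (cases "0 < s")
    case True
    thus ?thesis unfolding inner using fin' sets(2) by (intro integrable_mult_right integrable_real_indicator) auto
  next
    case False
    hence "f s r = 0" for r by (auto simp: f_def k_def)
    thus ?thesis by simp
  qed
  have f: "integrable (m \<Otimes>\<^sub>M \<nu>) (case_prod f)"
  proof (rule Fubini_integrable[OF fm])
    have *: "(\<integral>r. norm (f s r) \<partial>\<nu>) = \<bar>k s\<bar> * measure \<nu> {s..t}" for s
    proof -
      have "(\<integral>r. norm (f s r) \<partial>\<nu>) = (\<integral>r. \<bar>k s\<bar> * indicat_real {s..t} r \<partial>\<nu>)"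
        unfolding inner by (simp add: abs_mult)
      thus ?thesis using sp sets(2) by simp
    qed
    \<comment> \<open>The majorant is constant in the second factor, since \<open>[s,t]\<close> lies
      in \<open>(0,t]\<close> wherever \<open>k\<close> does not vanish.\<close>
    have "integrable m (\<lambda>s. \<bar>k s\<bar> * measure \<nu> {s..t})"
    proof (rule Bochner_Integration.integrable_bound)
      show "integrable m (\<lambda>s. measure \<nu> {0<..t} * k s)" using k by (rule integrable_mult_right)
      have "(\<lambda>s. \<integral>r. norm (f s r) \<partial>\<nu>) \<in> borel_measurable m"
        using fm by (intro M2.borel_measurable_lebesgue_integral) (auto simp: split_beta')
      thus "(\<lambda>s. \<bar>k s\<bar> * measure \<nu> {s..t}) \<in> borel_measurable m" unfolding * .
      show "AE s in m. norm (\<bar>k s\<bar> * measure \<nu> {s..t}) \<le> norm (measure \<nu> {0<..t} * k s)"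
      proof (rule AE_I2)
        fix s
        show "norm (\<bar>k s\<bar> * measure \<nu> {s..t}) \<le> norm (measure \<nu> {0<..t} * k s)"
        proof (cases "0 < s")
          case True
          hence "measure \<nu> {s..t} \<le> measure \<nu> {0<..t}"
            using fin sets(2) by (intro measure_mono_fmeasurable fmeasurableI) auto
          thus ?thesis by (auto simp: abs_mult mult.commute[of "measure _ _"] intro!: mult_left_mono)
        qed (simp add: k_def)
      qed
    qed
    thus "integrable m (\<lambda>s. \<integral>r. norm (case_prod f (s, r)) \<partial>\<nu>)" by (simp only: case_prod_conv *)
  qed (use int2' in auto)
  have int1: "(\<integral>s. f s r \<partial>m) = indicat_real {0<..t} r * (LINT s:{0<..r}|m. g s)" for r
  proof -
    have "f s r = indicat_real {0<..t} r * (indicat_real {0<..r} s *\<^sub>R g s)" for s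
      by (auto simp: f_def k_def indicator_def)
    thus ?thesis by (simp add: set_lebesgue_integral_def)
  qed
  show "set_integrable \<nu> {0<..t} (\<lambda>r. LINT s:{0<..r}|m. g s)"
    using integrable_snd[OF f] by (simp add: int1 set_integrable_def)
  have "(LINT r:{0<..t}|\<nu>. LINT s:{0<..r}|m. g s) = (\<integral>r. (\<integral>s. f s r \<partial>m) \<partial>\<nu>)"
    by (simp add: int1 set_lebesgue_integral_def)
  also have "\<dots> = (\<integral>s. (\<integral>r. f s r \<partial>\<nu>) \<partial>m)" by (rule Fubini_integral[OF f])
  also have "\<dots> = (LINT s:{0<..t}|m. g s * measure \<nu> {s..t})"
    by (simp add: int2 set_lebesgue_integral_def k_def mult.assoc)
  finally show "(LINT r:{0<..t}|\<nu>. LINT s:{0<..r}|m. g s) = (LINT s:{0<..t}|m. g s * measure \<nu> {s..t})" .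
qed

context sub_distribution_at
begin

lemma left_lim_v:
  assumes "0 < s" "s \<le> T"
  shows "left_lim v s = 1 / z_left s"
proof (rule left_lim_eq)
  have "0 < z_left s" using z_left_ge_z[OF assms(2)] T by linarith
  hence "((\<lambda>u. 1 / z u) \<longlongrightarrow> 1 / z_left s) (at_left s)"
    by (intro tendsto_intros z_tendsto_left assms) auto
  moreover have "(v \<longlongrightarrow> l) (at_left s) \<longleftrightarrow> ((\<lambda>u. 1 / z u) \<longlongrightarrow> l) (at_left s)" for l
    by (intro tendsto_cong) (use assms in \<open>auto simp: v_def min_def eventually_at_left[OF assms(1)] intro!: exI[of _ 0]\<close>)
  ultimately show "(v \<longlongrightarrow> 1 / z_left s) (at_left s)" by simp
qed

text \<open>This turns the triangle formula into partial integration: the total mass yields the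
  boundary term \<open>v T\<close>, the left limit yields the integrand
  \<open>1 / z_left\<close>.\<close>

lemma measure_v_Icc:
  assumes "0 < s" "s \<le> T"
  shows "measure (LS_measure v) {s..T} = v T - 1 / z_left s"
proof -
  have "{s..T} = {0..T} - {0..<s}" using assms by auto
  moreover have "measure (LS_measure v) ({0..T} - {0..<s}) = measure (LS_measure v) {0..T} - measure (LS_measure v) {0..<s}"
    by (rule measure_Diff) (use assms emeasure_LS_measure_finite[OF inc_v, of "{0..T}" T] in auto)
  ultimately have "measure (LS_measure v) {s..T} = measure (LS_measure v) {0..T} - measure (LS_measure v) {0..<s}"
    by simp
  thus ?thesis
    using assms emeasure_LS_measure_Ico[OF inc_v assms(1)] emeasure_LS_measure_Icc[OF inc_v, of T]
      v_nonneg[of T] increasing_path_left_limit(4)[OF inc_v assms(1)]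
    by (simp add: measure_def left_lim_v)
qed

text \<open>Carries the density identity over from measures to signed integrands, together with
  their integrability.\<close>

lemma set_integral_v:
  fixes f :: "real \<Rightarrow> real"
  assumes int: "set_integrable (LS_measure v) {0<..T} f"
  shows "(LINT s:{0<..T}|LS_measure v. f s) = (LINT s:{0<..T}|LS_measure a. f s * (v s / z_left s))"
    and "set_integrable (LS_measure a) {0<..T} (\<lambda>s. f s * (v s / z_left s))"
proof -
  note [measurable] = borel_measurable_v'
  define k where "k s = indicat_real {0<..T} s * f s" for s
  have k: "integrable (LS_measure v) k" using int by (simp add: k_def[abs_def] set_integrable_def)
  hence [measurable]: "k \<in> borel_measurable borel"
    using borel_measurable_integrable[OF k] by (simp cong: measurable_cong_sets)
  define w where "w s = indicat_real {0<..T} s * (v s / z_left s)" for s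
  have "w s = indicat_real {0<..T} s * ((if s < 0 then 0 else v s) / z_left s)" for s
    by (auto simp: w_def indicator_def)
  hence [measurable]: "w \<in> borel_measurable borel" by (simp add: cong: measurable_cong)
  have w: "0 \<le> w s" for s
  proof (cases "s \<in> {0<..T}")
    case True
    hence "0 \<le> z_left s" "0 \<le> v s" by (auto intro: z_left_nonneg v_nonneg)
    thus ?thesis by (simp add: w_def)
  qed (auto simp: w_def indicator_def)
  have eq: "density (LS_measure v) (\<lambda>s. ennreal (indicat_real {0<..T} s)) = density (LS_measure a) (\<lambda>s. ennreal (w s))"
  proof -
    have "(\<lambda>s. ennreal (indicat_real {0<..T} s)) = indicator {0<..T}" by (auto simp: fun_eq_iff indicator_def)
    moreover have "(\<lambda>s. ennreal (w s)) = (\<lambda>s. ennreal (v s / z_left s) * indicator {0<..T} s)"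
      by (auto simp: fun_eq_iff w_def indicator_def)
    ultimately show ?thesis using density_reciprocal by simp
  qed
  have kv: "indicat_real {0<..T} s * k s = k s" for s by (simp add: k_def indicator_def)
  have wk: "w s * k s = indicat_real {0<..T} s * (f s * (v s / z_left s))" for s by (auto simp: k_def w_def indicator_def)
  have "integrable (density (LS_measure v) (\<lambda>s. ennreal (indicat_real {0<..T} s))) k"
    using k by (subst integrable_real_density) (auto simp: kv)
  hence "integrable (density (LS_measure a) (\<lambda>s. ennreal (w s))) k" by (simp only: eq)
  hence "integrable (LS_measure a) (\<lambda>s. w s * k s)" using w by (subst (asm) integrable_real_density) auto
  thus "set_integrable (LS_measure a) {0<..T} (\<lambda>s. f s * (v s / z_left s))"
    by (simp add: wk set_integrable_def)
  have "(LINT s:{0<..T}|LS_measure v. f s) = (\<integral>s. k s \<partial>LS_measure v)"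
    by (simp add: set_lebesgue_integral_def k_def)
  also have "\<dots> = (\<integral>s. k s \<partial>density (LS_measure v) (\<lambda>s. ennreal (indicat_real {0<..T} s)))"
    by (subst integral_real_density) (auto simp: kv)
  also have "\<dots> = (\<integral>s. w s * k s \<partial>LS_measure a)"
    unfolding eq using w by (subst integral_real_density) auto
  also have "\<dots> = (LINT s:{0<..T}|LS_measure a. f s * (v s / z_left s))"
    by (simp add: set_lebesgue_integral_def wk)
  finally show "(LINT s:{0<..T}|LS_measure v. f s) = (LINT s:{0<..T}|LS_measure a. f s * (v s / z_left s))" .
qed

text \<open>By the triangle formula the integral of \<open>U\<close> against \<open>dv\<close> is
  that of \<open>g * (v T - 1 / z_left)\<close> against \<open>dP\<close>. Thus \<open>v\<close>
  enters with its left limit and \<open>U\<close> with its full value, which is why \<open>X\<close>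
  and not \<open>X_-\<close> is integrated against \<open>dv\<close> later on.\<close>

lemma integral_by_parts:
  fixes g :: "real \<Rightarrow> real"
  assumes P: "increasing_path P" and int: "set_integrable (LS_measure P) {0<..T} g"
  defines "U \<equiv> \<lambda>r. LINT s:{0<..r}|LS_measure P. g s"
  shows "set_integrable (LS_measure v) {0<..T} U"
    and "set_integrable (LS_measure P) {0<..T} (\<lambda>s. g s / z_left s)"
    and "U T * v T = (LINT s:{0<..T}|LS_measure P. g s / z_left s) + (LINT s:{0<..T}|LS_measure v. U s)"
proof -
  note F = Fubini_triangle[of "LS_measure P" "LS_measure v" T g, OF _ _ sigma_finite_LS_measure[OF P]
      sigma_finite_LS_measure[OF inc_v] int emeasure_LS_measure_finite[OF inc_v, of _ T]]
  show "set_integrable (LS_measure v) {0<..T} U"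
    unfolding U_def by (rule F(1)) auto
  show gz: "set_integrable (LS_measure P) {0<..T} (\<lambda>s. g s / z_left s)"
  proof (rule set_integrable_bound)
    show "set_integrable (LS_measure P) {0<..T} (\<lambda>s. g s / z T)" using int by simp
    have "(\<lambda>s. (indicat_real {0<..T} s *\<^sub>R g s) / z_left s) \<in> borel_measurable (LS_measure P)"
      using borel_measurable_integrable[OF int[unfolded set_integrable_def]] by measurable
    thus "set_borel_measurable (LS_measure P) {0<..T} (\<lambda>s. g s / z_left s)"
      by (simp add: set_borel_measurable_def)
    show "AE s in LS_measure P. s \<in> {0<..T} \<longrightarrow> norm (g s / z_left s) \<le> norm (g s / z T)"
    proof (intro AE_I2 impI)
      fix s assume "s \<in> {0<..T}"
      hence "z T \<le> z_left s" using z_left_ge_z by auto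
      thus "norm (g s / z_left s) \<le> norm (g s / z T)" using T by (auto simp: abs_divide intro!: divide_left_mono)
    qed
  qed
  have "(LINT s:{0<..T}|LS_measure v. U s) = (LINT s:{0<..T}|LS_measure P. g s * measure (LS_measure v) {s..T})"
    unfolding U_def by (rule F(2)) auto
  also have "\<dots> = (LINT s:{0<..T}|LS_measure P. g s * v T - g s / z_left s)"
    by (intro set_lebesgue_integral_cong) (auto simp: measure_v_Icc algebra_simps)
  also have "\<dots> = U T * v T - (LINT s:{0<..T}|LS_measure P. g s / z_left s)"
    using int gz by (subst set_integral_diff) (auto simp: U_def)
  finally show "U T * v T = (LINT s:{0<..T}|LS_measure P. g s / z_left s) + (LINT s:{0<..T}|LS_measure v. U s)"
    by simp
qed

end

section \<open>The pathwise formula\<close>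

lemma set_integrable_bounded:
  fixes f :: "'b \<Rightarrow> real"
  assumes "A \<in> sets \<mu>" "emeasure \<mu> A < \<infinity>" "set_borel_measurable \<mu> A f" "\<And>x. x \<in> A \<Longrightarrow> \<bar>f x\<bar> \<le> K"
  shows "set_integrable \<mu> A f"
proof (rule set_integrable_bound[OF _ assms(3)])
  show "set_integrable \<mu> A (\<lambda>_. K)"
    using assms unfolding set_integrable_def by (intro integrable_scaleR_left integrable_real_indicator) auto
  show "AE x in \<mu>. x \<in> A \<longrightarrow> norm (f x) \<le> norm K" using assms(4) by (force intro: AE_I2)
qed

lemma set_borel_measurable_LS [simp]: "set_borel_measurable (LS_measure V) A f = set_borel_measurable borel A f"
  by (simp add: set_borel_measurable_def cong: measurable_cong_sets)

text \<open>Inside \<open>(0,t]\<close> the open integral is a parameter integral of the jointly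
  measurable function \<open>of_bool (r < s) * k r\<close>.\<close>

lemma set_borel_measurable_open_integral:
  fixes g :: "real \<Rightarrow> real"
  assumes "sigma_finite_measure m" and sets [measurable_cong]: "sets m = sets borel"
    and int: "set_integrable m {0<..t} g"
  shows "set_borel_measurable borel {0<..t} (\<lambda>s. LINT r:{0<..<s}|m. g r)"
proof -
  interpret sigma_finite_measure m by fact
  define k where "k r = indicat_real {0<..t} r * g r" for r
  have k: "integrable m k" using int by (simp add: k_def[abs_def] set_integrable_def)
  hence [measurable]: "k \<in> borel_measurable borel"
    using borel_measurable_integrable[OF k] sets by (simp cong: measurable_cong_sets)
  have "(\<lambda>s::real. \<integral>r. of_bool (r < s) * k r \<partial>m) \<in> borel_measurable borel"
    by (rule borel_measurable_lebesgue_integral) measurable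
  hence "(\<lambda>s::real. indicat_real {0<..t} s * (\<integral>r. of_bool (r < s) * k r \<partial>m)) \<in> borel_measurable borel"
    by measurable
  also have "(\<lambda>s::real. indicat_real {0<..t} s * (\<integral>r. of_bool (r < s) * k r \<partial>m)) =
      (\<lambda>s. indicat_real {0<..t} s *\<^sub>R (LINT r:{0<..<s}|m. g r))"
  proof
    fix s
    have "(\<integral>r. of_bool (r < s) * k r \<partial>m) = (LINT r:{0<..<s}|m. g r)" if "s \<in> {0<..t}"
      unfolding set_lebesgue_integral_def using that
      by (intro Bochner_Integration.integral_cong refl) (auto simp: k_def indicator_def)
    thus "indicat_real {0<..t} s * (\<integral>r. of_bool (r < s) * k r \<partial>m) =
        indicat_real {0<..t} s *\<^sub>R (LINT r:{0<..<s}|m. g r)" by (auto simp: indicator_def)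
  qed
  finally show ?thesis by (simp add: set_borel_measurable_def)
qed

text \<open>One trajectory at a fixed outcome, up to a fixed time \<open>t\<close>: \<open>V\<close>
  stands for the compensated Poisson path, and the assumption on \<open>X\<close> is
  \<open>X = \<mu> - int h da\<close> with the representation of \<open>\<mu>\<close> inserted.
  Jumps of \<open>V\<close> are excluded only at \<open>da\<close>-almost every time.\<close>

locale jump_path = sub_distribution +
  fixes t C :: real and X V \<phi> h P Q :: "real \<Rightarrow> real"
  assumes t: "0 \<le> t"
    and P: "increasing_path P" and Q: "increasing_path Q"
    and V: "\<And>s. 0 \<le> s \<Longrightarrow> V s = P s - Q s"
    and \<phi>P: "set_integrable (LS_measure P) {0<..t} \<phi>" and \<phi>Q: "set_integrable (LS_measure Q) {0<..t} \<phi>"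
    and X: "\<And>u. 0 \<le> u \<Longrightarrow> u \<le> t \<Longrightarrow> X u = X 0 + (LINT s:{0<..u}|LS_measure P. \<phi> s)
      - (LINT s:{0<..u}|LS_measure Q. \<phi> s) - (LINT s:{0<..u}|LS_measure a. h s)"
    and h: "set_borel_measurable borel {0..} h" and h_le: "\<And>s. 0 \<le> s \<Longrightarrow> \<bar>h s\<bar> \<le> C"
    and V_cont: "AE s in LS_measure a. 0 < s \<longrightarrow> (V \<longlongrightarrow> V s) (at_left s)"
begin

text \<open>The left limit of \<open>X\<close> as integrals over open intervals, from which its
  boundedness and measurability can be read off.\<close>

definition Xl where "Xl s = X 0 + (LINT s:{0<..<s}|LS_measure P. \<phi> s)
      - (LINT s:{0<..<s}|LS_measure Q. \<phi> s) - (LINT s:{0<..<s}|LS_measure a. h s)"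

text \<open>The first integrand of the theorem, with \<open>z\<close> for
  \<open>Z_- - \<Delta>A^p\<close>. Where \<open>z\<close> vanishes, the quotient is 0 by the
  convention on division, just as the setting prescribes.\<close>

definition H where "H s = z_left s / z s * (h s - Xl s / z_left s)"

lemma h_int: "set_integrable (LS_measure a) {0<..t} h"
proof (rule set_integrable_bounded[where K = C])
  show "emeasure (LS_measure a) {0<..t} < \<infinity>" using emeasure_LS_measure_finite[OF inc, of "{0<..t}" t] by (simp add: subset_eq)
  show "set_borel_measurable (LS_measure a) {0<..t} h"
    using set_borel_measurable_subset[OF h, of "{0<..t}"] by (auto simp: subset_eq)
qed (use h_le in auto)

lemma X_tendsto_left:
  assumes s: "0 < s" "s \<le> t"
  shows "(X \<longlongrightarrow> Xl s) (at_left s)"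
proof -
  have "((\<lambda>u. X 0 + (LINT s:{0<..u}|LS_measure P. \<phi> s)
      - (LINT s:{0<..u}|LS_measure Q. \<phi> s) - (LINT s:{0<..u}|LS_measure a. h s)) \<longlongrightarrow> Xl s) (at_left s)"
    unfolding Xl_def
    by (intro tendsto_intros set_integral_Ioc_tendsto_left[OF \<phi>P] set_integral_Ioc_tendsto_left[OF \<phi>Q]
        set_integral_Ioc_tendsto_left[OF h_int]) (use s in auto)
  moreover have "\<forall>\<^sub>F u in at_left s. X 0 + (LINT s:{0<..u}|LS_measure P. \<phi> s)
      - (LINT s:{0<..u}|LS_measure Q. \<phi> s) - (LINT s:{0<..u}|LS_measure a. h s) = X u"
    unfolding eventually_at_left[OF s(1)] using s by (intro exI[of _ 0]) (auto simp: X[symmetric])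
  ultimately show ?thesis by (rule Lim_transform_eventually)
qed

lemma left_lim_X: "0 < s \<Longrightarrow> s \<le> t \<Longrightarrow> left_lim X s = Xl s"
  by (rule left_lim_eq[OF X_tendsto_left])

text \<open>The decomposition is arbitrary, so \<open>P\<close> and \<open>Q\<close> may both have
  an atom at \<open>s\<close>. Continuity of \<open>V\<close> forces these atoms to be equal; the
  two contributions of \<open>\<phi>\<close> then cancel and only that of \<open>h\<close> is
  left.\<close>

lemma X_jump:
  assumes s: "0 < s" "s \<le> t" and cont: "(V \<longlongrightarrow> V s) (at_left s)"
  shows "measure (LS_measure P) {s} = measure (LS_measure Q) {s}"
    and "X s = Xl s - h s * measure (LS_measure a) {s}"
proof -
  have "(V \<longlongrightarrow> left_lim P s - left_lim Q s) (at_left s)"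
  proof (rule Lim_transform_eventually)
    show "((\<lambda>u. P u - Q u) \<longlongrightarrow> left_lim P s - left_lim Q s) (at_left s)"
      by (intro tendsto_diff increasing_path_left_limit(1) P Q s)
    show "\<forall>\<^sub>F u in at_left s. P u - Q u = V u"
      unfolding eventually_at_left[OF s(1)] using s V by (intro exI[of _ 0]) auto
  qed
  hence "V s = left_lim P s - left_lim Q s" using cont by (intro tendsto_unique[of "at_left s" V]) auto
  thus eq: "measure (LS_measure P) {s} = measure (LS_measure Q) {s}"
    using measure_LS_measure_singleton[OF P s(1)] measure_LS_measure_singleton[OF Q s(1)] V[of s] s by simp
  have *: "(LINT x:{0<..s}|LS_measure W. g x) = (LINT x:{0<..<s}|LS_measure W. g x) + g s * measure (LS_measure W) {s}"
    if "set_integrable (LS_measure W) {0<..t} g" "increasing_path W" for g W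
  proof (rule set_integral_insert_right)
    show "set_integrable (LS_measure W) {0<..s} g"
      by (rule set_integrable_subset[OF that(1)]) (use s in auto)
    show "emeasure (LS_measure W) {s} < \<infinity>"
      using emeasure_LS_measure_finite[OF that(2), of "{s}" s] by simp
  qed (use s in auto)
  show "X s = Xl s - h s * measure (LS_measure a) {s}"
    using X[of s] s *[OF \<phi>P P] *[OF \<phi>Q Q] *[OF h_int inc] eq by (simp add: Xl_def)
qed

lemma Xl_bounded: "\<exists>K. \<forall>s\<in>{0<..t}. \<bar>Xl s\<bar> \<le> K"
proof -
  have "\<bar>Xl s\<bar> \<le> \<bar>X 0\<bar> + (LINT s:{0<..t}|LS_measure P. \<bar>\<phi> s\<bar>)
      + (LINT s:{0<..t}|LS_measure Q. \<bar>\<phi> s\<bar>) + (LINT s:{0<..t}|LS_measure a. \<bar>h s\<bar>)"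
    if s: "s \<in> {0<..t}" for s
  proof -
    have sub: "{0<..<s} \<subseteq> {0<..t}" using s by auto
    show ?thesis
      using set_integral_abs_le[OF \<phi>P _ sub] set_integral_abs_le[OF \<phi>Q _ sub] set_integral_abs_le[OF h_int _ sub]
      by (simp add: Xl_def)
  qed
  thus ?thesis by blast
qed

lemma Xl_measurable: "set_borel_measurable borel {0<..t} Xl"
proof -
  note * = set_borel_measurable_open_integral[OF sigma_finite_LS_measure sets_LS_measure,
      unfolded set_borel_measurable_def]
  note [measurable] = *[OF P \<phi>P] *[OF Q \<phi>Q] *[OF inc h_int]
  have "(\<lambda>s. indicat_real {0<..t} s *\<^sub>R X 0
      + indicat_real {0<..t} s *\<^sub>R (LINT s:{0<..<s}|LS_measure P. \<phi> s)
      - indicat_real {0<..t} s *\<^sub>R (LINT s:{0<..<s}|LS_measure Q. \<phi> s)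
      - indicat_real {0<..t} s *\<^sub>R (LINT s:{0<..<s}|LS_measure a. h s)) \<in> borel_measurable borel"
    by measurable
  thus ?thesis unfolding set_borel_measurable_def Xl_def by (simp add: algebra_simps)
qed

lemma borel_measurable_z: "(\<lambda>s. indicat_real {0<..t} s * z s) \<in> borel_measurable borel"
proof -
  have "(\<lambda>s. if s < 0 then 0 else a s) \<in> borel_measurable borel"
    by (rule borel_measurable_mono) (use increasing_path_extension(1)[OF inc] in \<open>auto simp: mono_def\<close>)
  hence "(\<lambda>s. indicat_real {0<..t} s * (1 - (if s < 0 then 0 else a s))) \<in> borel_measurable borel" by measurable
  moreover have "indicat_real {0<..t} s * (1 - (if s < 0 then 0 else a s)) = indicat_real {0<..t} s * z s" for s
    by (auto simp: z_def indicator_def)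
  ultimately show ?thesis by simp
qed

text \<open>Measurability of \<open>z\<close>, \<open>h\<close> and \<open>Xl\<close> is used on
  \<open>(0,t]\<close> only, so each of them carries the indicator; outside it they are all 0, and
  so is the quotient.\<close>

lemma H_measurable: "set_borel_measurable borel {0<..t} H"
proof -
  note [measurable] = borel_measurable_z
  have [measurable]: "(\<lambda>s. indicat_real {0<..t} s * h s) \<in> borel_measurable borel"
    using set_borel_measurable_subset[OF h, of "{0<..t}"] by (auto simp: set_borel_measurable_def subset_eq)
  have [measurable]: "(\<lambda>s. indicat_real {0<..t} s * Xl s) \<in> borel_measurable borel"
    using Xl_measurable by (simp add: set_borel_measurable_def)
  have "(\<lambda>s. z_left s / (indicat_real {0<..t} s * z s) *
     (indicat_real {0<..t} s * h s - indicat_real {0<..t} s * Xl s / z_left s)) \<in> borel_measurable borel"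
    by measurable
  also have "(\<lambda>s. z_left s / (indicat_real {0<..t} s * z s) *
     (indicat_real {0<..t} s * h s - indicat_real {0<..t} s * Xl s / z_left s)) = (\<lambda>s. indicat_real {0<..t} s *\<^sub>R H s)"
    by (auto simp: H_def indicator_def fun_eq_iff)
  finally show ?thesis by (simp add: set_borel_measurable_def)
qed

lemma H_integrable:
  assumes S: "S \<in> sets borel" "S \<subseteq> {0<..t}"
    and c: "0 < c" "\<And>s. s \<in> S \<Longrightarrow> c \<le> z_left s" "\<And>s. s \<in> S \<Longrightarrow> z s = 0 \<or> c \<le> z s"
  shows "set_integrable (LS_measure a) S (\<lambda>s. H s / z_left s)"
proof -
  obtain K where K: "\<And>s. s \<in> {0<..t} \<Longrightarrow> \<bar>Xl s\<bar> \<le> K" using Xl_bounded by blast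
  have fin: "emeasure (LS_measure a) S < \<infinity>"
    using emeasure_LS_measure_finite[OF inc, of S t] S by (auto simp: subset_eq)
  show "set_integrable (LS_measure a) S (\<lambda>s. H s / z_left s)"
  proof (rule set_integrable_bounded[OF _ fin])
    have 1: "(\<lambda>s. (indicat_real {0<..t} s *\<^sub>R H s) / z_left s) \<in> borel_measurable borel"
      using H_measurable unfolding set_borel_measurable_def by measurable
    have "set_borel_measurable borel {0<..t} (\<lambda>s. H s / z_left s)"
      using 1 by (simp add: set_borel_measurable_def)
    from set_borel_measurable_subset[OF this S]
    show "set_borel_measurable (LS_measure a) S (\<lambda>s. H s / z_left s)" by simp
    show "\<bar>H s / z_left s\<bar> \<le> 1 / c * (C + K / c)" if s: "s \<in> S" for s
    proof -
      have s': "0 < s" "s \<le> t" "0 < z_left s" using s S c(1) c(2)[OF s] by auto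
      have C: "0 \<le> C" using h_le[of 0] by simp
      have K0: "0 \<le> K" using K[of s] s' by simp
      have "H s / z_left s = 1 / z s * (h s - Xl s / z_left s)" using s' by (simp add: H_def)
      hence "\<bar>H s / z_left s\<bar> = \<bar>1 / z s\<bar> * \<bar>h s - Xl s / z_left s\<bar>" by (simp only: abs_mult)
      also have "\<dots> \<le> 1 / c * (C + K / c)"
      proof (intro mult_mono)
        show "\<bar>1 / z s\<bar> \<le> 1 / c" using c(1) c(3)[OF s] by (cases "z s = 0") (auto simp: abs_divide intro!: divide_left_mono)
        have "\<bar>h s - Xl s / z_left s\<bar> \<le> \<bar>h s\<bar> + \<bar>Xl s\<bar> / z_left s" using s' abs_triangle_ineq4[of "h s" "Xl s / z_left s"] by simp
        also have "\<bar>Xl s\<bar> / z_left s \<le> K / c" using K[of s] s' c(1) c(2)[OF s] by (intro frac_le) auto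
        finally show "\<bar>h s - Xl s / z_left s\<bar> \<le> C + K / c" using h_le[of s] s' by simp
      qed (use c(1) in auto)
      finally show ?thesis .
    qed
  qed (use S in auto)
qed

lemma \<phi>_integrable:
  assumes S: "S \<in> sets borel" "S \<subseteq> {0<..t}"
    and c: "0 < c" "\<And>s. s \<in> S \<Longrightarrow> c \<le> z_left s"
    and W: "set_integrable (LS_measure W) {0<..t} \<phi>"
  shows "set_integrable (LS_measure W) S (\<lambda>s. \<phi> s / z_left s)"
proof (rule set_integrable_bound)
  have W': "set_integrable (LS_measure W) S \<phi>" by (rule set_integrable_subset[OF W]) (use S in auto)
  thus "set_integrable (LS_measure W) S (\<lambda>s. \<phi> s / c)" by simp
  have "(\<lambda>s. (indicat_real S s *\<^sub>R \<phi> s) / z_left s) \<in> borel_measurable (LS_measure W)"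
    using borel_measurable_integrable[OF W'[unfolded set_integrable_def]] by measurable
  thus "set_borel_measurable (LS_measure W) S (\<lambda>s. \<phi> s / z_left s)"
    unfolding set_borel_measurable_def by simp
  show "AE s in LS_measure W. s \<in> S \<longrightarrow> norm (\<phi> s / z_left s) \<le> norm (\<phi> s / c)"
  proof (intro AE_I2 impI)
    fix s assume s: "s \<in> S"
    show "norm (\<phi> s / z_left s) \<le> norm (\<phi> s / c)"
      using c(1) c(2)[OF s] by (auto simp: abs_divide intro!: divide_left_mono)
  qed
qed

text \<open>Partial integration of \<open>X * (1/z)\<close>, term by term along the decomposition of
  \<open>X\<close>. The terms with \<open>\<phi>\<close> leave the last two integrals; the integrals
  against \<open>dv\<close> recombine to that of \<open>X\<close>, which the density identity turns
  into an integral against \<open>da\<close>.\<close>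

lemma quotient_formula:
  assumes T: "0 \<le> T" "T \<le> t" "0 < z T"
  shows "X T / z T = X 0 / z 0 - (LINT s:{0<..T}|LS_measure a. H s / z_left s)
    + (LINT s:{0<..T}|LS_measure P. \<phi> s / z_left s) - (LINT s:{0<..T}|LS_measure Q. \<phi> s / z_left s)"
proof -
  interpret at: sub_distribution_at a T by unfold_locales (use T in auto)
  have sub: "set_integrable \<mu> {0<..T} g" if "set_integrable \<mu> {0<..t} g" "sets \<mu> = sets borel"
    for \<mu> and g :: "real \<Rightarrow> real"
    by (rule set_integrable_subset[OF that(1)]) (use T that(2) in auto)
  note P' = at.integral_by_parts[OF P sub[OF \<phi>P sets_LS_measure]] and Q' = at.integral_by_parts[OF Q sub[OF \<phi>Q sets_LS_measure]]
    and A' = at.integral_by_parts[OF inc sub[OF h_int sets_LS_measure]]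
  define v where "v = at.v"
  have v: "v T = 1 / z T" "v 0 = 1 / z 0" using T by (auto simp: v_def at.v_def)
  have X': "X s = X 0 + (LINT s:{0<..s}|LS_measure P. \<phi> s)
      - (LINT s:{0<..s}|LS_measure Q. \<phi> s) - (LINT s:{0<..s}|LS_measure a. h s)" if "s \<in> {0<..T}" for s
    using X[of s] T that by auto
  have vfin: "emeasure (LS_measure v) {0<..T} < \<infinity>"
    unfolding v_def by (rule emeasure_LS_measure_finite[OF at.inc_v, of _ T]) auto
  have cint: "set_integrable (LS_measure v) {0<..T} (\<lambda>_. X 0)"
    using vfin by (intro set_integrable_bounded[where K = "\<bar>X 0\<bar>"]) (auto simp: set_borel_measurable_def)
  have mv: "measure (LS_measure v) {0<..T} = v T - v 0"
    using emeasure_LS_measure_Ioc[OF at.inc_v, of 0 T] T increasing_pathD(2)[OF at.inc_v, of 0 T]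
    by (simp add: measure_def v_def)
  have const: "(LINT s:{0<..T}|LS_measure v. X 0) = X 0 * (v T - v 0)"
    using vfin mv by (simp add: set_lebesgue_integral_def)
  note ints = cint P'(1) Q'(1) A'(1)
  have Xint: "set_integrable (LS_measure v) {0<..T} X"
  proof -
    have "set_integrable (LS_measure v) {0<..T} (\<lambda>s. X 0 + (LINT s:{0<..s}|LS_measure P. \<phi> s)
      - (LINT s:{0<..s}|LS_measure Q. \<phi> s) - (LINT s:{0<..s}|LS_measure a. h s))"
      using ints unfolding v_def by (intro set_integral_diff set_integral_add) auto
    thus ?thesis using X' by (subst set_integrable_cong[OF refl refl]) auto
  qed
  have "(LINT s:{0<..T}|LS_measure v. X s) = (LINT s:{0<..T}|LS_measure v. X 0 + (LINT s:{0<..s}|LS_measure P. \<phi> s)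
      - (LINT s:{0<..s}|LS_measure Q. \<phi> s) - (LINT s:{0<..s}|LS_measure a. h s))"
    by (rule set_lebesgue_integral_cong) (use X' in auto)
  also have "\<dots> = X 0 * (v T - v 0) + (LINT s:{0<..T}|LS_measure v. LINT s:{0<..s}|LS_measure P. \<phi> s)
      - (LINT s:{0<..T}|LS_measure v. LINT s:{0<..s}|LS_measure Q. \<phi> s)
      - (LINT s:{0<..T}|LS_measure v. LINT s:{0<..s}|LS_measure a. h s)"
    using ints unfolding v_def const[unfolded v_def, symmetric] by (simp add: set_integral_diff set_integral_add)
  finally have 1: "(LINT s:{0<..T}|LS_measure v. X s) = \<dots>" .
  have 2: "X T * v T = X 0 * v 0 + (LINT s:{0<..T}|LS_measure P. \<phi> s / z_left s)
    - (LINT s:{0<..T}|LS_measure Q. \<phi> s / z_left s) - (LINT s:{0<..T}|LS_measure a. h s / z_left s)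
    + (LINT s:{0<..T}|LS_measure v. X s)"
  proof -
    have "X T * v T = X 0 * v T + (LINT s:{0<..T}|LS_measure P. \<phi> s) * v T
      - (LINT s:{0<..T}|LS_measure Q. \<phi> s) * v T - (LINT s:{0<..T}|LS_measure a. h s) * v T"
      unfolding X[OF T(1,2)] by (simp add: algebra_simps)
    moreover have "(LINT s:{0<..T}|LS_measure P. \<phi> s) * v T = (LINT s:{0<..T}|LS_measure P. \<phi> s / z_left s)
        + (LINT s:{0<..T}|LS_measure v. LINT s:{0<..s}|LS_measure P. \<phi> s)"
      "(LINT s:{0<..T}|LS_measure Q. \<phi> s) * v T = (LINT s:{0<..T}|LS_measure Q. \<phi> s / z_left s)
        + (LINT s:{0<..T}|LS_measure v. LINT s:{0<..s}|LS_measure Q. \<phi> s)"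
      "(LINT s:{0<..T}|LS_measure a. h s) * v T = (LINT s:{0<..T}|LS_measure a. h s / z_left s)
        + (LINT s:{0<..T}|LS_measure v. LINT s:{0<..s}|LS_measure a. h s)"
      using P'(3) Q'(3) A'(3) by (simp_all add: v_def)
    ultimately show ?thesis unfolding 1 by (simp add: algebra_simps)
  qed
  note Xv = at.set_integral_v[OF Xint[unfolded v_def], folded v_def]
  \<comment> \<open>Here the jump relation enters. It expresses \<open>X\<close> by
    \<open>Xl\<close> only for \<open>da\<close>-almost all times, which suffices since the
    integrals to be compared are taken against \<open>da\<close>.\<close>
  have 3: "(LINT s:{0<..T}|LS_measure a. h s / z_left s) - (LINT s:{0<..T}|LS_measure v. X s) =
      (LINT s:{0<..T}|LS_measure a. H s / z_left s)"
  proof -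
    have "(LINT s:{0<..T}|LS_measure a. h s / z_left s) - (LINT s:{0<..T}|LS_measure v. X s) =
      (LINT s:{0<..T}|LS_measure a. h s / z_left s - X s * (v s / z_left s))"
      unfolding Xv(1) using A'(2) Xv(2) by (simp add: set_integral_diff)
    also have "\<dots> = (LINT s:{0<..T}|LS_measure a. H s / z_left s)"
      unfolding set_lebesgue_integral_def
    proof (rule integral_cong_AE)
      have "set_integrable (LS_measure a) {0<..T} (\<lambda>s. h s / z_left s - X s * (v s / z_left s))"
        using A'(2) Xv(2) by (rule set_integral_diff)
      thus "(\<lambda>s. indicat_real {0<..T} s *\<^sub>R (h s / z_left s - X s * (v s / z_left s))) \<in> borel_measurable (LS_measure a)"
        unfolding set_integrable_def by (rule borel_measurable_integrable)
      have "set_integrable (LS_measure a) {0<..T} (\<lambda>s. H s / z_left s)"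
      proof (rule H_integrable)
        fix s assume s: "s \<in> {0<..T}"
        thus "z T \<le> z_left s" using at.z_left_ge_z by auto
        show "z s = 0 \<or> z T \<le> z s" using z_antimono[of s T] s by auto
      qed (use T in auto)
      thus "(\<lambda>s. indicat_real {0<..T} s *\<^sub>R (H s / z_left s)) \<in> borel_measurable (LS_measure a)"
        unfolding set_integrable_def by (rule borel_measurable_integrable)
      show "AE s in LS_measure a. indicat_real {0<..T} s *\<^sub>R (h s / z_left s - X s * (v s / z_left s)) =
          indicat_real {0<..T} s *\<^sub>R (H s / z_left s)"
        using V_cont
      proof eventually_elim
        case (elim s)
        show ?case
        proof (cases "s \<in> {0<..T}")
          case True
          hence s: "0 < s" "s \<le> t" "s \<le> T" using T by auto
          have z: "0 < z s" "0 < z_left s" "v s = 1 / z s"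
            using z_antimono[of s T] s T z_le_z_left[of s] by (auto simp: v_def at.v_def min_def)
          have "X s = Xl s - h s * measure (LS_measure a) {s}"
            using X_jump(2)[OF s(1,2)] elim s by simp
          also have "measure (LS_measure a) {s} = z_left s - z s"
            using z_left_eq_plus[OF s(1)] by simp
          \<comment> \<open>Because the atom of \<open>a\<close> is \<open>z_left - z\<close>, the
            jump of \<open>X\<close> trades the full values of \<open>z\<close> and \<open>X\<close>
            for their left limits.\<close>
          finally have "h s * z s - X s = h s * z_left s - Xl s" by (simp add: algebra_simps)
          moreover have "h s / z_left s - X s * (1 / z s / z_left s) = (h s * z s - X s) / (z s * z_left s)"
            "H s / z_left s = (h s * z_left s - Xl s) / (z s * z_left s)"
            using z(1,2) by (simp_all add: H_def field_simps)
          ultimately have "h s / z_left s - X s * (1 / z s / z_left s) = H s / z_left s" by simp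
          thus ?thesis using z(3) by simp
        qed simp
      qed
    qed
    finally show ?thesis .
  qed
  show ?thesis using 2 3 by (simp add: v)
qed

end

section \<open>The jump path of the random time and its compensator\<close>

lemma increasing_path_jump: "increasing_path (\<lambda>u. of_bool (\<tau> \<le> ennreal u))" (is "increasing_path ?A")
  unfolding increasing_path_def
proof (intro conjI allI impI)
  show "mono_on {0..} ?A" by (auto intro!: monotone_onI dest: order_trans[OF _ ennreal_leI])
  fix s :: real assume s: "0 \<le> s"
  have "(?A \<longlongrightarrow> ?A s) (at_right s)"
  proof (cases "\<tau> \<le> ennreal s")
    case True
    hence "\<forall>\<^sub>F u in at_right s. ?A s = ?A u"
      unfolding eventually_at_right[of s "s + 1", simplified] using s
      by (intro exI[of _ "s + 1"]) (auto intro: order_trans ennreal_leI)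
    thus ?thesis by (rule Lim_transform_eventually[OF tendsto_const])
  next
    case False
    \<comment> \<open>A time strictly between \<open>s\<close> and \<open>\<tau>\<close>, finite
      even if \<open>\<tau>\<close> is not; up to it the path stays 0.\<close>
    then obtain r where r: "ennreal s < r" "r < \<tau>" using dense[of "ennreal s" \<tau>] by (auto simp: not_le)
    then obtain r' where r': "r = ennreal r'" "0 \<le> r'" by (cases r) auto
    have "s < r'" using r(1) s r' by (simp add: ennreal_less_iff)
    hence "\<forall>\<^sub>F u in at_right s. ?A s = ?A u"
      unfolding eventually_at_right[OF \<open>s < r'\<close>] using s r r' False
      by (intro exI[of _ r']) (auto simp: not_le intro: less_trans le_less_trans dest: ennreal_leI[OF less_imp_le])
    thus ?thesis by (rule Lim_transform_eventually[OF tendsto_const])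
  qed
  thus "continuous (at_right s) ?A" by (simp add: continuous_within)
qed simp


text \<open>The case distinction is forced by \<open>enn2real\<close>, which would place an infinite
  time at 0.\<close>

lemma LS_measure_jump:
  "LS_measure (\<lambda>u. of_bool (\<tau> \<le> ennreal u)) = (if \<tau> = \<top> then null_measure borel else return borel (enn2real \<tau>))"
proof (rule LS_measure_unique[OF increasing_path_jump, symmetric])
  fix t
  show "emeasure (if \<tau> = \<top> then null_measure borel else return borel (enn2real \<tau>)) {..t} =
      (if t < 0 then 0 else ennreal (of_bool (\<tau> \<le> ennreal t)))"
    by (cases \<tau>) (auto simp: indicator_def top_unique)
qed simp

lemma set_integral_jump:
  fixes f :: "real \<Rightarrow> real" and \<tau> :: ennreal
  assumes f: "set_borel_measurable borel {0<..t} f"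
  defines "A \<equiv> \<lambda>u. of_bool (\<tau> \<le> ennreal u)"
  shows "set_integrable (LS_measure A) {0<..t} f"
    and "(LINT s:{0<..t}|LS_measure A. f s) = (if 0 < \<tau> \<and> \<tau> \<le> ennreal t then f (enn2real \<tau>) else 0)"
proof -
  have [measurable]: "(\<lambda>s. indicat_real {0<..t} s * f s) \<in> borel_measurable borel"
    using f by (simp add: set_borel_measurable_def)
  have "set_integrable (LS_measure A) {0<..t} f \<and>
    (LINT s:{0<..t}|LS_measure A. f s) = (if 0 < \<tau> \<and> \<tau> \<le> ennreal t then f (enn2real \<tau>) else 0)"
  proof (cases \<tau>)
    case top
    hence "LS_measure A = null_measure borel" by (simp add: A_def LS_measure_jump)
    thus ?thesis using top by (auto simp: set_integrable_def set_lebesgue_integral_def top_unique)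
  next
    case (real T)
    hence "LS_measure A = return borel T" by (simp add: A_def LS_measure_jump)
    moreover define g where "g s = indicat_real {0<..t} s * f s" for s
    have [measurable]: "g \<in> borel_measurable borel" unfolding g_def by measurable
    have "integrable (return borel T) g"
      by (simp add: integrable_iff_bounded nn_integral_return)
    moreover have "(\<integral>s. g s \<partial>return borel T) = g T" by (rule integral_return) auto
    moreover have "0 < \<tau> \<and> \<tau> \<le> ennreal t \<longleftrightarrow> 0 < T \<and> T \<le> t"
    proof (cases "0 \<le> t")
      case False
      thus ?thesis using real by (auto simp: ennreal_neg)
    qed (use real in auto)
    moreover have "enn2real \<tau> = T" using real by simp
    ultimately show ?thesis
      by (simp add: set_integrable_def set_lebesgue_integral_def flip: g_def) (simp add: g_def indicator_def)
  qed
  thus "set_integrable (LS_measure A) {0<..t} f"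
    "(LINT s:{0<..t}|LS_measure A. f s) = (if 0 < \<tau> \<and> \<tau> \<le> ennreal t then f (enn2real \<tau>) else 0)" by auto
qed


text \<open>The bound on \<open>z\<close> is required strictly before \<open>\<tau>\<close> only. It
  passes to \<open>z_left\<close> up to and including \<open>\<tau>\<close>, while \<open>z\<close>
  itself may drop to 0 at \<open>\<tau>\<close>.\<close>

locale killed_path = sub_distribution +
  fixes \<tau> :: ennreal
  assumes survival: "\<And>u. 0 \<le> u \<Longrightarrow> \<exists>c>0. \<forall>s. 0 \<le> s \<and> s \<le> u \<and> ennreal s < \<tau> \<longrightarrow> c \<le> z s"
begin

definition B where "B u = (LINT s:{s. 0 < s \<and> s \<le> u \<and> ennreal s \<le> \<tau>}|LS_measure a. 1 / z_left s)"

lemma z_left_lower: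
  "\<exists>c>0. \<forall>s. 0 < s \<and> s \<le> u \<and> ennreal s \<le> \<tau> \<longrightarrow> c \<le> z_left s"
proof -
  obtain c where c: "c > 0" "\<And>s. 0 \<le> s \<Longrightarrow> s \<le> max 0 u \<Longrightarrow> ennreal s < \<tau> \<Longrightarrow> c \<le> z s"
    using survival[of "max 0 u"] by auto
  have "c \<le> z_left s" if "0 < s" "s \<le> u" "ennreal s \<le> \<tau>" for s
  proof (rule z_left_ge)
    fix r assume r: "0 \<le> r" "r < s"
    hence "ennreal r < ennreal s" by (simp add: ennreal_lessI)
    thus "c \<le> z r" using c(2)[of r] r that by auto
  qed (use that in auto)
  thus ?thesis using c(1) by blast
qed

text \<open>The density of \<open>dB\<close> with respect to \<open>da\<close>; its vanishing up to
  time 0 keeps an atom of \<open>a\<close> at 0 out of \<open>dB\<close>.\<close>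

definition k where "k s = (if 0 < s \<and> ennreal s \<le> \<tau> then 1 / z_left s else 0)"

lemma borel_measurable_k [measurable]: "k \<in> borel_measurable borel"
  unfolding k_def by measurable

lemma k_nonneg: "0 \<le> k s" using z_left_nonneg by (auto simp: k_def)

lemma B_eq: "B u = (LINT s:{0<..u}|LS_measure a. k s)"
  unfolding B_def set_lebesgue_integral_def
  by (intro Bochner_Integration.integral_cong refl) (auto simp: k_def indicator_def)

lemma k_bounded: "\<exists>K. \<forall>s\<le>u. \<bar>k s\<bar> \<le> K"
proof -
  obtain c where c: "c > 0" "\<And>s. 0 < s \<Longrightarrow> s \<le> u \<Longrightarrow> ennreal s \<le> \<tau> \<Longrightarrow> c \<le> z_left s"
    using z_left_lower[of u] by blast
  have "\<bar>k s\<bar> \<le> 1 / c" if "s \<le> u" for s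
    using c(1) c(2)[of s] that by (auto simp: k_def abs_divide intro!: divide_left_mono)
  thus ?thesis by blast
qed

lemma k_integrable: "set_integrable (LS_measure a) {0<..u} k"
proof -
  obtain K where K: "\<And>s. s \<le> u \<Longrightarrow> \<bar>k s\<bar> \<le> K" using k_bounded by blast
  show ?thesis
    by (rule set_integrable_bounded[where K = K])
      (use K emeasure_LS_measure_finite[OF inc, of "{0<..u}" u] in \<open>auto simp: subset_eq set_borel_measurable_def\<close>)
qed

lemma inc_B: "increasing_path B"
  unfolding increasing_path_def
proof (intro conjI allI impI)
  show "0 \<le> B 0" by (simp add: B_eq set_lebesgue_integral_def)
  show "mono_on {0..} B"
  proof (rule monotone_onI)
    fix r s :: real assume rs: "r \<le> s"
    show "B r \<le> B s" unfolding B_eq set_lebesgue_integral_def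
      using k_integrable[unfolded set_integrable_def] rs k_nonneg
      by (intro integral_mono) (auto split: split_indicator)
  qed
  fix s :: real assume "0 \<le> s"
  thus "continuous (at_right s) B"
    unfolding continuous_within B_eq
    by (intro set_integral_Ioc_tendsto_right[OF k_integrable[of "s + 1"]]) auto
qed

lemma LS_measure_B: "LS_measure B = density (LS_measure a) (\<lambda>s. ennreal (k s))"
proof (rule LS_measure_unique[OF inc_B, symmetric])
  fix u
  have "emeasure (density (LS_measure a) (\<lambda>s. ennreal (k s))) {..u} = (\<integral>\<^sup>+s. ennreal (indicat_real {0<..u} s *\<^sub>R k s) \<partial>LS_measure a)"
    by (auto simp: emeasure_density k_def indicator_def intro!: nn_integral_cong)
  also have "\<dots> = ennreal (\<integral>s. indicat_real {0<..u} s *\<^sub>R k s \<partial>LS_measure a)"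
    using k_integrable[of u, unfolded set_integrable_def] k_nonneg by (intro nn_integral_eq_integral) auto
  also have "\<dots> = ennreal (B u)" by (simp add: B_eq set_lebesgue_integral_def)
  finally show "emeasure (density (LS_measure a) (\<lambda>s. ennreal (k s))) {..u} = (if u < 0 then 0 else ennreal (B u))"
    by (auto simp: B_eq set_lebesgue_integral_def)
qed simp

lemma set_integral_B:
  fixes f :: "real \<Rightarrow> real"
  assumes f: "set_borel_measurable borel {0<..t} f"
    and int: "set_integrable (LS_measure a) {s. 0 < s \<and> s \<le> t \<and> ennreal s \<le> \<tau>} (\<lambda>s. f s / z_left s)"
  shows "set_integrable (LS_measure B) {0<..t} f"
    and "(LINT s:{0<..t}|LS_measure B. f s) = (LINT s:{s. 0 < s \<and> s \<le> t \<and> ennreal s \<le> \<tau>}|LS_measure a. f s / z_left s)"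
proof -
  define g where "g s = indicat_real {0<..t} s *\<^sub>R f s" for s
  have [measurable]: "g \<in> borel_measurable borel"
    using f by (simp add: set_borel_measurable_def g_def[abs_def])
  have eq: "k s *\<^sub>R g s = indicat_real {s. 0 < s \<and> s \<le> t \<and> ennreal s \<le> \<tau>} s *\<^sub>R (f s / z_left s)" for s
    by (auto simp: k_def g_def indicator_def)
  have "integrable (LS_measure a) (\<lambda>s. k s *\<^sub>R g s)"
    unfolding eq using int by (simp only: set_integrable_def)
  hence "integrable (LS_measure B) g"
    unfolding LS_measure_B using k_nonneg by (subst integrable_density) auto
  thus "set_integrable (LS_measure B) {0<..t} f"
    by (simp add: set_integrable_def g_def[abs_def])
  have "(LINT s:{0<..t}|LS_measure B. f s) = (\<integral>s. g s \<partial>LS_measure B)"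
    by (simp add: set_lebesgue_integral_def g_def)
  also have "\<dots> = (\<integral>s. k s *\<^sub>R g s \<partial>LS_measure a)"
    unfolding LS_measure_B using k_nonneg by (subst integral_density) auto
  finally show "(LINT s:{0<..t}|LS_measure B. f s) = (LINT s:{s. 0 < s \<and> s \<le> t \<and> ennreal s \<le> \<tau>}|LS_measure a. f s / z_left s)"
    unfolding eq set_lebesgue_integral_def .
qed

end

text \<open>\<open>\<tau>\<close> need not be an atom of \<open>da\<close>, so continuity of
  \<open>V\<close> there does not follow from the almost-everywhere statement and is a separate
  assumption. \<open>X_vanish\<close> covers a random time on the last atom of its law.
  \<open>Y\<close> is the candidate for the conditional expectation.\<close>

locale killed_jump_path = killed_path + jump_path +
  fixes Y :: "real \<Rightarrow> real"
  assumes V_cont_\<tau>: "\<And>T. 0 < T \<Longrightarrow> \<tau> = ennreal T \<Longrightarrow> (V \<longlongrightarrow> V T) (at_left T)"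
    and X_vanish: "\<And>T. 0 < T \<Longrightarrow> T \<le> t \<Longrightarrow> \<tau> = ennreal T \<Longrightarrow> z T = 0 \<Longrightarrow> X T = 0"
    and Y: "\<And>u. 0 \<le> u \<Longrightarrow> u \<le> t \<Longrightarrow> Y u = (if \<tau> \<le> ennreal u then h (enn2real \<tau>) else X u / z u)"
begin

abbreviation A where "A \<equiv> \<lambda>u. of_bool (\<tau> \<le> ennreal u) :: real"

abbreviation S where "S \<equiv> {s. 0 < s \<and> s \<le> t \<and> ennreal s \<le> \<tau>}"

text \<open>A common constant for the integrability of \<open>H\<close>, for that of
  \<open>\<phi>\<close>, and for the validity of the quotient formula before
  \<open>\<tau>\<close>.\<close>

lemma S_bounds:
  "\<exists>c>0. (\<forall>s\<in>S. c \<le> z_left s) \<and> (\<forall>s\<in>S. z s = 0 \<or> c \<le> z s) \<and>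
    (\<forall>s. 0 \<le> s \<longrightarrow> s \<le> t \<longrightarrow> ennreal s < \<tau> \<longrightarrow> c \<le> z s)"
proof -
  obtain c where c: "c > 0" "\<And>s. 0 \<le> s \<Longrightarrow> s \<le> t \<Longrightarrow> ennreal s < \<tau> \<Longrightarrow> c \<le> z s"
    using survival[OF t] by auto
  obtain c' where c': "c' > 0" "\<And>s. s \<in> S \<Longrightarrow> c' \<le> z_left s"
    using z_left_lower[of t] by auto
  \<comment> \<open>Takes care of \<open>z\<close> at the single time \<open>\<tau>\<close>; any
    positive number will do if that value is 0.\<close>
  define c'' where "c'' = (if z (enn2real \<tau>) > 0 then z (enn2real \<tau>) else 1)"
  have c'': "c'' > 0" by (simp add: c''_def)
  show ?thesis
  proof (rule exI[of _ "min (min c c') c''"], intro conjI ballI allI impI)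
    fix s assume s: "s \<in> S"
    show "min (min c c') c'' \<le> z_left s" using c'(2)[OF s] by auto
    show "z s = 0 \<or> min (min c c') c'' \<le> z s"
    proof (cases "ennreal s < \<tau>")
      case True
      thus ?thesis using c(2)[of s] s by auto
    next
      case False
      hence "\<tau> = ennreal s" using s by auto
      hence "enn2real \<tau> = s" using s by auto
      thus ?thesis using z_nonneg[of s] s by (auto simp: c''_def)
    qed
  next
    fix s assume "0 \<le> s" "s \<le> t" "ennreal s < \<tau>"
    thus "min (min c c') c'' \<le> z s" using c(2)[of s] by auto
  qed (use c(1) c'(1) c'' in auto)
qed

definition I where "I = (LINT s:{0<..t}|LS_measure A. H s) - (LINT s:{0<..t}|LS_measure B. H s)"
text \<open>Integration over \<open>S\<close> accounts for the factor \<open>1 - A_-\<close>, which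
  is the indicator of \<open>s \<le> \<tau>\<close>.\<close>

definition J where "J = (LINT s:S|LS_measure P. \<phi> s / z_left s) - (LINT s:S|LS_measure Q. \<phi> s / z_left s)"

lemma has_integral_I: "has_LS_integral (\<lambda>u. A u - B u) H t I"
  and H_integrable_S: "set_integrable (LS_measure a) S (\<lambda>s. H s / z_left s)"
proof -
  obtain c where c: "0 < c" "\<And>s. s \<in> S \<Longrightarrow> c \<le> z_left s" "\<And>s. s \<in> S \<Longrightarrow> z s = 0 \<or> c \<le> z s"
    using S_bounds by blast
  show int: "set_integrable (LS_measure a) S (\<lambda>s. H s / z_left s)"
    by (rule H_integrable[OF _ _ c]) auto
  show "has_LS_integral (\<lambda>u. A u - B u) H t I"
    unfolding has_LS_integral_def I_def
    by (intro exI[of _ A] exI[of _ B] conjI increasing_path_jump inc_B set_integral_jump(1) set_integral_B(1) H_measurable int) auto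
qed

lemma \<phi>_integrable_S:
  assumes "set_integrable (LS_measure W) {0<..t} \<phi>"
  shows "set_integrable (LS_measure W) S (\<lambda>s. \<phi> s / z_left s)"
proof -
  obtain c where c: "0 < c" "\<And>s. s \<in> S \<Longrightarrow> c \<le> z_left s" using S_bounds by blast
  show ?thesis by (rule \<phi>_integrable[OF _ _ c assms]) auto
qed

lemma has_integral_J: "has_LS_integral V (\<lambda>s. of_bool (ennreal s \<le> \<tau>) / z_left s * \<phi> s) t J"
proof -
  have "set_integrable (LS_measure W) {0<..t} (\<lambda>s. of_bool (ennreal s \<le> \<tau>) / z_left s * \<phi> s) =
      set_integrable (LS_measure W) S (\<lambda>s. \<phi> s / z_left s)" for W
    unfolding set_integrable_def
    by (intro arg_cong[where f = "integrable _"] ext) (auto simp: indicator_def)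
  moreover have "(LINT s:{0<..t}|LS_measure W. of_bool (ennreal s \<le> \<tau>) / z_left s * \<phi> s) =
      (LINT s:S|LS_measure W. \<phi> s / z_left s)" for W
    unfolding set_lebesgue_integral_def
    by (intro Bochner_Integration.integral_cong refl) (auto simp: indicator_def)
  ultimately show ?thesis
    unfolding has_LS_integral_def J_def
    by (intro exI[of _ P] exI[of _ Q] conjI P Q) (use V \<phi>_integrable_S[OF \<phi>P] \<phi>_integrable_S[OF \<phi>Q] in auto)
qed

text \<open>If \<open>\<tau>\<close> exceeds \<open>t\<close>, this is
  \<open>quotient_formula\<close> at \<open>t\<close>. If \<open>\<tau> = T\<close> lies in
  \<open>(0,t]\<close>, that formula is applied strictly before \<open>T\<close>; its limit gives
  \<open>Xl T / z_left T\<close>, and the contributions of the single time \<open>T\<close> make up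
  the difference to \<open>h T\<close>. For \<open>\<tau> = 0\<close> all integrals vanish.\<close>

lemma martingale_formula: "Y t = Y 0 + I + J"
proof (cases "0 < \<tau>")
  case False
  hence \<tau>: "\<tau> = 0" by (simp add: not_less)
  hence S: "S = {}" by (auto simp: ennreal_eq_0_iff)
  have "(LINT s:{0<..t}|LS_measure A. H s) = 0" using set_integral_jump(2)[OF H_measurable, of \<tau>] by (simp only: False simp_thms if_False)
  moreover have "(LINT s:{0<..t}|LS_measure B. H s) = 0"
    using set_integral_B(2)[OF H_measurable H_integrable_S] unfolding S by (simp add: set_lebesgue_integral_def)
  ultimately have "I = 0" "J = 0" unfolding I_def J_def S by (auto simp: set_lebesgue_integral_def)
  thus ?thesis using Y[of 0] Y[of t] t \<tau> by simp
next
  case pos: True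
  have Y0: "Y 0 = X 0 / z 0" using Y[of 0] t pos by (simp add: zero_less_iff_neq_zero)
  have IA: "I = (if \<tau> \<le> ennreal t then H (enn2real \<tau>) else 0) - (LINT s:S|LS_measure a. H s / z_left s)"
    unfolding I_def using pos set_integral_jump(2)[OF H_measurable] set_integral_B(2)[OF H_measurable H_integrable_S] by auto
  show ?thesis
  proof (cases "\<tau> \<le> ennreal t")
    case False
    hence S: "S = {0<..t}" by (auto simp: not_le intro: order_trans[OF ennreal_leI less_imp_le])
    obtain c where "0 < c" "c \<le> z t" using S_bounds False t by (auto simp: not_le)
    hence "0 < z t" by simp
    from quotient_formula[OF t order_refl this] show ?thesis
      using IA False unfolding J_def S by (simp add: Y0 Y[OF t order_refl])
  next
    case True
    then obtain T where T: "\<tau> = ennreal T" "0 < T" "T \<le> t"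
      using pos t by (cases \<tau>) (auto simp: top_unique)
    have S: "S = {0<..T}" using T by (auto simp: ennreal_le_iff)
    note S_int = H_integrable_S[unfolded S] \<phi>_integrable_S[OF \<phi>P, unfolded S] \<phi>_integrable_S[OF \<phi>Q, unfolded S]
    note lim = set_integral_Ioc_tendsto_left[OF S_int(1) sets_LS_measure T(2) order_refl]
      set_integral_Ioc_tendsto_left[OF S_int(2) sets_LS_measure T(2) order_refl]
      set_integral_Ioc_tendsto_left[OF S_int(3) sets_LS_measure T(2) order_refl]
    obtain c where c: "0 < c" "\<And>s. s \<in> S \<Longrightarrow> c \<le> z_left s"
      "\<And>s. 0 \<le> s \<Longrightarrow> s \<le> t \<Longrightarrow> ennreal s < \<tau> \<Longrightarrow> c \<le> z s" using S_bounds by blast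
    have zl: "0 < z_left T" using c(1) c(2)[of T] S T by auto
    have "((\<lambda>u. X 0 / z 0 - (LINT s:{0<..u}|LS_measure a. H s / z_left s)
      + (LINT s:{0<..u}|LS_measure P. \<phi> s / z_left s) - (LINT s:{0<..u}|LS_measure Q. \<phi> s / z_left s)) \<longlongrightarrow>
      X 0 / z 0 - (LINT s:{0<..<T}|LS_measure a. H s / z_left s)
      + (LINT s:{0<..<T}|LS_measure P. \<phi> s / z_left s) - (LINT s:{0<..<T}|LS_measure Q. \<phi> s / z_left s)) (at_left T)"
      by (intro tendsto_intros lim)
    moreover have "\<forall>\<^sub>F u in at_left T. X 0 / z 0 - (LINT s:{0<..u}|LS_measure a. H s / z_left s)
      + (LINT s:{0<..u}|LS_measure P. \<phi> s / z_left s) - (LINT s:{0<..u}|LS_measure Q. \<phi> s / z_left s) = X u / z u"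
      unfolding eventually_at_left[OF T(2)]
    proof (intro exI[of _ 0] conjI T allI impI)
      fix u assume u: "0 < u" "u < T"
      hence "ennreal u < \<tau>" using T by (simp add: ennreal_lessI)
      hence "0 < z u" using c(1) c(3)[of u] u T by auto
      thus "X 0 / z 0 - (LINT s:{0<..u}|LS_measure a. H s / z_left s)
      + (LINT s:{0<..u}|LS_measure P. \<phi> s / z_left s) - (LINT s:{0<..u}|LS_measure Q. \<phi> s / z_left s) = X u / z u"
        using quotient_formula[of u] u T by simp
    qed
    ultimately have "((\<lambda>u. X u / z u) \<longlongrightarrow> X 0 / z 0 - (LINT s:{0<..<T}|LS_measure a. H s / z_left s)
      + (LINT s:{0<..<T}|LS_measure P. \<phi> s / z_left s) - (LINT s:{0<..<T}|LS_measure Q. \<phi> s / z_left s)) (at_left T)"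
      by (rule Lim_transform_eventually)
    moreover have "((\<lambda>u. X u / z u) \<longlongrightarrow> Xl T / z_left T) (at_left T)"
      using zl T by (intro tendsto_intros X_tendsto_left z_tendsto_left) auto
    ultimately have lim_eq: "Xl T / z_left T = X 0 / z 0 - (LINT s:{0<..<T}|LS_measure a. H s / z_left s)
      + (LINT s:{0<..<T}|LS_measure P. \<phi> s / z_left s) - (LINT s:{0<..<T}|LS_measure Q. \<phi> s / z_left s)"
      by (intro tendsto_unique[of "at_left T"]) auto
    have fin: "emeasure (LS_measure W) {T} < \<infinity>" if "increasing_path W" for W
      using emeasure_LS_measure_finite[OF that, of "{T}" T] by simp
    note jump = X_jump[OF T(2,3) V_cont_\<tau>[OF T(2,1)]]
    note ins = set_integral_insert_right[OF S_int(1) sets_LS_measure T(2) fin[OF inc]]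
      set_integral_insert_right[OF S_int(2) sets_LS_measure T(2) fin[OF P]]
      set_integral_insert_right[OF S_int(3) sets_LS_measure T(2) fin[OF Q]]
    have m: "measure (LS_measure a) {T} = z_left T - z T" using z_left_eq_plus[OF T(2)] by simp
    \<comment> \<open>On the last atom of the law both sides are 0: the left one by
      \<open>z T = 0\<close>, the right one because \<open>X T = 0\<close> forces
      \<open>Xl T = h T * z_left T\<close>.\<close>
    have "H T * z T / z_left T = h T - Xl T / z_left T"
    proof (cases "z T = 0")
      case True
      hence "Xl T = h T * z_left T" using X_vanish[OF T(2,3,1)] jump(2) m by simp
      thus ?thesis using True zl by simp
    next
      case False
      thus ?thesis using zl by (simp add: H_def)
    qed
    \<comment> \<open>The net jump of the first integral at \<open>T\<close>: the unit atom of
      \<open>A\<close> less the atom \<open>(z_left T - z T) / z_left T\<close> of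
      \<open>B\<close>.\<close>
    moreover have "H T - H T / z_left T * (z_left T - z T) = H T * z T / z_left T"
      using zl by (simp add: field_simps)
    ultimately have "h T = Xl T / z_left T + H T - H T / z_left T * measure (LS_measure a) {T}"
      unfolding m by simp
    moreover have "Y t = h T" using Y[OF t order_refl] True T by simp
    moreover have "I = H T - (LINT s:{0<..<T}|LS_measure a. H s / z_left s) - H T / z_left T * measure (LS_measure a) {T}"
      unfolding IA S ins(1) using True T by simp
    \<comment> \<open>The atoms of \<open>P\<close> and \<open>Q\<close> at \<open>T\<close> are
      equal, so that including \<open>T\<close> does not change the difference.\<close>
    moreover have "J = (LINT s:{0<..<T}|LS_measure P. \<phi> s / z_left s) - (LINT s:{0<..<T}|LS_measure Q. \<phi> s / z_left s)"
      unfolding J_def S ins(2,3) jump(1) by simp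
    ultimately show ?thesis using lim_eq Y0 by simp
  qed
qed

end

section \<open>Predictability and independence\<close>

lemma sets_predictable_sigma:
  assumes "\<And>t. 0 \<le> t \<Longrightarrow> subalgebra M (F t)"
  shows "sets (predictable_sigma M F) = sigma_sets ({0..} \<times> space M)
     ({{0} \<times> B | B. B \<in> sets (F 0)} \<union> {{s<..t} \<times> B | s t B. 0 \<le> s \<and> s < t \<and> B \<in> sets (F s)})"
proof -
  have "B \<subseteq> space M" if "B \<in> sets (F s)" "0 \<le> s" for B s
    using assms[OF that(2)] sets.sets_into_space[OF that(1)] by (auto simp: subalgebra_def)
  thus ?thesis unfolding predictable_sigma_def by (intro sets_measure_of) fastforce
qed

lemma space_predictable_sigma: "space (predictable_sigma M F) = {0..} \<times> space M"
  by (simp add: predictable_sigma_def space_measure_of_conv)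

text \<open>
  Instantiated with fixed times, with the coordinate projections and with \<open>\<tau>\<close>, this yields
  adaptedness, progressive measurability and the measurability of \<open>h\<^sub>\<tau>\<close>, respectively.
\<close>

lemma measurable_predictable:
  assumes sub: "\<And>t. 0 \<le> t \<Longrightarrow> subalgebra M (F t)"
    and T: "T \<in> borel_measurable L" "\<And>x. x \<in> space L \<Longrightarrow> 0 \<le> T x"
    and W: "\<And>x. x \<in> space L \<Longrightarrow> W x \<in> space M"
    and zero: "\<And>B. B \<in> sets (F 0) \<Longrightarrow> {x\<in>space L. T x = 0 \<and> W x \<in> B} \<in> sets L"
    and pos: "\<And>s B. 0 \<le> s \<Longrightarrow> B \<in> sets (F s) \<Longrightarrow> {x\<in>space L. s < T x \<and> W x \<in> B} \<in> sets L"
  shows "(\<lambda>x. (T x, W x)) \<in> measurable L (predictable_sigma M F)"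
proof (rule measurable_sigma_sets[OF sets_predictable_sigma[OF sub]])
  note [measurable] = T(1)
  have "B \<subseteq> space M" if "B \<in> sets (F s)" "0 \<le> s" for B s
    using sub[OF that(2)] sets.sets_into_space[OF that(1)] by (auto simp: subalgebra_def)
  thus "{{0} \<times> B | B. B \<in> sets (F 0)} \<union> {{s<..t} \<times> B | s t B. 0 \<le> s \<and> s < t \<and> B \<in> sets (F s)}
      \<subseteq> Pow ({0..} \<times> space M)" by fastforce
  show "(\<lambda>x. (T x, W x)) \<in> space L \<rightarrow> {0..} \<times> space M" using T W by auto
  fix y assume "y \<in> {{0} \<times> B | B. B \<in> sets (F 0)} \<union> {{s<..t} \<times> B | s t B. 0 \<le> s \<and> s < t \<and> B \<in> sets (F s)}"
  then consider B where "y = {0} \<times> B" "B \<in> sets (F 0)"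
    | s t B where "y = {s<..t} \<times> B" "0 \<le> s" "s < t" "B \<in> sets (F s)" by auto
  thus "(\<lambda>x. (T x, W x)) -` y \<inter> space L \<in> sets L"
  proof cases
    case 1
    have "(\<lambda>x. (T x, W x)) -` y \<inter> space L = {x\<in>space L. T x = 0 \<and> W x \<in> B}" using 1 by auto
    thus ?thesis using zero[OF 1(2)] by simp
  next
    case 2
    have "(\<lambda>x. (T x, W x)) -` y \<inter> space L = {x\<in>space L. s < T x \<and> W x \<in> B} \<inter> {x\<in>space L. T x \<le> t}"
      using 2 by auto
    also have "\<dots> \<in> sets L" by (intro sets.Int pos 2) measurable
    finally show ?thesis .
  qed
qed

text \<open>The exceptional set must not depend on \<open>t\<close>. Rational times give a single
  null set, and a nonzero difference at \<open>t\<close> would persist on a right neighbourhood,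
  which contains rationals.\<close>

lemma AE_right_continuous_eq:
  fixes f g :: "real \<Rightarrow> 'a \<Rightarrow> real"
  assumes eq: "\<And>t. 0 \<le> t \<Longrightarrow> AE \<omega> in M. f t \<omega> = g t \<omega>"
    and f: "AE \<omega> in M. \<forall>t\<ge>0. ((\<lambda>u. f u \<omega>) \<longlongrightarrow> f t \<omega>) (at_right t)"
    and g: "AE \<omega> in M. \<forall>t\<ge>0. ((\<lambda>u. g u \<omega>) \<longlongrightarrow> g t \<omega>) (at_right t)"
  shows "AE \<omega> in M. \<forall>t\<ge>0. f t \<omega> = g t \<omega>"
proof -
  have "AE \<omega> in M. \<forall>q\<in>\<rat> \<inter> {0..}. f q \<omega> = g q \<omega>"
    by (subst AE_ball_countable) (use eq countable_rat in auto)
  thus ?thesis using f g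
  proof eventually_elim
    case (elim \<omega>)
    show ?case
    proof (intro allI impI)
      fix t :: real assume t: "0 \<le> t"
      show "f t \<omega> = g t \<omega>"
      proof (rule ccontr)
        assume "f t \<omega> \<noteq> g t \<omega>"
        moreover have "((\<lambda>u. f u \<omega> - g u \<omega>) \<longlongrightarrow> f t \<omega> - g t \<omega>) (at_right t)"
          using elim(2,3) t by (intro tendsto_diff) auto
        ultimately have "\<forall>\<^sub>F u in at_right t. f u \<omega> - g u \<omega> \<noteq> 0" by (intro tendsto_imp_eventually_ne) auto
        then obtain b where b: "t < b" "\<And>u. t < u \<Longrightarrow> u < b \<Longrightarrow> f u \<omega> - g u \<omega> \<noteq> 0"
          unfolding eventually_at_right[of t "t + 1", simplified] by auto
        obtain q where "q \<in> \<rat>" "t < q" "q < b" using Rats_dense_in_real[OF b(1)] by blast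
        thus False using b(2)[of q] elim(1) t by auto
      qed
    qed
  qed
qed

lemma cadlagD: "cadlag f \<Longrightarrow> 0 \<le> t \<Longrightarrow> (f \<longlongrightarrow> f t) (at_right t)"
  by (simp add: cadlag_def continuous_within)

text \<open>The Poisson process enters here through its filtration alone; its jumps are examined
  separately at the end.\<close>

locale independent_time = prob_space +
  fixes F :: "real \<Rightarrow> 'a measure" and \<tau> :: "'a \<Rightarrow> ennreal"
  assumes sub: "\<And>t. 0 \<le> t \<Longrightarrow> subalgebra M (F t)"
    and mono_F: "\<And>s t. 0 \<le> s \<Longrightarrow> s \<le> t \<Longrightarrow> sets (F s) \<subseteq> sets (F t)"
    and null_F: "\<And>t. 0 \<le> t \<Longrightarrow> null_sets M \<subseteq> sets (F t)"
    and \<tau>_measurable [measurable]: "\<tau> \<in> borel_measurable M"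
    and indep: "indep_of_filtration M F \<tau>"
begin

lemma space_F [simp]: "0 \<le> t \<Longrightarrow> space (F t) = space M"
  using sub[of t] by (simp add: subalgebra_def)

lemma sets_F_M: "0 \<le> t \<Longrightarrow> B \<in> sets (F t) \<Longrightarrow> B \<in> sets M"
  using sub[of t] by (auto simp: subalgebra_def)

lemma sets_F_mono: "0 \<le> s \<Longrightarrow> s \<le> t \<Longrightarrow> B \<in> sets (F s) \<Longrightarrow> B \<in> sets (F t)"
  using mono_F[of s t] by auto

lemma measurable_F_M: "0 \<le> t \<Longrightarrow> f \<in> measurable (F t) N \<Longrightarrow> f \<in> measurable M N"
  using measurable_from_subalg[OF sub] .

definition F_inf where "F_inf = sigma (space M) (\<Union>t\<in>{0..}. sets (F t))"

lemma F_inf_gen: "(\<Union>t\<in>{0..}. sets (F t)) \<subseteq> Pow (space M)"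
  using sets_F_M sets.sets_into_space by fastforce

lemma space_F_inf [simp]: "space F_inf = space M" by (simp add: F_inf_def space_measure_of_conv)

lemma sets_F_inf: "sets F_inf = sigma_sets (space M) (\<Union>t\<in>{0..}. sets (F t))"
  unfolding F_inf_def using F_inf_gen by (rule sets_measure_of)

lemma sets_F_F_inf: "0 \<le> t \<Longrightarrow> B \<in> sets (F t) \<Longrightarrow> B \<in> sets F_inf"
  unfolding sets_F_inf by (intro sigma_sets.Basic) auto

lemma sets_F_inf_M: "B \<in> sets F_inf \<Longrightarrow> B \<in> sets M"
  unfolding sets_F_inf using sets.sigma_sets_subset[of "\<Union>t\<in>{0..}. sets (F t)" M] sets_F_M by auto

lemma measurable_M_F_inf: "(\<lambda>\<omega>. \<omega>) \<in> measurable M F_inf"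
  by (rule measurableI) (use sets_F_inf_M in \<open>auto simp: Int_absorb2 sets.sets_into_space\<close>)

lemma sets_predictable: "sets (predictable_sigma M F) = sigma_sets ({0..} \<times> space M)
     ({{0} \<times> B | B. B \<in> sets (F 0)} \<union> {{s<..t} \<times> B | s t B. 0 \<le> s \<and> s < t \<and> B \<in> sets (F s)})"
  by (rule sets_predictable_sigma) (rule sub)

lemma predictable_at: "0 \<le> t \<Longrightarrow> (\<lambda>\<omega>. (t, \<omega>)) \<in> measurable (F t) (predictable_sigma M F)"
proof (rule measurable_predictable[OF sub])
  fix B s assume t: "0 \<le> t"
  { assume B: "B \<in> sets (F 0)"
    hence "B \<in> sets (F t)" using sets_F_mono t by blast
    hence "{x \<in> space (F t). x \<in> B} \<in> sets (F t)" by measurable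
    thus "{x \<in> space (F t). t = 0 \<and> x \<in> B} \<in> sets (F t)" by (cases "t = 0") auto }
  { assume B: "B \<in> sets (F s)" "0 \<le> s"
    show "{x \<in> space (F t). s < t \<and> x \<in> B} \<in> sets (F t)"
    proof (cases "s < t")
      case True
      hence "B \<in> sets (F t)" using sets_F_mono[of s t] B by auto
      hence "{x \<in> space (F t). x \<in> B} \<in> sets (F t)" by measurable
      thus ?thesis using True by simp
    qed simp }
qed auto

text \<open>The predictable sets live over nonnegative times, the Borel factor over the whole line;
  clamping at 0 reconciles the two.\<close>

lemma predictable_F_inf:
  "(\<lambda>x. (max 0 (fst x), snd x)) \<in> measurable (borel \<Otimes>\<^sub>M F_inf) (predictable_sigma M F)"
proof (rule measurable_predictable[OF sub])
  let ?L = "(borel :: real measure) \<Otimes>\<^sub>M F_inf"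
  fix B s
  { assume "B \<in> sets (F 0)"
    hence [measurable]: "B \<in> sets F_inf" by (auto intro: sets_F_F_inf)
    show "{x \<in> space ?L. max 0 (fst x) = 0 \<and> snd x \<in> B} \<in> sets ?L" by measurable }
  { assume "B \<in> sets (F s)" "0 \<le> s"
    hence [measurable]: "B \<in> sets F_inf" by (auto intro: sets_F_F_inf)
    show "{x \<in> space ?L. s < max 0 (fst x) \<and> snd x \<in> B} \<in> sets ?L" by measurable }
qed (auto simp: space_pair_measure)

text \<open>Clamping time to \<open>[0,t]\<close> lets only information up to \<open>t\<close>
  enter; the measurability of \<open>elapsed t\<close> will rest on this.\<close>

lemma predictable_progressive:
  assumes t: "0 \<le> t"
  shows "(\<lambda>x. (max 0 (min (fst x) t), snd x)) \<in> measurable (borel \<Otimes>\<^sub>M F t) (predictable_sigma M F)"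
proof (rule measurable_predictable[OF sub])
  let ?L = "(borel :: real measure) \<Otimes>\<^sub>M F t"
  fix B s
  { assume "B \<in> sets (F 0)"
    hence [measurable]: "B \<in> sets (F t)" using t sets_F_mono by blast
    show "{x \<in> space ?L. max 0 (min (fst x) t) = 0 \<and> snd x \<in> B} \<in> sets ?L" by measurable }
  { assume B: "B \<in> sets (F s)" "0 \<le> s"
    show "{x \<in> space ?L. s < max 0 (min (fst x) t) \<and> snd x \<in> B} \<in> sets ?L"
    proof (cases "s < t")
      case True
      hence [measurable]: "B \<in> sets (F t)" using sets_F_mono[of s t] B by auto
      show ?thesis by measurable
    next
      case False
      hence empty: "{x \<in> space ?L. s < max 0 (min (fst x) t) \<and> snd x \<in> B} = {}" using B t by auto
      show ?thesis unfolding empty by (rule sets.empty_sets)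
    qed }
qed (use t in \<open>auto simp: space_pair_measure\<close>)

lemma predictable_Ioc:
  assumes "0 \<le> s" "s \<le> t" "B \<in> sets (F s)"
  shows "{s<..t} \<times> B \<in> sets (predictable_sigma M F)"
proof (cases "s = t")
  case False
  thus ?thesis unfolding sets_predictable using assms False
    by (intro sigma_sets.Basic UnI2 CollectI exI[of _ s] exI[of _ t] exI[of _ B]) auto
qed auto

lemma predictable_Ioi:
  assumes "0 \<le> s" "B \<in> sets (F s)"
  shows "{s<..} \<times> B \<in> sets (predictable_sigma M F)"
proof -
  have "{s<..} \<times> B = (\<Union>n::nat. {s<..s + real n} \<times> B)"
  proof (intro set_eqI iffI)
    fix x assume x: "x \<in> {s<..} \<times> B"
    obtain n :: nat where "fst x - s \<le> real n" using real_arch_simple by blast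
    thus "x \<in> (\<Union>n::nat. {s<..s + real n} \<times> B)" using x by (cases x) (auto intro!: exI[of _ n])
  qed auto
  also have "\<dots> \<in> sets (predictable_sigma M F)"
    using assms by (intro sets.countable_UN) (auto intro!: predictable_Ioc)
  finally show ?thesis .
qed

lemma predictable_zero: "B \<in> sets (F 0) \<Longrightarrow> {0} \<times> B \<in> sets (predictable_sigma M F)"
  unfolding sets_predictable by (intro sigma_sets.Basic) auto

lemma predictable_fst [measurable]: "fst \<in> borel_measurable (predictable_sigma M F)"
proof (rule borel_measurableI_le)
  fix t :: real
  have "{x \<in> space (predictable_sigma M F). fst x \<le> t} =
     (if 0 \<le> t then {0} \<times> space M \<union> {0<..t} \<times> space M else {})"
    by (auto simp: space_predictable_sigma)
  also have "\<dots> \<in> sets (predictable_sigma M F)"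
    using predictable_zero[of "space M"] predictable_Ioc[of 0 t "space M"] sets.top[of "F 0"]
    by auto
  finally show "{x \<in> space (predictable_sigma M F). fst x \<le> t} \<in> sets (predictable_sigma M F)" .
qed

definition a where "a t = measure M {\<omega>\<in>space M. \<tau> \<omega> \<le> ennreal t}"

lemma a_tendsto_right:
  fixes t :: real
  shows "(a \<longlongrightarrow> a t) (at_right t)"
  unfolding a_def
proof (rule tendsto_at_right_sequentially[of t "t + 1"])
  fix S :: "nat \<Rightarrow> real" assume S: "\<And>n. t < S n" "decseq S" "S \<longlonglongrightarrow> t"
  have "(\<lambda>n. measure M {\<omega>\<in>space M. \<tau> \<omega> \<le> ennreal (S n)}) \<longlonglongrightarrow> measure M (\<Inter>n. {\<omega>\<in>space M. \<tau> \<omega> \<le> ennreal (S n)})"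
  proof (rule finite_Lim_measure_decseq)
    show "decseq (\<lambda>n. {\<omega>\<in>space M. \<tau> \<omega> \<le> ennreal (S n)})"
      using S(2) by (auto simp: decseq_def dest: order_trans[OF _ ennreal_leI])
  qed auto
  moreover have "(\<Inter>n. {\<omega>\<in>space M. \<tau> \<omega> \<le> ennreal (S n)}) = {\<omega>\<in>space M. \<tau> \<omega> \<le> ennreal t}"
  proof (intro set_eqI iffI)
    fix \<omega> assume w: "\<omega> \<in> (\<Inter>n. {\<omega>\<in>space M. \<tau> \<omega> \<le> ennreal (S n)})"
    have "(\<lambda>n. ennreal (S n)) \<longlonglongrightarrow> ennreal t" using S(3) by (rule tendsto_ennrealI)
    hence "\<tau> \<omega> \<le> ennreal t" by (rule LIMSEQ_le_const) (use w in auto)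
    thus "\<omega> \<in> {\<omega>\<in>space M. \<tau> \<omega> \<le> ennreal t}" using w by auto
  next
    fix \<omega> assume "\<omega> \<in> {\<omega>\<in>space M. \<tau> \<omega> \<le> ennreal t}"
    thus "\<omega> \<in> (\<Inter>n. {\<omega>\<in>space M. \<tau> \<omega> \<le> ennreal (S n)})"
      using less_imp_le[OF S(1)] by (auto intro: order_trans ennreal_leI)
  qed
  ultimately show "(\<lambda>n. measure M {\<omega>\<in>space M. \<tau> \<omega> \<le> ennreal (S n)}) \<longlonglongrightarrow> measure M {\<omega>\<in>space M. \<tau> \<omega> \<le> ennreal t}"
    by simp
qed simp

sublocale sub_distribution a
proof
  show "increasing_path a"
    unfolding increasing_path_def
  proof (intro conjI allI impI)
    show "mono_on {0..} a"
      by (auto simp: a_def intro!: monotone_onI finite_measure_mono dest: order_trans[OF _ ennreal_leI])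
    show "continuous (at_right t) a" for t by (simp add: continuous_within a_tendsto_right)
  qed (auto simp: a_def)
qed (simp add: a_def)

text \<open>\<open>enn2real\<close> would put the mass of infinite \<open>\<tau>\<close> at 0, hence
  the restriction to finite \<open>\<tau>\<close>. The total mass is below 1 if
  \<open>\<tau>\<close> is infinite with positive probability.\<close>

lemma LS_measure_a:
  "LS_measure a = distr (density M (indicator {\<omega>. \<tau> \<omega> < \<top>})) borel (\<lambda>\<omega>. enn2real (\<tau> \<omega>))"
proof (rule LS_measure_unique[OF inc, symmetric])
  fix t
  let ?A = "(\<lambda>\<omega>. enn2real (\<tau> \<omega>)) -` {..t} \<inter> space M"
  have "emeasure (distr (density M (indicator {\<omega>. \<tau> \<omega> < \<top>})) borel (\<lambda>\<omega>. enn2real (\<tau> \<omega>))) {..t}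
      = emeasure (density M (indicator {\<omega>. \<tau> \<omega> < \<top>})) ?A"
    by (subst emeasure_distr) auto
  also have "\<dots> = (\<integral>\<^sup>+\<omega>. indicator {\<omega>. \<tau> \<omega> < \<top>} \<omega> * indicator ?A \<omega> \<partial>M)"
    by (rule emeasure_density) auto
  also have "\<dots> = (\<integral>\<^sup>+\<omega>. indicator {\<omega>\<in>space M. 0 \<le> t \<and> \<tau> \<omega> \<le> ennreal t} \<omega> \<partial>M)"
  proof (rule nn_integral_cong)
    fix \<omega> assume "\<omega> \<in> space M"
    thus "indicator {\<omega>. \<tau> \<omega> < \<top>} \<omega> * indicator ?A \<omega> = (indicator {\<omega>\<in>space M. 0 \<le> t \<and> \<tau> \<omega> \<le> ennreal t} \<omega> :: ennreal)"
      by (cases "\<tau> \<omega>") (auto simp: indicator_def top_unique ennreal_le_iff2)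
  qed
  also have "\<dots> = (if t < 0 then 0 else ennreal (a t))"
    by (auto simp: a_def emeasure_eq_measure)
  finally show "emeasure (distr (density M (indicator {\<omega>. \<tau> \<omega> < \<top>})) borel (\<lambda>\<omega>. enn2real (\<tau> \<omega>))) {..t}
      = (if t < 0 then 0 else ennreal (a t))" .
qed simp

lemma nn_integral_LS_measure_a:
  "f \<in> borel_measurable borel \<Longrightarrow>
    (\<integral>\<^sup>+s. f s \<partial>LS_measure a) = (\<integral>\<^sup>+\<omega>. f (enn2real (\<tau> \<omega>)) * indicator {\<omega>. \<tau> \<omega> < \<top>} \<omega> \<partial>M)"
  unfolding LS_measure_a by (subst nn_integral_distr) (auto simp: nn_integral_density mult.commute)

text \<open>Independence makes the joint law of the outcome, seen through \<open>F_inf\<close>, and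
  of \<open>\<tau>\<close> a product measure. So \<open>\<tau>\<close> can be integrated out against
  its law with the outcome kept fixed.\<close>

lemma nn_integral_independent:
  assumes [measurable]: "K \<in> borel_measurable (borel \<Otimes>\<^sub>M F_inf)"
  shows "(\<integral>\<^sup>+\<omega>. K (enn2real (\<tau> \<omega>), \<omega>) * indicator {\<omega>. \<tau> \<omega> < \<top>} \<omega> \<partial>M) =
    (\<integral>\<^sup>+\<omega>. (\<integral>\<^sup>+s. K (s, \<omega>) \<partial>LS_measure a) \<partial>M)"
proof -
  note [measurable] = measurable_M_F_inf
  have distr: "distr M F_inf (\<lambda>\<omega>. \<omega>) \<Otimes>\<^sub>M distr M borel \<tau> = distr M (F_inf \<Otimes>\<^sub>M borel) (\<lambda>\<omega>. (\<omega>, \<tau> \<omega>))"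
  proof (rule pair_measure_eqI)
    show "sigma_finite_measure (distr M F_inf (\<lambda>\<omega>. \<omega>))" "sigma_finite_measure (distr M borel \<tau>)"
      by (auto intro!: finite_measure.axioms finite_measure_distr)
    fix A B assume "A \<in> sets (distr M F_inf (\<lambda>\<omega>. \<omega>))" "B \<in> sets (distr M borel \<tau>)"
    hence AB [measurable]: "A \<in> sets F_inf" "B \<in> sets borel" by auto
    have A [measurable]: "A \<in> sets M" using sets_F_inf_M AB by auto
    have "prob (A \<inter> (\<tau> -` B \<inter> space M)) = prob A * prob (\<tau> -` B \<inter> space M)"
      by (rule indep_setD[OF indep[unfolded indep_of_filtration_def]]) (use AB sets_F_inf in auto)
    moreover have "(\<lambda>\<omega>. (\<omega>, \<tau> \<omega>)) -` (A \<times> B) \<inter> space M = A \<inter> (\<tau> -` B \<inter> space M)" by auto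
    moreover have "(\<lambda>\<omega>. \<omega>) -` A \<inter> space M = A" using sets.sets_into_space[OF A] by auto
    ultimately show "emeasure (distr M F_inf (\<lambda>\<omega>. \<omega>)) A * emeasure (distr M borel \<tau>) B =
        emeasure (distr M (F_inf \<Otimes>\<^sub>M borel) (\<lambda>\<omega>. (\<omega>, \<tau> \<omega>))) (A \<times> B)"
      by (simp add: emeasure_distr emeasure_eq_measure ennreal_mult)
  qed simp
  interpret T: prob_space "distr M borel \<tau>" by (rule prob_space_distr) simp
  define k where "k = (\<lambda>(\<omega>, t). K (enn2real t, \<omega>) * indicator {t::ennreal. t < \<top>} t)"
  have [measurable]: "k \<in> borel_measurable (F_inf \<Otimes>\<^sub>M borel)" unfolding k_def by measurable
  have "(\<integral>\<^sup>+\<omega>. K (enn2real (\<tau> \<omega>), \<omega>) * indicator {\<omega>. \<tau> \<omega> < \<top>} \<omega> \<partial>M) = (\<integral>\<^sup>+\<omega>. k (\<omega>, \<tau> \<omega>) \<partial>M)"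
    by (intro nn_integral_cong) (auto simp: k_def indicator_def)
  also have "\<dots> = (\<integral>\<^sup>+x. k x \<partial>distr M (F_inf \<Otimes>\<^sub>M borel) (\<lambda>\<omega>. (\<omega>, \<tau> \<omega>)))"
    by (rule nn_integral_distr[symmetric]) auto
  also have "\<dots> = (\<integral>\<^sup>+\<omega>. (\<integral>\<^sup>+t. k (\<omega>, t) \<partial>distr M borel \<tau>) \<partial>distr M F_inf (\<lambda>\<omega>. \<omega>))"
    unfolding distr[symmetric] by (rule T.nn_integral_fst[symmetric]) measurable
  also have "\<dots> = (\<integral>\<^sup>+\<omega>. (\<integral>\<^sup>+t. k (\<omega>, t) \<partial>distr M borel \<tau>) \<partial>M)"
    by (subst nn_integral_distr) measurable
  also have "\<dots> = (\<integral>\<^sup>+\<omega>. (\<integral>\<^sup>+s. K (s, \<omega>) \<partial>LS_measure a) \<partial>M)"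
  proof (rule nn_integral_cong)
    fix \<omega> assume w[measurable]: "\<omega> \<in> space M"
    have [measurable]: "(\<lambda>s. K (s, \<omega>)) \<in> borel_measurable borel"
      by (rule measurable_compose[OF _ assms]) (use w in measurable)
    have "(\<lambda>t. k (\<omega>, t)) \<in> borel_measurable borel" unfolding k_def by simp
    hence "(\<integral>\<^sup>+t. k (\<omega>, t) \<partial>distr M borel \<tau>) = (\<integral>\<^sup>+\<omega>'. k (\<omega>, \<tau> \<omega>') \<partial>M)"
      by (subst nn_integral_distr) auto
    also have "\<dots> = (\<integral>\<^sup>+s. K (s, \<omega>) \<partial>LS_measure a)"
      by (subst nn_integral_LS_measure_a) (auto simp: k_def indicator_def intro!: nn_integral_cong)
    finally show "(\<integral>\<^sup>+t. k (\<omega>, t) \<partial>distr M borel \<tau>) = (\<integral>\<^sup>+s. K (s, \<omega>) \<partial>LS_measure a)" .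
  qed
  finally show ?thesis .
qed

end

section \<open>The dual predictable projection is deterministic\<close>

locale dual_projection = independent_time +
  fixes Ap :: "real \<Rightarrow> 'a \<Rightarrow> real"
  assumes Ap: "dual_predictable_projection M F (jump_process \<tau>) Ap"
begin

lemma Ap_increasing: "\<omega> \<in> space M \<Longrightarrow> increasing_path (\<lambda>t. Ap t \<omega>)"
  using Ap by (simp add: dual_predictable_projection_def)

lemma Ap_predictable: "(\<lambda>(t, \<omega>). Ap t \<omega>) \<in> borel_measurable (predictable_sigma M F)"
  using Ap by (simp add: dual_predictable_projection_def predictable_process_def)

lemma Ap_measurable_F: "0 \<le> t \<Longrightarrow> Ap t \<in> borel_measurable (F t)"
  using measurable_compose[OF predictable_at Ap_predictable] by simp

lemma Ap_measurable: "0 \<le> t \<Longrightarrow> Ap t \<in> borel_measurable M"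
  using Ap_measurable_F measurable_F_M by blast

lemma predictable_measurable_pair:
  fixes K :: "real \<times> 'a \<Rightarrow> 'b::topological_space"
  assumes "K \<in> borel_measurable (predictable_sigma M F)"
  shows "(\<lambda>x. K (max 0 (fst x), snd x)) \<in> borel_measurable (borel \<Otimes>\<^sub>M F_inf)"
  by (rule measurable_compose[OF predictable_F_inf assms])

lemma measurable_F_inf_pair:
  "f \<in> measurable (borel \<Otimes>\<^sub>M F_inf) N \<Longrightarrow> f \<in> measurable (borel \<Otimes>\<^sub>M M) N"
proof -
  note [measurable] = measurable_M_F_inf
  have "(\<lambda>x. (fst x, snd x)) \<in> measurable (borel \<Otimes>\<^sub>M M) (borel \<Otimes>\<^sub>M F_inf)" by measurable
  thus "f \<in> measurable (borel \<Otimes>\<^sub>M F_inf) N \<Longrightarrow> f \<in> measurable (borel \<Otimes>\<^sub>M M) N"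
    by (auto dest: measurable_compose)
qed

text \<open>For the jump process the inner Stieltjes integral is evaluation at
  \<open>\<tau>\<close>.\<close>

lemma dual_projection_identity:
  assumes K: "K \<in> borel_measurable (predictable_sigma M F)"
  shows "(\<integral>\<^sup>+\<omega>. K (enn2real (\<tau> \<omega>), \<omega>) * indicator {\<omega>. \<tau> \<omega> < \<top>} \<omega> \<partial>M) =
    (\<integral>\<^sup>+\<omega>. (\<integral>\<^sup>+s\<in>{0..}. K (s, \<omega>) \<partial>LS_measure (\<lambda>t. Ap t \<omega>)) \<partial>M)"
proof -
  have "(\<integral>\<^sup>+s\<in>{0..}. K (s, \<omega>) \<partial>LS_measure (\<lambda>t. jump_process \<tau> t \<omega>)) =
      K (enn2real (\<tau> \<omega>), \<omega>) * indicator {\<omega>. \<tau> \<omega> < \<top>} \<omega>" if w: "\<omega> \<in> space M" for \<omega>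
  proof -
    have LS: "LS_measure (\<lambda>t. jump_process \<tau> t \<omega>) = LS_measure (\<lambda>t. of_bool (\<tau> \<omega> \<le> ennreal t))"
      by (rule LS_measure_cong) (simp add: jump_process_def)
    have "(\<lambda>s. (s, \<omega>)) \<in> measurable borel (borel \<Otimes>\<^sub>M F_inf)" using w by simp
    from measurable_compose[OF this predictable_measurable_pair[OF K]]
    have [measurable]: "(\<lambda>s. K (max 0 s, \<omega>)) \<in> borel_measurable borel" by simp
    have "(\<lambda>s. K (s, \<omega>) * indicator {0..} s) = (\<lambda>s. K (max 0 s, \<omega>) * indicator {0..} s)"
      by (auto simp: indicator_def fun_eq_iff)
    thus ?thesis unfolding LS LS_measure_jump
      by (auto simp: nn_integral_return indicator_def less_top)
  qed
  hence "(\<integral>\<^sup>+\<omega>. K (enn2real (\<tau> \<omega>), \<omega>) * indicator {\<omega>. \<tau> \<omega> < \<top>} \<omega> \<partial>M) =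
      (\<integral>\<^sup>+\<omega>. (\<integral>\<^sup>+s\<in>{0..}. K (s, \<omega>) \<partial>LS_measure (\<lambda>t. jump_process \<tau> t \<omega>)) \<partial>M)"
    by (intro nn_integral_cong) simp
  also have "\<dots> = (\<integral>\<^sup>+\<omega>. (\<integral>\<^sup>+s\<in>{0..}. K (s, \<omega>) \<partial>LS_measure (\<lambda>t. Ap t \<omega>)) \<partial>M)"
    using Ap K by (simp add: dual_predictable_projection_def)
  finally show ?thesis .
qed

text \<open>Integrands that depend on time alone show that \<open>da\<close> is the mean of the
  random measure \<open>dAp\<close>.\<close>

lemma nn_integral_emeasure_Ap:
  assumes [measurable]: "B \<in> sets borel" and sub: "B \<subseteq> {0..}"
  shows "(\<integral>\<^sup>+\<omega>. emeasure (LS_measure (\<lambda>t. Ap t \<omega>)) B \<partial>M) = emeasure (LS_measure a) B"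
proof -
  have "(\<lambda>x. indicator B (fst x)) \<in> borel_measurable (predictable_sigma M F)" by measurable
  from dual_projection_identity[OF this]
  have "(\<integral>\<^sup>+\<omega>. indicator B (enn2real (\<tau> \<omega>)) * indicator {\<omega>. \<tau> \<omega> < \<top>} \<omega> \<partial>M) =
      (\<integral>\<^sup>+\<omega>. (\<integral>\<^sup>+s\<in>{0..}. indicator B s \<partial>LS_measure (\<lambda>t. Ap t \<omega>)) \<partial>M)" by simp
  moreover have "(\<lambda>s. indicator B s * indicator {0..} s :: ennreal) = indicator B"
    using sub by (auto simp: indicator_def fun_eq_iff)
  ultimately show ?thesis using nn_integral_LS_measure_a[of "indicator B"] by simp
qed

lemma nn_integral_Ap: "0 \<le> t \<Longrightarrow> (\<integral>\<^sup>+\<omega>. ennreal (Ap t \<omega>) \<partial>M) = ennreal (a t)"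
proof -
  assume t: "0 \<le> t"
  have "(\<integral>\<^sup>+\<omega>. ennreal (Ap t \<omega>) \<partial>M) = (\<integral>\<^sup>+\<omega>. emeasure (LS_measure (\<lambda>t. Ap t \<omega>)) {0..t} \<partial>M)"
    using t by (intro nn_integral_cong) (simp add: emeasure_LS_measure_Icc Ap_increasing)
  thus ?thesis using t by (simp add: nn_integral_emeasure_Ap emeasure_LS_measure_Icc inc)
qed

text \<open>The mass of \<open>[0,s)\<close> exceeds \<open>y\<close> iff \<open>Ap\<close> already
  exceeds \<open>y\<close> at some rational time \<open>q\<close> before \<open>s\<close>; and
  \<open>{q<..} \<times> B\<close> is predictable for \<open>B\<close> in
  \<open>F q\<close>.\<close>

lemma Ap_left_predictable:
  "(\<lambda>(s, \<omega>). emeasure (LS_measure (\<lambda>t. Ap t \<omega>)) {0..<s}) \<in> borel_measurable (predictable_sigma M F)"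
proof (rule borel_measurableI_greater)
  fix y :: ennreal
  have "{x \<in> space (predictable_sigma M F). y < (case x of (s, \<omega>) \<Rightarrow> emeasure (LS_measure (\<lambda>t. Ap t \<omega>)) {0..<s})} =
      (\<Union>q\<in>\<rat> \<inter> {0..}. {q<..} \<times> {\<omega>\<in>space M. y < ennreal (Ap q \<omega>)})" (is "?L = ?R")
  proof (intro set_eqI iffI)
    fix x assume "x \<in> ?L"
    then obtain s \<omega> where x: "x = (s, \<omega>)" "0 \<le> s" "\<omega> \<in> space M"
      and y: "y < emeasure (LS_measure (\<lambda>t. Ap t \<omega>)) {0..<s}"
      by (auto simp: space_predictable_sigma)
    note inc = Ap_increasing[OF x(3)]
    have s: "0 < s" using y x(2) by (cases "s = 0") auto
    have "y < ennreal (left_lim (\<lambda>t. Ap t \<omega>) s)" using y emeasure_LS_measure_Ico[OF inc s] by simp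
    moreover have "((\<lambda>t. ennreal (Ap t \<omega>)) \<longlongrightarrow> ennreal (left_lim (\<lambda>t. Ap t \<omega>) s)) (at_left s)"
      by (intro tendsto_ennrealI increasing_path_left_limit(1)[OF inc s])
    ultimately have "\<forall>\<^sub>F t in at_left s. y < ennreal (Ap t \<omega>)" by (rule order_tendstoD(1)[rotated])
    then obtain b where b: "b < s" "\<And>t. b < t \<Longrightarrow> t < s \<Longrightarrow> y < ennreal (Ap t \<omega>)"
      unfolding eventually_at_left[OF s] by auto
    obtain q where "q \<in> \<rat>" "max 0 b < q" "q < s" using Rats_dense_in_real[of "max 0 b" s] s b by auto
    thus "x \<in> ?R" using b(2)[of q] x by auto
  next
    fix x assume "x \<in> ?R"
    then obtain q s \<omega> where x: "x = (s, \<omega>)" "0 \<le> q" "q < s" "\<omega> \<in> space M" and y: "y < ennreal (Ap q \<omega>)" by auto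
    note y
    also have "ennreal (Ap q \<omega>) = emeasure (LS_measure (\<lambda>t. Ap t \<omega>)) {0..q}"
      using x by (simp add: emeasure_LS_measure_Icc Ap_increasing)
    also have "\<dots> \<le> emeasure (LS_measure (\<lambda>t. Ap t \<omega>)) {0..<s}"
      using x by (intro emeasure_mono) auto
    finally show "x \<in> ?L" using x by (auto simp: space_predictable_sigma)
  qed
  also have "\<dots> \<in> sets (predictable_sigma M F)"
  proof (rule sets.countable_UN'')
    show "countable (\<rat> \<inter> {0::real..})" by (auto intro: countable_Int1 countable_rat)
    fix q :: real assume q: "q \<in> \<rat> \<inter> {0..}"
    hence [measurable]: "Ap q \<in> borel_measurable (F q)" by (simp add: Ap_measurable_F)
    have sp: "space (F q) = space M" using q by simp
    have "{\<omega> \<in> space (F q). y < ennreal (Ap q \<omega>)} \<in> sets (F q)" by measurable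
    hence "{\<omega> \<in> space M. y < ennreal (Ap q \<omega>)} \<in> sets (F q)" unfolding sp .
    thus "{q<..} \<times> {\<omega> \<in> space M. y < ennreal (Ap q \<omega>)} \<in> sets (predictable_sigma M F)"
      using q by (intro predictable_Ioi) auto
  qed
  finally show "{x \<in> space (predictable_sigma M F). y < (case x of (s, \<omega>) \<Rightarrow> emeasure (LS_measure (\<lambda>t. Ap t \<omega>)) {0..<s})}
      \<in> sets (predictable_sigma M F)" .
qed

text \<open>
  By partial integration \<open>Ap\<^sub>t\<^sup>2\<close> is the integral of the predictable process \<open>Ap\<^sub>- + Ap\<close> against
  \<open>dAp\<close>, so its expectation may be computed with the jump process instead and, by
  independence, with the deterministic measure \<open>da\<close>. Hence \<open>Ap\<^sub>t\<close> has vanishing variance.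
\<close>

lemma nn_integral_Ap_square:
  assumes t: "0 \<le> t"
  shows "(\<integral>\<^sup>+\<omega>. ennreal (Ap t \<omega>) * ennreal (Ap t \<omega>) \<partial>M) = ennreal (a t) * ennreal (a t)"
proof -
  define R where "R = (\<lambda>(s, \<omega>). ennreal (Ap s \<omega>))"
  define L where "L = (\<lambda>(s, \<omega>). emeasure (LS_measure (\<lambda>t. Ap t \<omega>)) {0..<s})"
  define K where "K x = (L x + R x) * indicator {0..t} (fst x)" for x
  have R: "R \<in> borel_measurable (predictable_sigma M F)"
    using measurable_compose[OF Ap_predictable measurable_ennreal] by (simp add: R_def split_beta' comp_def)
  have L: "L \<in> borel_measurable (predictable_sigma M F)" unfolding L_def by (rule Ap_left_predictable)
  have K: "K \<in> borel_measurable (predictable_sigma M F)"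
    unfolding K_def[abs_def] using R L by measurable
  \<comment> \<open>\<open>K\<close> extended by 0 to negative times, which makes it measurable on
    the product of the whole line with \<open>F_inf\<close>.\<close>
  define K' where "K' x = K (max 0 (fst x), snd x) * indicator {0..} (fst x)" for x
  have K' [measurable]: "K' \<in> borel_measurable (borel \<Otimes>\<^sub>M F_inf)"
    unfolding K'_def[abs_def] using predictable_measurable_pair[OF K] by measurable
  have K'_K: "K' (s, \<omega>) = K (s, \<omega>) * indicator {0..} s" for s \<omega> by (auto simp: K'_def indicator_def)
  have K'_M [measurable]: "K' \<in> borel_measurable (borel \<Otimes>\<^sub>M M)" using K' by (rule measurable_F_inf_pair)
  have "(\<integral>\<^sup>+\<omega>. ennreal (Ap t \<omega>) * ennreal (Ap t \<omega>) \<partial>M) =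
      (\<integral>\<^sup>+\<omega>. (\<integral>\<^sup>+s\<in>{0..}. K (s, \<omega>) \<partial>LS_measure (\<lambda>t. Ap t \<omega>)) \<partial>M)"
  proof (rule nn_integral_cong)
    fix \<omega> assume w: "\<omega> \<in> space M"
    note inc = Ap_increasing[OF w]
    let ?m = "LS_measure (\<lambda>t. Ap t \<omega>)"
    have "ennreal (Ap t \<omega>) * ennreal (Ap t \<omega>) = (\<integral>\<^sup>+s\<in>{0..t}. L (s, \<omega>) \<partial>?m) + (\<integral>\<^sup>+s\<in>{0..t}. emeasure ?m {0..s} \<partial>?m)"
      using emeasure_square_split[of ?m ?m t] t
      by (simp add: sigma_finite_LS_measure[OF inc] emeasure_LS_measure_Icc[OF inc] L_def)
    also have "(\<integral>\<^sup>+s\<in>{0..t}. emeasure ?m {0..s} \<partial>?m) = (\<integral>\<^sup>+s\<in>{0..t}. R (s, \<omega>) \<partial>?m)"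
      by (intro nn_integral_cong) (auto simp: emeasure_LS_measure_Icc[OF inc] indicator_def R_def)
    also have "(\<integral>\<^sup>+s\<in>{0..t}. L (s, \<omega>) \<partial>?m) + (\<integral>\<^sup>+s\<in>{0..t}. R (s, \<omega>) \<partial>?m) =
        (\<integral>\<^sup>+s. L (s, \<omega>) * indicator {0..t} s + R (s, \<omega>) * indicator {0..t} s \<partial>?m)"
    proof (rule nn_integral_add[symmetric])
      have sec: "(\<lambda>s. f (s, \<omega>) * indicator {0..t} s) \<in> borel_measurable ?m"
        if f: "f \<in> borel_measurable (predictable_sigma M F)" for f :: "real \<times> 'a \<Rightarrow> ennreal"
      proof -
        have "(\<lambda>s. (s, \<omega>)) \<in> measurable borel (borel \<Otimes>\<^sub>M F_inf)" using w by simp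
        from measurable_compose[OF this predictable_measurable_pair[OF f]]
        have [measurable]: "(\<lambda>s. f (max 0 s, \<omega>)) \<in> borel_measurable borel" by simp
        have "(\<lambda>s. f (s, \<omega>) * indicator {0..t} s) = (\<lambda>s. f (max 0 s, \<omega>) * indicator {0..t} s)"
          by (auto simp: indicator_def fun_eq_iff)
        thus ?thesis by simp
      qed
      show "(\<lambda>s. L (s, \<omega>) * indicator {0..t} s) \<in> borel_measurable ?m"
        "(\<lambda>s. R (s, \<omega>) * indicator {0..t} s) \<in> borel_measurable ?m"
        using L R by (auto intro: sec)
    qed
    also have "\<dots> = (\<integral>\<^sup>+s\<in>{0..}. K (s, \<omega>) \<partial>?m)"
      by (intro nn_integral_cong) (auto simp: K_def indicator_def)
    finally show "ennreal (Ap t \<omega>) * ennreal (Ap t \<omega>) = (\<integral>\<^sup>+s\<in>{0..}. K (s, \<omega>) \<partial>?m)" .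
  qed
  also have "\<dots> = (\<integral>\<^sup>+\<omega>. K' (enn2real (\<tau> \<omega>), \<omega>) * indicator {\<omega>. \<tau> \<omega> < \<top>} \<omega> \<partial>M)"
    by (subst dual_projection_identity[OF K, symmetric]) (simp add: K'_K)
  also have "\<dots> = (\<integral>\<^sup>+\<omega>. (\<integral>\<^sup>+s. K' (s, \<omega>) \<partial>LS_measure a) \<partial>M)"
    by (rule nn_integral_independent) measurable
  also have "\<dots> = (\<integral>\<^sup>+s. (\<integral>\<^sup>+\<omega>. K' (s, \<omega>) \<partial>M) \<partial>LS_measure a)"
  proof -
    interpret LSa: sigma_finite_measure "LS_measure a" by (rule sigma_finite_LS_measure[OF inc])
    interpret pair_sigma_finite "LS_measure a" M ..
    have "K' \<in> borel_measurable (LS_measure a \<Otimes>\<^sub>M M)" by measurable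
    thus ?thesis by (intro Fubini') auto
  qed
  also have "\<dots> = (\<integral>\<^sup>+s\<in>{0..t}. emeasure (LS_measure a) {0..<s} + emeasure (LS_measure a) {0..s} \<partial>LS_measure a)"
  proof (rule nn_integral_cong)
    fix s :: real
    show "(\<integral>\<^sup>+\<omega>. K' (s, \<omega>) \<partial>M) = (emeasure (LS_measure a) {0..<s} + emeasure (LS_measure a) {0..s}) * indicator {0..t} s"
    proof (cases "s \<in> {0..t}")
      case True
      hence s: "0 \<le> s" by simp
      have m: "(\<lambda>\<omega>. L (s, \<omega>)) \<in> borel_measurable M" "(\<lambda>\<omega>. R (s, \<omega>)) \<in> borel_measurable M"
        using measurable_F_M[OF s measurable_compose[OF predictable_at[OF s] L]]
          measurable_F_M[OF s measurable_compose[OF predictable_at[OF s] R]] by auto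
      have "(\<integral>\<^sup>+\<omega>. K' (s, \<omega>) \<partial>M) = (\<integral>\<^sup>+\<omega>. L (s, \<omega>) + R (s, \<omega>) \<partial>M)"
        using True by (intro nn_integral_cong) (simp add: K'_K K_def)
      also have "\<dots> = (\<integral>\<^sup>+\<omega>. L (s, \<omega>) \<partial>M) + (\<integral>\<^sup>+\<omega>. R (s, \<omega>) \<partial>M)"
        using m by (rule nn_integral_add)
      also have "(\<integral>\<^sup>+\<omega>. L (s, \<omega>) \<partial>M) = emeasure (LS_measure a) {0..<s}"
        unfolding L_def prod.case by (rule nn_integral_emeasure_Ap) auto
      also have "(\<integral>\<^sup>+\<omega>. R (s, \<omega>) \<partial>M) = emeasure (LS_measure a) {0..s}"
        using s by (simp add: R_def nn_integral_Ap emeasure_LS_measure_Icc inc)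
      finally show ?thesis using True by simp
    qed (auto simp: K'_K K_def indicator_def)
  qed
  also have "\<dots> = (\<integral>\<^sup>+s. emeasure (LS_measure a) {0..<s} * indicator {0..t} s + emeasure (LS_measure a) {0..s} * indicator {0..t} s \<partial>LS_measure a)"
    by (intro nn_integral_cong) (auto simp: indicator_def)
  also have "\<dots> = (\<integral>\<^sup>+s\<in>{0..t}. emeasure (LS_measure a) {0..<s} \<partial>LS_measure a) + (\<integral>\<^sup>+s\<in>{0..t}. emeasure (LS_measure a) {0..s} \<partial>LS_measure a)"
  proof (rule nn_integral_add)
    have "(\<lambda>s. if s < 0 then 0 else a s) \<in> borel_measurable borel"
      by (rule borel_measurable_mono) (use increasing_path_extension(1)[OF inc] in \<open>auto simp: mono_def\<close>)
    moreover have "emeasure (LS_measure a) {0..s} = ennreal (if s < 0 then 0 else a s)" for s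
      by (simp add: emeasure_LS_measure_Icc inc)
    moreover have "emeasure (LS_measure a) {0..<s} = ennreal (1 - z_left s)" for s
      using emeasure_LS_measure_finite[OF inc, of "{0..<s}" s] unfolding z_left_def
      by (subst emeasure_eq_ennreal_measure) (auto simp: subset_eq)
    ultimately have [measurable]: "(\<lambda>s. emeasure (LS_measure a) {0..<s}) \<in> borel_measurable borel"
      "(\<lambda>s. emeasure (LS_measure a) {0..s}) \<in> borel_measurable borel"
      by simp_all
    show "(\<lambda>s. emeasure (LS_measure a) {0..<s} * indicator {0..t} s) \<in> borel_measurable (LS_measure a)"
      "(\<lambda>s. emeasure (LS_measure a) {0..s} * indicator {0..t} s) \<in> borel_measurable (LS_measure a)" by measurable
  qed
  also have "\<dots> = ennreal (a t) * ennreal (a t)"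
    using emeasure_square_split[of "LS_measure a" "LS_measure a" t] t
    by (simp add: sigma_finite_LS_measure[OF inc] emeasure_LS_measure_Icc[OF inc])
  finally show ?thesis .
qed

lemma AE_Ap_eq: "AE \<omega> in M. \<forall>t\<ge>0. Ap t \<omega> = a t"
proof (rule AE_right_continuous_eq)
  fix t :: real assume t: "0 \<le> t"
  note [measurable] = Ap_measurable[OF t]
  have nn: "AE \<omega> in M. 0 \<le> Ap t \<omega>" using increasing_pathD(1)[OF Ap_increasing t] by auto
  have 1: "has_bochner_integral M (Ap t) (a t)"
    using nn nn_integral_Ap[OF t] a_nonneg[OF t] by (intro has_bochner_integral_nn_integral) auto
  have 2: "has_bochner_integral M (\<lambda>\<omega>. Ap t \<omega> * Ap t \<omega>) (a t * a t)"
  proof (rule has_bochner_integral_nn_integral)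
    have "(\<integral>\<^sup>+\<omega>. ennreal (Ap t \<omega> * Ap t \<omega>) \<partial>M) = (\<integral>\<^sup>+\<omega>. ennreal (Ap t \<omega>) * ennreal (Ap t \<omega>) \<partial>M)"
      using increasing_pathD(1)[OF Ap_increasing t] by (intro nn_integral_cong) (simp add: ennreal_mult)
    thus "(\<integral>\<^sup>+\<omega>. ennreal (Ap t \<omega> * Ap t \<omega>) \<partial>M) = ennreal (a t * a t)"
      using nn_integral_Ap_square[OF t] a_nonneg[OF t] by (simp add: ennreal_mult)
  qed (use a_nonneg[OF t] in auto)
  have const: "has_bochner_integral M (\<lambda>_. c) c" for c :: real
    by (simp add: has_bochner_integral_iff prob_space)
  have "has_bochner_integral M (\<lambda>\<omega>. Ap t \<omega> * Ap t \<omega> - 2 * a t * Ap t \<omega> + a t * a t) (a t * a t - 2 * a t * a t + a t * a t)"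
    by (intro has_bochner_integral_add has_bochner_integral_diff 2 has_bochner_integral_mult_right 1 const)
  hence "has_bochner_integral M (\<lambda>\<omega>. (Ap t \<omega> - a t)^2) 0"
    by (simp add: power2_eq_square algebra_simps)
  hence "AE \<omega> in M. (Ap t \<omega> - a t)^2 = 0"
    using integral_nonneg_eq_0_iff_AE[of M "\<lambda>\<omega>. (Ap t \<omega> - a t)^2"] by (auto simp: has_bochner_integral_iff)
  thus "AE \<omega> in M. Ap t \<omega> = a t" by simp
next
  show "AE \<omega> in M. \<forall>t\<ge>0. ((\<lambda>u. Ap u \<omega>) \<longlongrightarrow> Ap t \<omega>) (at_right t)"
    using increasing_pathD(3)[OF Ap_increasing] by auto
  show "AE \<omega> in M. \<forall>t\<ge>0. (a \<longlongrightarrow> a t) (at_right t)" by (simp add: a_tendsto_right)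
qed

lemma AE_LS_measure_Ap: "AE \<omega> in M. LS_measure (\<lambda>t. Ap t \<omega>) = LS_measure a"
  using AE_Ap_eq by eventually_elim (auto intro: LS_measure_cong)

end

section \<open>Integration against the law of the random time\<close>

context independent_time
begin

lemma emeasure_LS_a_UNIV: "emeasure (LS_measure a) UNIV = emeasure M {\<omega>\<in>space M. \<tau> \<omega> < \<top>}"
proof -
  have "emeasure (LS_measure a) UNIV = (\<integral>\<^sup>+\<omega>. 1 * indicator {\<omega>. \<tau> \<omega> < \<top>} \<omega> \<partial>M)"
    using nn_integral_LS_measure_a[of "\<lambda>_. 1"] by simp
  also have "\<dots> = (\<integral>\<^sup>+\<omega>. indicator {\<omega>\<in>space M. \<tau> \<omega> < \<top>} \<omega> \<partial>M)"
    by (intro nn_integral_cong) (simp add: indicator_def)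
  finally show ?thesis by simp
qed

lemma finite_measure_LS_a: "finite_measure (LS_measure a)"
  by (rule finite_measureI) (simp add: emeasure_LS_a_UNIV)

text \<open>This number turns out to be the almost sure value of \<open>Z_inf\<close>.\<close>

definition p where "p = prob {\<omega>\<in>space M. \<tau> \<omega> = \<top>}"

lemma prob_finite: "prob {\<omega>\<in>space M. \<tau> \<omega> < \<top>} = 1 - p"
proof -
  have "{\<omega>\<in>space M. \<tau> \<omega> < \<top>} = space M - {\<omega>\<in>space M. \<tau> \<omega> = \<top>}" by (auto simp: less_top)
  thus ?thesis unfolding p_def by (simp add: prob_compl)
qed

lemma measure_LS_a_UNIV: "measure (LS_measure a) UNIV = 1 - p"
  using emeasure_LS_a_UNIV prob_finite by (simp add: Sigma_Algebra.measure_def)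

lemma z_eq: "z t = prob {\<omega>\<in>space M. ennreal t < \<tau> \<omega>}"
proof -
  have "{\<omega>\<in>space M. ennreal t < \<tau> \<omega>} = space M - {\<omega>\<in>space M. \<tau> \<omega> \<le> ennreal t}" by auto
  thus ?thesis unfolding z_def a_def by (simp add: prob_compl)
qed

lemma p_nonneg: "0 \<le> p" and p_le_z: "p \<le> z t"
  unfolding z_eq p_def by (auto intro!: finite_measure_mono)

lemma z_tendsto_p: "(\<lambda>n. z (real n)) \<longlonglongrightarrow> p"
proof -
  have "(\<lambda>n. prob {\<omega>\<in>space M. ennreal (real n) < \<tau> \<omega>}) \<longlonglongrightarrow> prob (\<Inter>n. {\<omega>\<in>space M. ennreal (real n) < \<tau> \<omega>})"
    by (rule finite_Lim_measure_decseq)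
      (auto simp: decseq_def intro: le_less_trans[OF ennreal_leI[OF of_nat_mono]] simp del: ennreal_of_nat_eq_real_of_nat)
  moreover have "(\<Inter>n. {\<omega>\<in>space M. ennreal (real n) < \<tau> \<omega>}) = {\<omega>\<in>space M. \<tau> \<omega> = \<top>}"
  proof (intro set_eqI iffI)
    fix \<omega> assume w: "\<omega> \<in> (\<Inter>n. {\<omega>\<in>space M. ennreal (real n) < \<tau> \<omega>})"
    have "\<tau> \<omega> = \<top>"
    proof (rule ccontr)
      assume "\<tau> \<omega> \<noteq> \<top>"
      then obtain r where r: "\<tau> \<omega> = ennreal r" "0 \<le> r" by (cases "\<tau> \<omega>") auto
      obtain n :: nat where "r \<le> real n" using real_arch_simple by blast
      moreover have "ennreal (real n) < \<tau> \<omega>" using w by auto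
      ultimately show False using r by (simp add: ennreal_less_iff)
    qed
    thus "\<omega> \<in> {\<omega>\<in>space M. \<tau> \<omega> = \<top>}" using w by auto
  qed auto
  ultimately show ?thesis unfolding z_eq p_def by simp
qed

text \<open>The version for signed integrands bounded by \<open>c\<close>: the nonnegative case is
  applied to \<open>g + c\<close> and to the constant \<open>c\<close>, and the difference is
  taken.\<close>

lemma integral_independent:
  fixes g :: "real \<Rightarrow> 'a \<Rightarrow> real"
  assumes g: "(\<lambda>(s, \<omega>). g s \<omega>) \<in> borel_measurable (borel \<Otimes>\<^sub>M F_inf)"
    and bound: "\<And>s \<omega>. \<omega> \<in> space M \<Longrightarrow> \<bar>g s \<omega>\<bar> \<le> c"
  shows "(\<integral>\<omega>. of_bool (\<tau> \<omega> < \<top>) * g (enn2real (\<tau> \<omega>)) \<omega> \<partial>M) = (\<integral>\<omega>. (\<integral>s. g s \<omega> \<partial>LS_measure a) \<partial>M)"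
proof -
  interpret LSa: finite_measure "LS_measure a" by (rule finite_measure_LS_a)
  note [measurable] = measurable_M_F_inf
  have nonneg: "(\<integral>\<omega>. of_bool (\<tau> \<omega> < \<top>) * f (enn2real (\<tau> \<omega>)) \<omega> \<partial>M) = (\<integral>\<omega>. (\<integral>s. f s \<omega> \<partial>LS_measure a) \<partial>M)"
    if fm [measurable]: "(\<lambda>(s, \<omega>). f s \<omega>) \<in> borel_measurable (borel \<Otimes>\<^sub>M F_inf)"
      and f: "\<And>s \<omega>. \<omega> \<in> space M \<Longrightarrow> 0 \<le> f s \<omega> \<and> f s \<omega> \<le> d" for f and d :: real
  proof -
    have [measurable]: "(\<lambda>(s, \<omega>). f s \<omega>) \<in> borel_measurable (borel \<Otimes>\<^sub>M M)"
    proof -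
      have "(\<lambda>x. (fst x, snd x)) \<in> measurable (borel \<Otimes>\<^sub>M M) (borel \<Otimes>\<^sub>M F_inf)" by measurable
      from measurable_compose[OF this fm] show ?thesis by (simp add: split_beta')
    qed
    have "(\<integral>\<omega>. of_bool (\<tau> \<omega> < \<top>) * f (enn2real (\<tau> \<omega>)) \<omega> \<partial>M) =
        enn2real (\<integral>\<^sup>+\<omega>. ennreal (of_bool (\<tau> \<omega> < \<top>) * f (enn2real (\<tau> \<omega>)) \<omega>) \<partial>M)"
      by (rule integral_eq_nn_integral) (use f in auto)
    also have "(\<integral>\<^sup>+\<omega>. ennreal (of_bool (\<tau> \<omega> < \<top>) * f (enn2real (\<tau> \<omega>)) \<omega>) \<partial>M) =
        (\<integral>\<^sup>+\<omega>. (case (enn2real (\<tau> \<omega>), \<omega>) of (s, \<omega>) \<Rightarrow> ennreal (f s \<omega>)) * indicator {\<omega>. \<tau> \<omega> < \<top>} \<omega> \<partial>M)"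
      by (intro nn_integral_cong) (auto simp: indicator_def)
    also have "\<dots> = (\<integral>\<^sup>+\<omega>. (\<integral>\<^sup>+s. (case (s, \<omega>) of (s, \<omega>) \<Rightarrow> ennreal (f s \<omega>)) \<partial>LS_measure a) \<partial>M)"
      by (rule nn_integral_independent) measurable
    also have "\<dots> = (\<integral>\<^sup>+\<omega>. ennreal (\<integral>s. f s \<omega> \<partial>LS_measure a) \<partial>M)"
    proof (rule nn_integral_cong)
      fix \<omega> assume w: "\<omega> \<in> space M"
      have "(\<lambda>s. (s, \<omega>)) \<in> measurable borel (borel \<Otimes>\<^sub>M F_inf)" using w by simp
      from measurable_compose[OF this fm] have [measurable]: "(\<lambda>s. f s \<omega>) \<in> borel_measurable borel" by simp
      have "integrable (LS_measure a) (\<lambda>s. f s \<omega>)"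
        by (rule LSa.integrable_const_bound[where B = d]) (use f[OF w] in auto)
      thus "(\<integral>\<^sup>+s. (case (s, \<omega>) of (s, \<omega>) \<Rightarrow> ennreal (f s \<omega>)) \<partial>LS_measure a) = ennreal (\<integral>s. f s \<omega> \<partial>LS_measure a)"
        using f[OF w] by (simp add: nn_integral_eq_integral)
    qed
    also have "enn2real \<dots> = (\<integral>\<omega>. (\<integral>s. f s \<omega> \<partial>LS_measure a) \<partial>M)"
    proof (rule integral_eq_nn_integral[symmetric])
      have "(\<lambda>\<omega>. \<integral>s. f s \<omega> \<partial>LS_measure a) \<in> borel_measurable M"
        by (rule LSa.borel_measurable_lebesgue_integral) measurable
      thus "(\<lambda>\<omega>. \<integral>s. f s \<omega> \<partial>LS_measure a) \<in> borel_measurable M" .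
    qed (use f in \<open>auto intro!: AE_I2 integral_nonneg_AE\<close>)
    finally show ?thesis .
  qed
  obtain \<omega>0 where "\<omega>0 \<in> space M" using not_empty by blast
  hence c: "0 \<le> c" using bound[of \<omega>0 0] by simp
  have gM: "(\<lambda>(s, \<omega>). g s \<omega>) \<in> borel_measurable (borel \<Otimes>\<^sub>M M)"
  proof -
    have "(\<lambda>x. (fst x, snd x)) \<in> measurable (borel \<Otimes>\<^sub>M M) (borel \<Otimes>\<^sub>M F_inf)" by measurable
    from measurable_compose[OF this g] show ?thesis by (simp add: split_beta')
  qed
  have i1: "integrable M (\<lambda>\<omega>. of_bool (\<tau> \<omega> < \<top>) * g (enn2real (\<tau> \<omega>)) \<omega>)"
  proof (rule integrable_const_bound[where B = c])
    have "(\<lambda>\<omega>. (enn2real (\<tau> \<omega>), \<omega>)) \<in> measurable M (borel \<Otimes>\<^sub>M M)" by measurable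
    from measurable_compose[OF this gM] have [measurable]: "(\<lambda>\<omega>. g (enn2real (\<tau> \<omega>)) \<omega>) \<in> borel_measurable M" by simp
    show "(\<lambda>\<omega>. of_bool (\<tau> \<omega> < \<top>) * g (enn2real (\<tau> \<omega>)) \<omega>) \<in> borel_measurable M" by measurable
  qed (use bound c in \<open>auto simp: abs_mult intro!: AE_I2\<close>)
  have sec: "integrable (LS_measure a) (\<lambda>s. g s \<omega>)" if w: "\<omega> \<in> space M" for \<omega>
  proof (rule LSa.integrable_const_bound[where B = c])
    have "(\<lambda>s. (s, \<omega>)) \<in> measurable borel (borel \<Otimes>\<^sub>M F_inf)" using w by simp
    from measurable_compose[OF this g] show "(\<lambda>s. g s \<omega>) \<in> borel_measurable (LS_measure a)" by simp
  qed (use bound[OF w] in auto)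
  have "\<bar>\<integral>s. g s \<omega> \<partial>LS_measure a\<bar> \<le> c * measure (LS_measure a) UNIV" if w: "\<omega> \<in> space M" for \<omega>
  proof -
    have "\<bar>\<integral>s. g s \<omega> \<partial>LS_measure a\<bar> \<le> (\<integral>s. \<bar>g s \<omega>\<bar> \<partial>LS_measure a)"
      using integral_norm_bound[of "LS_measure a" "\<lambda>s. g s \<omega>"] by simp
    also have "\<dots> \<le> (\<integral>s. c \<partial>LS_measure a)"
      using sec[OF w] bound[OF w] by (intro integral_mono) auto
    finally show ?thesis by (simp add: mult.commute)
  qed
  hence i2: "integrable M (\<lambda>\<omega>. \<integral>s. g s \<omega> \<partial>LS_measure a)"
  proof (intro integrable_const_bound[where B = "c * measure (LS_measure a) UNIV"] AE_I2)
    note [measurable] = gM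
    show "(\<lambda>\<omega>. \<integral>s. g s \<omega> \<partial>LS_measure a) \<in> borel_measurable M"
      by (rule LSa.borel_measurable_lebesgue_integral) measurable
  qed auto
  have i3: "integrable M (\<lambda>\<omega>. of_bool (\<tau> \<omega> < \<top>) * c)"
    by (rule integrable_const_bound[where B = c]) (use c in auto)
  have "(\<integral>\<omega>. of_bool (\<tau> \<omega> < \<top>) * (g (enn2real (\<tau> \<omega>)) \<omega> + c) \<partial>M) = (\<integral>\<omega>. (\<integral>s. g s \<omega> + c \<partial>LS_measure a) \<partial>M)"
  proof (rule nonneg)
    show "0 \<le> g s \<omega> + c \<and> g s \<omega> + c \<le> c + c" if "\<omega> \<in> space M" for s \<omega>
      using bound[OF that, of s] by auto
  qed (use g in \<open>simp add: split_beta'\<close>)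
  moreover have "(\<integral>\<omega>. of_bool (\<tau> \<omega> < \<top>) * c \<partial>M) = (\<integral>\<omega>. (\<integral>s. c \<partial>LS_measure a) \<partial>M)"
    using c by (intro nonneg[of _ c]) auto
  moreover have "(\<integral>\<omega>. of_bool (\<tau> \<omega> < \<top>) * (g (enn2real (\<tau> \<omega>)) \<omega> + c) \<partial>M) =
      (\<integral>\<omega>. of_bool (\<tau> \<omega> < \<top>) * g (enn2real (\<tau> \<omega>)) \<omega> \<partial>M) + (\<integral>\<omega>. of_bool (\<tau> \<omega> < \<top>) * c \<partial>M)"
    using i1 i3 by (simp add: distrib_left)
  moreover have "(\<integral>\<omega>. (\<integral>s. g s \<omega> + c \<partial>LS_measure a) \<partial>M) =
      (\<integral>\<omega>. (\<integral>s. g s \<omega> \<partial>LS_measure a) + (\<integral>s. c \<partial>LS_measure a) \<partial>M)"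
    by (rule Bochner_Integration.integral_cong) (auto simp: sec)
  moreover have "(\<integral>\<omega>. (\<integral>s. g s \<omega> \<partial>LS_measure a) + (\<integral>s. c \<partial>LS_measure a) \<partial>M) =
      (\<integral>\<omega>. (\<integral>s. g s \<omega> \<partial>LS_measure a) \<partial>M) + (\<integral>\<omega>. (\<integral>s. c \<partial>LS_measure a) \<partial>M)"
    by (rule Bochner_Integration.integral_add[OF i2]) simp
  ultimately show ?thesis by linarith
qed

end

section \<open>Measurability of integrals against the random measure dAp\<close>

context dual_projection
begin

text \<open>\<open>M\<close> is not assumed complete, so the almost sure equality of
  \<open>dAp\<close> and \<open>da\<close> does not give measurability. Instead the random measures
  are cut off at \<open>n\<close> and divided by \<open>1 + Ap n\<close>; this yields subprobability
  kernels, whose integrals are measurable, and the supremum over \<open>n\<close> removes the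
  cut-off.\<close>

lemma nn_integral_kernel_measurable:
  assumes K [measurable]: "K \<in> borel_measurable (borel \<Otimes>\<^sub>M M)"
  shows "(\<lambda>\<omega>. \<integral>\<^sup>+s. K (s, \<omega>) \<partial>LS_measure (\<lambda>t. Ap t \<omega>)) \<in> borel_measurable M"
proof -
  \<comment> \<open>The summand 1 keeps the divisor away from 0.\<close>
  define c where "c n \<omega> = ennreal (1 + Ap (real n) \<omega>)" for n \<omega>
  define \<kappa> where "\<kappa> n \<omega> = density (LS_measure (\<lambda>t. Ap t \<omega>)) (\<lambda>s. indicator {..real n} s / c n \<omega>)" for n \<omega>
  have [measurable]: "c n \<in> borel_measurable M" for n
    using Ap_measurable[of "real n"] unfolding c_def by measurable
  have c: "c n \<omega> \<noteq> 0" "c n \<omega> < \<top>" "1 \<le> c n \<omega>" if "\<omega> \<in> space M" for n \<omega>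
    using increasing_pathD(1)[OF Ap_increasing[OF that], of "real n"] by (auto simp: c_def)
  have em: "emeasure (\<kappa> n \<omega>) A = emeasure (LS_measure (\<lambda>t. Ap t \<omega>)) ({..real n} \<inter> A) / c n \<omega>"
    if "A \<in> sets borel" for n \<omega> A
  proof -
    have "emeasure (\<kappa> n \<omega>) A = (\<integral>\<^sup>+s. indicator ({..real n} \<inter> A) s / c n \<omega> \<partial>LS_measure (\<lambda>t. Ap t \<omega>))"
      using that unfolding \<kappa>_def by (subst emeasure_density) (auto intro!: nn_integral_cong simp: indicator_def)
    thus ?thesis using that by (simp add: nn_integral_divide)
  qed
  have [measurable]: "\<kappa> n \<in> measurable M (subprob_algebra borel)" for n
  proof (rule measurable_subprob_algebra_generated[where \<Omega> = UNIV and G = "range (\<lambda>t. {..t})"])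
    show "sets borel = sigma_sets UNIV (range (\<lambda>t::real. {..t}))" by (simp add: borel_eq_atMost)
    show "Int_stable (range (\<lambda>t::real. {..t}))" by (auto simp: Int_stable_def intro!: exI[of _ "min _ _"])
    have le: "emeasure (LS_measure (\<lambda>t. Ap t \<omega>)) {..real n} \<le> c n \<omega>" if "\<omega> \<in> space M" for \<omega>
      using emeasure_LS_measure_atMost[OF Ap_increasing[OF that], of "real n"] by (simp add: c_def ennreal_leI)
    show "subprob_space (\<kappa> n \<omega>)" if w: "\<omega> \<in> space M" for \<omega>
    proof (rule subprob_spaceI)
      have "emeasure (\<kappa> n \<omega>) (space (\<kappa> n \<omega>)) = emeasure (LS_measure (\<lambda>t. Ap t \<omega>)) {..real n} / c n \<omega>"
        using em[of UNIV] by (simp add: \<kappa>_def)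
      also have "\<dots> \<le> 1" using le[OF w] c[OF w, of n] by (intro divide_le_posI_ennreal) (auto simp: zero_less_iff_neq_zero)
      finally show "emeasure (\<kappa> n \<omega>) (space (\<kappa> n \<omega>)) \<le> 1" .
    qed (auto simp: \<kappa>_def)
    have meas: "(\<lambda>\<omega>. emeasure (LS_measure (\<lambda>t. Ap t \<omega>)) {..t}) \<in> borel_measurable M" for t
    proof (cases "t < 0")
      case True
      thus ?thesis
        by (subst measurable_cong[where g = "\<lambda>_. 0"]) (auto simp: emeasure_LS_measure_atMost Ap_increasing)
    next
      case False
      hence "Ap t \<in> borel_measurable M" by (auto intro: Ap_measurable)
      thus ?thesis using False
        by (subst measurable_cong[where g = "\<lambda>\<omega>. ennreal (Ap t \<omega>)"]) (auto simp: emeasure_LS_measure_atMost Ap_increasing)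
    qed
    show "(\<lambda>\<omega>. emeasure (\<kappa> n \<omega>) A) \<in> borel_measurable M" if "A \<in> range (\<lambda>t. {..t})" for A
    proof -
      obtain t where A: "A = {..t}" using \<open>A \<in> range (\<lambda>t. {..t})\<close> by auto
      have "{..real n} \<inter> {..t} = {..min (real n) t}" by auto
      thus ?thesis using meas[of "min (real n) t"] unfolding A by (subst em) auto
    qed
    show "(\<lambda>\<omega>. emeasure (\<kappa> n \<omega>) UNIV) \<in> borel_measurable M"
      using meas[of "real n"] by (subst em) auto
  qed (auto simp: \<kappa>_def)
  have K': "(\<lambda>(\<omega>, s). K (s, \<omega>)) \<in> borel_measurable (M \<Otimes>\<^sub>M borel)" by measurable
  have [measurable]: "(\<lambda>\<omega>. \<integral>\<^sup>+s. K (s, \<omega>) \<partial>\<kappa> n \<omega>) \<in> borel_measurable M" for n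
    by (rule nn_integral_measurable_subprob_algebra2[OF K']) measurable
  have "(\<integral>\<^sup>+s. K (s, \<omega>) \<partial>LS_measure (\<lambda>t. Ap t \<omega>)) = (SUP n. c n \<omega> * (\<integral>\<^sup>+s. K (s, \<omega>) \<partial>\<kappa> n \<omega>))"
    if w: "\<omega> \<in> space M" for \<omega>
  proof -
    have [measurable]: "(\<lambda>s. K (s, \<omega>)) \<in> borel_measurable borel"
      using w by (intro measurable_compose[OF _ K]) simp
    have "c n \<omega> * (\<integral>\<^sup>+s. K (s, \<omega>) \<partial>\<kappa> n \<omega>) = (\<integral>\<^sup>+s. K (s, \<omega>) * indicator {..real n} s \<partial>LS_measure (\<lambda>t. Ap t \<omega>))" for n
    proof -
      have "(\<integral>\<^sup>+s. K (s, \<omega>) \<partial>\<kappa> n \<omega>) = (\<integral>\<^sup>+s. indicator {..real n} s / c n \<omega> * K (s, \<omega>) \<partial>LS_measure (\<lambda>t. Ap t \<omega>))"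
        unfolding \<kappa>_def by (subst nn_integral_density) auto
      also have "\<dots> = (\<integral>\<^sup>+s. (K (s, \<omega>) * indicator {..real n} s) / c n \<omega> \<partial>LS_measure (\<lambda>t. Ap t \<omega>))"
        by (intro nn_integral_cong) (simp add: divide_ennreal_def mult_ac)
      also have "\<dots> = (\<integral>\<^sup>+s. K (s, \<omega>) * indicator {..real n} s \<partial>LS_measure (\<lambda>t. Ap t \<omega>)) / c n \<omega>"
        by (rule nn_integral_divide) measurable
      finally show ?thesis using c[OF w, of n]
        by (simp add: ennreal_times_divide ennreal_mult_divide_eq mult.commute[of "c n \<omega>"] less_top)
    qed
    hence "(SUP n. c n \<omega> * (\<integral>\<^sup>+s. K (s, \<omega>) \<partial>\<kappa> n \<omega>)) =
        (SUP n. \<integral>\<^sup>+s. K (s, \<omega>) * indicator {..real n} s \<partial>LS_measure (\<lambda>t. Ap t \<omega>))" by simp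
    also have "\<dots> = (\<integral>\<^sup>+s. (SUP n. K (s, \<omega>) * indicator {..real n} s) \<partial>LS_measure (\<lambda>t. Ap t \<omega>))"
      by (rule nn_integral_monotone_convergence_SUP[symmetric])
        (auto simp: incseq_def le_fun_def indicator_def)
    also have "\<dots> = (\<integral>\<^sup>+s. K (s, \<omega>) \<partial>LS_measure (\<lambda>t. Ap t \<omega>))"
    proof (rule nn_integral_cong)
      fix s :: real
      obtain n0 :: nat where n0: "s \<le> real n0" using real_arch_simple by blast
      show "(SUP n. K (s, \<omega>) * indicator {..real n} s) = K (s, \<omega>)"
        by (intro antisym SUP_least SUP_upper2[of n0]) (use n0 in \<open>auto simp: indicator_def\<close>)
    qed
    finally show ?thesis by simp
  qed
  thus ?thesis by (subst measurable_cong) auto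
qed

text \<open>The Bochner integral is 0 by default where the integrand is not integrable; that event
  is measurable through the integral of the absolute value.\<close>

lemma integral_kernel_measurable:
  fixes k :: "real \<Rightarrow> 'a \<Rightarrow> real"
  assumes k: "(\<lambda>(s, \<omega>). k s \<omega>) \<in> borel_measurable (borel \<Otimes>\<^sub>M M)"
  shows "(\<lambda>\<omega>. \<integral>s. k s \<omega> \<partial>LS_measure (\<lambda>t. Ap t \<omega>)) \<in> borel_measurable M"
proof -
  let ?N = "\<lambda>f \<omega>. \<integral>\<^sup>+s. ennreal (f (k s \<omega>)) \<partial>LS_measure (\<lambda>t. Ap t \<omega>)"
  have [measurable]: "?N f \<in> borel_measurable M" if [measurable]: "f \<in> borel_measurable borel" for f :: "real \<Rightarrow> real"
    using nn_integral_kernel_measurable[of "\<lambda>x. ennreal (f (k (fst x) (snd x)))"] k by (simp add: split_beta')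
  have [measurable]: "?N (\<lambda>x. x) \<in> borel_measurable M" "?N uminus \<in> borel_measurable M" "?N abs \<in> borel_measurable M"
    by measurable
  have "(\<integral>s. k s \<omega> \<partial>LS_measure (\<lambda>t. Ap t \<omega>)) = (if ?N abs \<omega> < \<infinity> then enn2real (?N (\<lambda>x. x) \<omega>) - enn2real (?N uminus \<omega>) else 0)"
    if w: "\<omega> \<in> space M" for \<omega>
  proof -
    have "(\<lambda>s. (s, \<omega>)) \<in> measurable borel (borel \<Otimes>\<^sub>M M)" using w by simp
    from measurable_compose[OF this k] have "(\<lambda>s. k s \<omega>) \<in> borel_measurable borel" by simp
    hence "integrable (LS_measure (\<lambda>t. Ap t \<omega>)) (\<lambda>s. k s \<omega>) \<longleftrightarrow> ?N abs \<omega> < \<infinity>"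
      by (simp add: integrable_iff_bounded)
    thus ?thesis by (auto simp: real_lebesgue_integral_def not_integrable_integral_eq)
  qed
  thus ?thesis by (subst measurable_cong) auto
qed

end

section \<open>The progressive enlargement before the random time\<close>

context independent_time
begin

text \<open>The right limit \<open>F_{t+}\<close>. It takes the place of a proof that the completed
  Poisson filtration is right-continuous.\<close>

definition F_plus :: "real \<Rightarrow> 'a set set" where
  "F_plus t = {B. \<forall>s>t. B \<in> sets (F s)}"

lemma F_plusD: "B \<in> F_plus t \<Longrightarrow> t < s \<Longrightarrow> B \<in> sets (F s)"
  by (simp add: F_plus_def)

lemma F_plus_F_inf: "0 \<le> t \<Longrightarrow> B \<in> F_plus t \<Longrightarrow> B \<in> sets F_inf"
  using F_plusD[of B t "t + 1"] sets_F_F_inf[of "t + 1" B] by simp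

text \<open>
  Before \<open>\<tau>\<close> the enlargement carries no more information than the right-continuous version of
  \<open>F\<close>: the sets whose trace on \<open>{t < \<tau>}\<close> is that of an element of \<open>F\<^sub>t\<^sub>+\<close> form one of the
  filtrations whose intersection is the progressive enlargement.
\<close>

definition trace_sets :: "real \<Rightarrow> 'a set set" where
  "trace_sets t = {A \<in> sets M. \<exists>B\<in>F_plus t. \<forall>\<omega>\<in>space M. ennreal t < \<tau> \<omega> \<longrightarrow> (\<omega> \<in> A \<longleftrightarrow> \<omega> \<in> B)}"

lemma sigma_algebra_trace_sets:
  assumes t: "0 \<le> t"
  shows "sigma_algebra (space M) (trace_sets t)"
proof (rule sigma_algebra_iff2[THEN iffD2], intro conjI ballI allI impI)
  show "trace_sets t \<subseteq> Pow (space M)" using sets.sets_into_space by (auto simp: trace_sets_def)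
  show "{} \<in> trace_sets t" by (auto simp: trace_sets_def F_plus_def intro!: bexI[of _ "{}"])
next
  fix A assume "A \<in> trace_sets t"
  then obtain B where AB: "A \<in> sets M" "B \<in> F_plus t" "\<And>\<omega>. \<omega> \<in> space M \<Longrightarrow> ennreal t < \<tau> \<omega> \<Longrightarrow> \<omega> \<in> A \<longleftrightarrow> \<omega> \<in> B"
    by (auto simp: trace_sets_def)
  have "space M - B \<in> sets (F s)" if "t < s" for s
    using sets.compl_sets[OF F_plusD[OF AB(2) that]] that t by simp
  hence "space M - B \<in> F_plus t" by (simp add: F_plus_def)
  thus "space M - A \<in> trace_sets t" using AB by (auto simp: trace_sets_def intro!: bexI[of _ "space M - B"])
next
  fix A :: "nat \<Rightarrow> 'a set" assume "range A \<subseteq> trace_sets t"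
  hence A: "\<forall>n. A n \<in> sets M \<and> (\<exists>B\<in>F_plus t. \<forall>\<omega>\<in>space M. ennreal t < \<tau> \<omega> \<longrightarrow> (\<omega> \<in> A n \<longleftrightarrow> \<omega> \<in> B))"
    by (auto simp: trace_sets_def)
  then obtain B where B: "\<And>n. B n \<in> F_plus t"
    "\<And>n \<omega>. \<omega> \<in> space M \<Longrightarrow> ennreal t < \<tau> \<omega> \<Longrightarrow> \<omega> \<in> A n \<longleftrightarrow> \<omega> \<in> B n" by metis
  have "(\<Union>n. B n) \<in> F_plus t" using B(1) by (auto simp: F_plus_def)
  thus "(\<Union>n. A n) \<in> trace_sets t"
    using A B(2) by (auto simp: trace_sets_def intro!: bexI[of _ "\<Union>n. B n"])
qed

lemma trace_sets_mono: "s \<le> t \<Longrightarrow> trace_sets s \<subseteq> trace_sets t"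
proof
  fix A assume st: "s \<le> t" and "A \<in> trace_sets s"
  then obtain B where "A \<in> sets M" "B \<in> F_plus s"
    "\<And>\<omega>. \<omega> \<in> space M \<Longrightarrow> ennreal s < \<tau> \<omega> \<Longrightarrow> \<omega> \<in> A \<longleftrightarrow> \<omega> \<in> B" by (auto simp: trace_sets_def)
  moreover from this st have "B \<in> F_plus t" by (auto simp: F_plus_def)
  moreover have "ennreal s < \<tau> \<omega>" if "ennreal t < \<tau> \<omega>" for \<omega>
    using ennreal_leI[OF st] that by (rule le_less_trans)
  ultimately show "A \<in> trace_sets t" unfolding trace_sets_def by blast
qed

text \<open>Along times \<open>s n\<close> decreasing to \<open>t\<close>, each trace of
  \<open>A\<close> comes with a witness \<open>B n\<close>. On \<open>{t < \<tau>}\<close>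
  eventually \<open>s n < \<tau>\<close>, so that from some index on all \<open>B n\<close> agree
  with \<open>A\<close> there; their limit superior is a witness at time \<open>t\<close>.\<close>

lemma trace_sets_right_continuous:
  assumes t: "0 \<le> t"
  shows "trace_sets t = (\<Inter>s\<in>{t<..}. trace_sets s)"
proof (intro antisym subsetI)
  fix A assume A: "A \<in> (\<Inter>s\<in>{t<..}. trace_sets s)"
  define s where "s n = t + 1 / real (Suc n)" for n
  have s: "t < s n" for n by (simp add: s_def)
  have s_lim: "s \<longlonglongrightarrow> t"
    using tendsto_add[OF tendsto_const[of t] LIMSEQ_inverse_real_of_nat] by (simp add: s_def[abs_def] inverse_eq_divide)
  have "\<forall>n. \<exists>B\<in>F_plus (s n). \<forall>\<omega>\<in>space M. ennreal (s n) < \<tau> \<omega> \<longrightarrow> (\<omega> \<in> A \<longleftrightarrow> \<omega> \<in> B)"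
    using A s by (auto simp: trace_sets_def)
  then obtain B where B: "\<And>n. B n \<in> F_plus (s n)"
    "\<And>n \<omega>. \<omega> \<in> space M \<Longrightarrow> ennreal (s n) < \<tau> \<omega> \<Longrightarrow> \<omega> \<in> A \<longleftrightarrow> \<omega> \<in> B n" by metis
  define L where "L = (\<Inter>m. \<Union>n\<in>{m..}. B n)"
  have "L \<in> F_plus t"
    unfolding F_plus_def
  proof (intro CollectI allI impI)
    fix u assume u: "t < u"
    obtain m0 where m0: "\<And>n. m0 \<le> n \<Longrightarrow> s n < u"
      using order_tendstoD(2)[OF s_lim u] by (auto simp: eventually_sequentially)
    \<comment> \<open>A limit superior ignores finitely many terms, so only those \<open>B n\<close>
      with \<open>s n < u\<close> count, and these belong to \<open>F u\<close>.\<close>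
    have "L = (\<Inter>m\<in>{m0..}. \<Union>n\<in>{m..}. B n)"
    proof (intro antisym subsetI)
      fix x assume x: "x \<in> (\<Inter>m\<in>{m0..}. \<Union>n\<in>{m..}. B n)"
      have "x \<in> (\<Union>n\<in>{m..}. B n)" for m
        using INT_D[OF x, of "max m m0"] by auto
      thus "x \<in> L" by (simp add: L_def)
    qed (auto simp: L_def)
    also have "\<dots> \<in> sets (F u)"
    proof (intro sets.countable_INT' sets.countable_UN'')
      show "(\<lambda>m. \<Union>n\<in>{m..}. B n) ` {m0..} \<subseteq> sets (F u)"
        using F_plusD[OF B(1)] m0 by (auto intro!: sets.countable_UN'')
    qed auto
    finally show "L \<in> sets (F u)" .
  qed
  moreover have "\<omega> \<in> A \<longleftrightarrow> \<omega> \<in> L" if w: "\<omega> \<in> space M" "ennreal t < \<tau> \<omega>" for \<omega>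
  proof -
    have "(\<lambda>n. ennreal (s n)) \<longlonglongrightarrow> ennreal t" using s_lim by (rule tendsto_ennrealI)
    then obtain m where m: "\<And>n. m \<le> n \<Longrightarrow> ennreal (s n) < \<tau> \<omega>"
      using order_tendstoD(2)[OF _ w(2)] by (fastforce simp: eventually_sequentially)
    hence AB: "\<omega> \<in> A \<longleftrightarrow> \<omega> \<in> B n" if "m \<le> n" for n using B(2)[OF w(1)] that by auto
    show ?thesis
    proof
      assume "\<omega> \<in> A"
      hence "\<omega> \<in> (\<Union>n\<in>{k..}. B n)" for k using AB[of "max k m"] by (intro UN_I[of "max k m"]) auto
      thus "\<omega> \<in> L" by (simp add: L_def)
    next
      assume "\<omega> \<in> L"
      then obtain n where "m \<le> n" "\<omega> \<in> B n" unfolding L_def by auto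
      thus "\<omega> \<in> A" using AB by simp
    qed
  qed
  moreover have "A \<in> sets M" using A s[of 0] by (auto simp: trace_sets_def)
  ultimately show "A \<in> trace_sets t" by (auto simp: trace_sets_def)
next
  fix A assume "A \<in> trace_sets t"
  thus "A \<in> (\<Inter>s\<in>{t<..}. trace_sets s)" using trace_sets_mono[of t] less_imp_le[of t] by blast
qed

text \<open>The intersection is itself a sigma-algebra, so that generating one from it adds nothing.
  The constant filtration ensures that the family is not empty.\<close>

lemma sets_progressive_enlargement:
  "sets (progressive_enlargement M F \<tau> t) =
     (\<Inter>{sets (H t) | H. usual_filtration M H \<and> (\<forall>s\<ge>0. sets (F s) \<subseteq> sets (H s)) \<and>
                      (\<forall>s\<ge>0. {\<omega> \<in> space M. \<tau> \<omega> \<le> ennreal s} \<in> sets (H s))})"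
  (is "_ = \<Inter>?S")
  and space_progressive_enlargement: "space (progressive_enlargement M F \<tau> t) = space M" if t: "0 \<le> t"
proof -
  show "space (progressive_enlargement M F \<tau> t) = space M"
    by (simp add: progressive_enlargement_def space_measure_of_conv)
  have "usual_filtration M (\<lambda>_. M)"
    by (auto simp: usual_filtration_def subalgebra_def)
  moreover have "\<forall>s\<ge>0. sets (F s) \<subseteq> sets M" using sets_F_M by auto
  ultimately have "sets M \<in> ?S" by (intro CollectI exI[of _ "\<lambda>_. M"]) auto
  hence ne: "?S \<noteq> {}" by auto
  have sa: "sigma_algebra (space M) N" if "N \<in> ?S" for N
  proof -
    from that have "\<exists>H. N = sets (H t) \<and> usual_filtration M H"
      by (elim CollectE exE conjE) (intro exI conjI; assumption)
    then obtain H where H: "N = sets (H t)" "usual_filtration M H" by (elim exE conjE)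
    have "subalgebra M (H t)" using t H(2)[unfolded usual_filtration_def, THEN conjunct1] by simp
    hence "space (H t) = space M" by (rule subalgebra_def[THEN iffD1, THEN conjunct1])
    thus ?thesis using sets.sigma_algebra_axioms[of "H t"] unfolding H(1) by (rule subst)
  qed
  have "sigma_algebra (space M) (\<Inter>?S)"
  proof (rule sigma_algebra_iff2[THEN iffD2], intro conjI ballI allI impI)
    note sa' = sigma_algebra_iff2[THEN iffD1, OF sa]
    show "\<Inter>?S \<subseteq> Pow (space M)" using ne sa' by (meson Inter_lower ex_in_conv order_trans)
    show "{} \<in> \<Inter>?S" using sa' by (intro InterI) simp
    show "space M - A \<in> \<Inter>?S" if "A \<in> \<Inter>?S" for A
      using sa' that by (intro InterI) simp
    show "(\<Union>i. A i) \<in> \<Inter>?S" if "range A \<subseteq> \<Inter>?S" for A :: "nat \<Rightarrow> 'a set"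
    proof (rule InterI)
      fix N assume N: "N \<in> ?S"
      have "range A \<subseteq> N" using that N by (meson Inter_lower order_trans)
      thus "(\<Union>i. A i) \<in> N" using sa'[OF N] by simp
    qed
  qed
  thus "sets (progressive_enlargement M F \<tau> t) = \<Inter>?S"
    unfolding progressive_enlargement_def
    by (simp add: sigma_algebra.sets_measure_of_eq sigma_algebra.sigma_sets_eq)
qed

lemma enlargement_leastI:
  assumes "0 \<le> t" "\<And>H. usual_filtration M H \<Longrightarrow> (\<And>s. 0 \<le> s \<Longrightarrow> sets (F s) \<subseteq> sets (H s)) \<Longrightarrow>
    (\<And>s. 0 \<le> s \<Longrightarrow> {\<omega> \<in> space M. \<tau> \<omega> \<le> ennreal s} \<in> sets (H s)) \<Longrightarrow> A \<in> sets (H t)"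
  shows "A \<in> sets (progressive_enlargement M F \<tau> t)"
  unfolding sets_progressive_enlargement[OF assms(1)] using assms(2) by auto

lemma F_enlargement: "0 \<le> s \<Longrightarrow> s \<le> t \<Longrightarrow> B \<in> sets (F s) \<Longrightarrow> B \<in> sets (progressive_enlargement M F \<tau> t)"
proof (rule enlargement_leastI)
  fix H assume *: "0 \<le> s" "s \<le> t" "B \<in> sets (F s)" "\<And>s. 0 \<le> s \<Longrightarrow> sets (F s) \<subseteq> sets (H s)"
  have "sets (F t) \<subseteq> sets (H t)" using * by auto
  thus "B \<in> sets (H t)" using sets_F_mono[OF *(1,2,3)] by auto
qed auto

lemma \<tau>_enlargement: "0 \<le> s \<Longrightarrow> s \<le> t \<Longrightarrow> {\<omega> \<in> space M. \<tau> \<omega> \<le> ennreal s} \<in> sets (progressive_enlargement M F \<tau> t)"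
proof (rule enlargement_leastI)
  fix H assume *: "0 \<le> s" "s \<le> t" "usual_filtration M H"
    "\<And>s. 0 \<le> s \<Longrightarrow> {\<omega> \<in> space M. \<tau> \<omega> \<le> ennreal s} \<in> sets (H s)"
  have "sets (H s) \<subseteq> sets (H t)" using *(1-3) unfolding usual_filtration_def by blast
  thus "{\<omega> \<in> space M. \<tau> \<omega> \<le> ennreal s} \<in> sets (H t)" using *(4)[OF *(1)] by auto
qed auto

lemma enlargement_trace:
  assumes t: "0 \<le> t" and A: "A \<in> sets (progressive_enlargement M F \<tau> t)"
  shows "A \<in> trace_sets t"
proof -
  define H where "H t = sigma (space M) (trace_sets t)" for t
  have H: "sets (H s) = trace_sets s" "space (H s) = space M" if "0 \<le> s" for s
    using sigma_algebra.sets_measure_of_eq[OF sigma_algebra_trace_sets[OF that]]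
    by (auto simp: H_def space_measure_of_conv)
  have traceI: "A \<in> trace_sets s" if "A \<in> sets M" "A \<in> F_plus s" for A s
    using that unfolding trace_sets_def by blast
  have F: "sets (F s) \<subseteq> sets (H s)" if s: "0 \<le> s" for s
  proof
    fix A assume A: "A \<in> sets (F s)"
    have "A \<in> F_plus s" using sets_F_mono[OF s less_imp_le A] by (simp add: F_plus_def)
    thus "A \<in> sets (H s)" using sets_F_M[OF s A] by (simp add: H s traceI)
  qed
  \<comment> \<open>These sets have empty trace on \<open>{s < \<tau>}\<close>, hence the witness
    \<open>{}\<close>.\<close>
  have \<tau>: "{\<omega> \<in> space M. \<tau> \<omega> \<le> ennreal s} \<in> sets (H s)" if "0 \<le> s" for s
    unfolding H(1)[OF that] trace_sets_def by (intro CollectI conjI bexI[of _ "{}"]) (auto simp: F_plus_def)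
  have "usual_filtration M H"
    unfolding usual_filtration_def
  proof (intro conjI allI impI)
    fix s t :: real
    show "subalgebra M (H t)" if "0 \<le> t"
      unfolding subalgebra_def H[OF that] by (auto simp: trace_sets_def)
    show "sets (H s) \<subseteq> sets (H t)" if "0 \<le> s \<and> s \<le> t"
      using trace_sets_mono[of s t] that by (simp add: H)
    show "sets (H t) = (\<Inter>s\<in>{t<..}. sets (H s))" if t: "0 \<le> t"
    proof -
      have "(\<Inter>s\<in>{t<..}. sets (H s)) = (\<Inter>s\<in>{t<..}. trace_sets s)"
        by (rule INF_cong) (use t H in auto)
      thus ?thesis using H(1)[OF t] trace_sets_right_continuous[OF t] by simp
    qed
    show "null_sets M \<subseteq> sets (H t)" if "0 \<le> t"
      using null_F[OF that] F[OF that] by auto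
  qed
  hence "A \<in> sets (H t)" using A F \<tau> unfolding sets_progressive_enlargement[OF t] by blast
  thus ?thesis using H t by simp
qed

lemma subalgebra_enlargement: "0 \<le> t \<Longrightarrow> subalgebra M (progressive_enlargement M F \<tau> t)"
  unfolding subalgebra_def
  using enlargement_trace by (auto simp: space_progressive_enlargement trace_sets_def)

end

section \<open>Survival before the random time and identification of Z\<close>

context independent_time
begin

lemma prob_Int_less_\<tau>:
  assumes "A \<in> sets F_inf"
  shows "prob (A \<inter> {\<omega>\<in>space M. ennreal t < \<tau> \<omega>}) = prob A * z t"
proof -
  have "{\<omega>\<in>space M. ennreal t < \<tau> \<omega>} = \<tau> -` {ennreal t<..} \<inter> space M" by auto
  moreover have "prob (A \<inter> (\<tau> -` {ennreal t<..} \<inter> space M)) = prob A * prob (\<tau> -` {ennreal t<..} \<inter> space M)"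
    by (rule indep_setD[OF indep[unfolded indep_of_filtration_def]]) (use assms sets_F_inf in \<open>auto intro!: exI[of _ "{ennreal t<..}"]\<close>)
  ultimately show ?thesis by (simp add: z_eq)
qed

lemma z_tendsto_right: "(z \<longlongrightarrow> z t) (at_right t)"
  unfolding z_def by (intro tendsto_intros a_tendsto_right)

text \<open>Computed through the complement: on \<open>{\<tau> \<le> t}\<close> the time is finite
  and can be integrated out against \<open>da\<close>, which leaves
  \<open>1 - a t = z t\<close>.\<close>

lemma integral_less_\<tau>:
  assumes f: "f \<in> borel_measurable F_inf" and bound: "\<And>\<omega>. \<omega> \<in> space M \<Longrightarrow> \<bar>f \<omega>\<bar> \<le> c" and t: "0 \<le> t"
  shows "(\<integral>\<omega>. of_bool (ennreal t < \<tau> \<omega>) * f \<omega> \<partial>M) = z t * (\<integral>\<omega>. f \<omega> \<partial>M)"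
proof -
  note [measurable] = f measurable_M_F_inf
  have fM [measurable]: "f \<in> borel_measurable M" using measurable_compose[OF measurable_M_F_inf f] by simp
  have int: "integrable M f" by (rule integrable_const_bound[where B = c]) (use bound in auto)
  have int': "integrable M (\<lambda>\<omega>. of_bool (\<tau> \<omega> \<le> ennreal t) * f \<omega>)"
    by (rule Bochner_Integration.integrable_bound[OF int]) auto
  have "(\<integral>\<omega>. of_bool (\<tau> \<omega> \<le> ennreal t) * f \<omega> \<partial>M) =
      (\<integral>\<omega>. of_bool (\<tau> \<omega> < \<top>) * (indicator {..t} (enn2real (\<tau> \<omega>)) * f \<omega>) \<partial>M)"
  proof (rule Bochner_Integration.integral_cong)
    fix \<omega>
    show "of_bool (\<tau> \<omega> \<le> ennreal t) * f \<omega> = of_bool (\<tau> \<omega> < \<top>) * (indicator {..t} (enn2real (\<tau> \<omega>)) * f \<omega>)"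
      using t by (cases "\<tau> \<omega>") (auto simp: top_unique)
  qed simp
  also have "\<dots> = (\<integral>\<omega>. (\<integral>s. indicator {..t} s * f \<omega> \<partial>LS_measure a) \<partial>M)"
    by (rule integral_independent[where c = c])
      (use bound in \<open>auto simp: abs_mult indicator_def intro: order_trans[OF abs_ge_zero]\<close>)
  also have "\<dots> = a t * (\<integral>\<omega>. f \<omega> \<partial>M)"
    using t emeasure_LS_measure_atMost[OF inc, of t] a_nonneg[OF t] by (simp add: Sigma_Algebra.measure_def)
  finally have 1: "(\<integral>\<omega>. of_bool (\<tau> \<omega> \<le> ennreal t) * f \<omega> \<partial>M) = a t * (\<integral>\<omega>. f \<omega> \<partial>M)" .
  have "(\<integral>\<omega>. of_bool (ennreal t < \<tau> \<omega>) * f \<omega> \<partial>M) = (\<integral>\<omega>. f \<omega> - of_bool (\<tau> \<omega> \<le> ennreal t) * f \<omega> \<partial>M)"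
    by (rule Bochner_Integration.integral_cong) (auto simp: not_le)
  also have "\<dots> = (\<integral>\<omega>. f \<omega> \<partial>M) - a t * (\<integral>\<omega>. f \<omega> \<partial>M)"
    using int int' 1 by (subst Bochner_Integration.integral_diff) auto
  finally show ?thesis by (simp add: z_def algebra_simps)
qed

lemma measure_LS_a_Ico: "measure (LS_measure a) {0..<s} = prob {\<omega>\<in>space M. \<tau> \<omega> < ennreal s}"
proof -
  have "emeasure (LS_measure a) {0..<s} = (\<integral>\<^sup>+\<omega>. indicator {0..<s} (enn2real (\<tau> \<omega>)) * indicator {\<omega>. \<tau> \<omega> < \<top>} \<omega> \<partial>M)"
    using nn_integral_LS_measure_a[of "indicator {0..<s}"] by simp
  also have "\<dots> = (\<integral>\<^sup>+\<omega>. indicator {\<omega>\<in>space M. \<tau> \<omega> < ennreal s} \<omega> \<partial>M)"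
  proof (rule nn_integral_cong)
    fix \<omega> assume "\<omega> \<in> space M"
    thus "indicator {0..<s} (enn2real (\<tau> \<omega>)) * indicator {\<omega>. \<tau> \<omega> < \<top>} \<omega> = (indicator {\<omega>\<in>space M. \<tau> \<omega> < ennreal s} \<omega> :: ennreal)"
      by (cases "\<tau> \<omega>") (auto simp: indicator_def ennreal_less_iff)
  qed
  finally show ?thesis by (simp add: Sigma_Algebra.measure_def)
qed

text \<open>\<open>z q = 0\<close> means that \<open>q < \<tau>\<close> has probability 0. Rational
  \<open>q\<close> suffice, because there is one between \<open>t\<close> and \<open>\<tau>\<close>
  and \<open>z\<close> is decreasing.\<close>

lemma AE_z_pos: "AE \<omega> in M. \<forall>t\<ge>0. ennreal t < \<tau> \<omega> \<longrightarrow> 0 < z t"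
proof -
  have "AE \<omega> in M. ennreal q < \<tau> \<omega> \<longrightarrow> 0 < z q" if q: "q \<in> \<rat> \<inter> {0..}" for q
  proof (cases "z q = 0")
      case True
      hence "AE \<omega> in M. \<not> ennreal q < \<tau> \<omega>"
        by (intro AE_I[where N = "{\<omega>\<in>space M. ennreal q < \<tau> \<omega>}"]) (auto simp: z_eq emeasure_eq_measure)
      thus ?thesis by eventually_elim simp
    next
      case False
      thus ?thesis using z_nonneg[of q] q by auto
  qed
  hence "AE \<omega> in M. \<forall>q\<in>\<rat> \<inter> {0..}. ennreal q < \<tau> \<omega> \<longrightarrow> 0 < z q"
    by (subst AE_ball_countable) (auto intro: countable_Int1 countable_rat)
  thus ?thesis
  proof eventually_elim
    case (elim \<omega>)
    show ?case
    proof (intro allI impI)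
      fix t :: real assume t: "0 \<le> t" "ennreal t < \<tau> \<omega>"
      then obtain r where r: "ennreal t < r" "r < \<tau> \<omega>" using dense by blast
      then obtain r' where r': "r = ennreal r'" "0 \<le> r'" by (cases r) auto
      have "t < r'" using r(1) t r' by (simp add: ennreal_less_iff)
      then obtain q where q: "q \<in> \<rat>" "t < q" "q < r'" using Rats_dense_in_real by blast
      have "ennreal q < \<tau> \<omega>" using q r r' t by (intro less_trans[OF _ r(2)]) (simp add: ennreal_lessI)
      hence "0 < z q" using elim q t by auto
      also have "z q \<le> z t" using q t by (intro z_antimono) auto
      finally show "0 < z t" .
    qed
  qed
qed

text \<open>\<open>z_left s = 0\<close> means that \<open>\<tau> < s\<close> almost surely. Such
  \<open>s\<close> form an upward closed and possibly uncountable set: above any but the least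
  element lies off a rational member strictly below it, and the least element, if there is one,
  costs one more null set.\<close>

lemma AE_z_left_pos: "AE \<omega> in M. \<forall>s>0. \<tau> \<omega> = ennreal s \<longrightarrow> 0 < z_left s"
proof -
  define D where "D = {s. 0 < s \<and> z_left s = 0}"
  have null: "AE \<omega> in M. \<tau> \<omega> < ennreal s" if "s \<in> D" for s
  proof -
    have "prob {\<omega>\<in>space M. \<tau> \<omega> < ennreal s} = 1"
      using that measure_LS_a_Ico[of s] by (simp add: D_def z_left_def)
    thus ?thesis by (simp add: prob_Collect_eq_1)
  qed
  have "AE \<omega> in M. \<forall>s\<in>D \<inter> \<rat>. \<tau> \<omega> < ennreal s"
    by (subst AE_ball_countable) (auto intro: null countable_Int2 countable_rat)
  moreover have "AE \<omega> in M. Inf D \<in> D \<longrightarrow> \<tau> \<omega> < ennreal (Inf D)"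
    using null by (cases "Inf D \<in> D") auto
  ultimately show ?thesis
  proof eventually_elim
    case (elim \<omega>)
    show ?case
    proof (intro allI impI)
      fix s :: real assume s: "0 < s" "\<tau> \<omega> = ennreal s"
      show "0 < z_left s"
      proof (rule ccontr)
        assume "\<not> 0 < z_left s"
        hence sD: "s \<in> D" using z_left_nonneg[OF s(1)] s by (auto simp: D_def)
        show False
        proof (cases "\<exists>s'\<in>D. s' < s")
          case True
          then obtain s' where s': "s' \<in> D" "s' < s" by blast
          then obtain q where q: "q \<in> \<rat>" "s' < q" "q < s" using Rats_dense_in_real by blast
          have "z_left q \<le> z s'" using q s' by (intro z_left_le_z) (auto simp: D_def)
          also have "z s' \<le> 0" using z_le_z_left[of s'] s' by (simp add: D_def)
          finally have "q \<in> D" using z_left_nonneg[of q] q s' by (auto simp: D_def)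
          hence "\<tau> \<omega> < ennreal q" using elim(1) q by auto
          thus False using s q s' by (auto simp: ennreal_less_iff D_def)
        next
          case False
          hence "Inf D = s" using sD by (intro cInf_eq_minimum) (auto simp: not_less)
          thus False using elim(2) sD s by auto
        qed
      qed
    qed
  qed
qed

text \<open>The constant is \<open>z u\<close> if \<open>u < \<tau>\<close>, and otherwise
  \<open>z_left\<close> at \<open>\<tau>\<close>, which lies below all earlier values of
  \<open>z\<close>. If \<open>\<tau> = 0\<close>, there is no time to be bounded.\<close>

lemma AE_survival: "AE \<omega> in M. killed_path a (\<tau> \<omega>)"
  using AE_z_pos AE_z_left_pos
proof eventually_elim
  case (elim \<omega>)
  show ?case
  proof unfold_locales
    fix u :: real assume u: "0 \<le> u"
    show "\<exists>c>0. \<forall>s. 0 \<le> s \<and> s \<le> u \<and> ennreal s < \<tau> \<omega> \<longrightarrow> c \<le> z s"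
    proof (cases "ennreal u < \<tau> \<omega>")
      case True
      thus ?thesis using elim(1) u z_antimono by (intro exI[of _ "z u"]) auto
    next
      case False
      then obtain T where T: "\<tau> \<omega> = ennreal T" "0 \<le> T" by (cases "\<tau> \<omega>") (auto simp: not_less top_unique)
      show ?thesis
      proof (cases "0 < T")
        case True
        have "z_left T \<le> z s" if "0 \<le> s" "ennreal s < \<tau> \<omega>" for s
          using that T by (intro z_left_le_z) (auto simp: ennreal_less_iff)
        thus ?thesis using elim(2) True T(1) by (intro exI[of _ "z_left T"]) auto
      next
        case False
        thus ?thesis using T by (intro exI[of _ 1]) auto
      qed
    qed
  qed
qed

lemma sigma_finite_subalgebra_F: "0 \<le> t \<Longrightarrow> sigma_finite_subalgebra M (F t)"
  by (intro finite_measure_subalgebra_is_sigma_finite)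
    (auto simp: finite_measure_subalgebra_def finite_measure_subalgebra_axioms_def finite_measure_axioms sub)

lemma AE_Z_eq:
  assumes Z: "cadlag_cond_exp M F (\<lambda>t. indicator {\<omega>. ennreal t < \<tau> \<omega>}) Z"
  shows "AE \<omega> in M. \<forall>t\<ge>0. Z t \<omega> = z t"
proof (rule AE_right_continuous_eq)
  fix t :: real assume t: "0 \<le> t"
  interpret S: sigma_finite_subalgebra M "F t" by (rule sigma_finite_subalgebra_F[OF t])
  have "AE \<omega> in M. real_cond_exp M (F t) (indicator {\<omega>. ennreal t < \<tau> \<omega>}) \<omega> = z t"
  proof (rule S.real_cond_exp_charact)
    fix A assume A: "A \<in> sets (F t)"
    hence [measurable]: "A \<in> sets M" using sets_F_M t by auto
    have "(\<integral>\<omega>\<in>A. indicator {\<omega>. ennreal t < \<tau> \<omega>} \<omega> \<partial>M) = (\<integral>\<omega>. indicator (A \<inter> {\<omega>\<in>space M. ennreal t < \<tau> \<omega>}) \<omega> \<partial>M)"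
      unfolding set_lebesgue_integral_def
      by (rule Bochner_Integration.integral_cong) (auto simp: indicator_def)
    also have "\<dots> = prob A * z t" using prob_Int_less_\<tau>[of A t] sets_F_F_inf[OF t A] by simp
    also have "\<dots> = (\<integral>\<omega>\<in>A. z t \<partial>M)" by (simp add: set_lebesgue_integral_def)
    finally show "(\<integral>\<omega>\<in>A. indicator {\<omega>. ennreal t < \<tau> \<omega>} \<omega> \<partial>M) = (\<integral>\<omega>\<in>A. z t \<partial>M)" .
  next
    show "integrable M (indicat_real {\<omega>. ennreal t < \<tau> \<omega>})"
      by (rule integrable_const_bound[where B = 1]) auto
  qed auto
  moreover have "AE \<omega> in M. Z t \<omega> = real_cond_exp M (F t) (indicator {\<omega>. ennreal t < \<tau> \<omega>}) \<omega>"
    using Z t by (auto simp: cadlag_cond_exp_def)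
  ultimately show "AE \<omega> in M. Z t \<omega> = z t" by eventually_elim simp
next
  show "AE \<omega> in M. \<forall>t\<ge>0. ((\<lambda>u. Z u \<omega>) \<longlongrightarrow> Z t \<omega>) (at_right t)"
    using Z unfolding cadlag_cond_exp_def by (auto dest: cadlagD elim!: eventually_mono)
  show "AE \<omega> in M. \<forall>t\<ge>0. (z \<longlongrightarrow> z t) (at_right t)" by (simp add: z_tendsto_right)
qed

end

section \<open>The value processes\<close>

locale terminal_payoff = dual_projection +
  fixes Z h :: "real \<Rightarrow> 'a \<Rightarrow> real" and Z_inf h_inf :: "'a \<Rightarrow> real" and C :: real
  assumes Z: "cadlag_cond_exp M F (\<lambda>t. indicator {\<omega>. ennreal t < \<tau> \<omega>}) Z"
    and Z_inf [measurable]: "Z_inf \<in> borel_measurable M"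
    and Z_lim: "AE \<omega> in M. ((\<lambda>t. Z t \<omega>) \<longlongrightarrow> Z_inf \<omega>) at_top"
    and h_predictable: "predictable_process M F h"
    and h_le: "\<And>t \<omega>. 0 \<le> t \<Longrightarrow> \<omega> \<in> space M \<Longrightarrow> \<bar>h t \<omega>\<bar> \<le> C"
    and h_inf [measurable]: "h_inf \<in> borel_measurable M"
    and h_lim: "AE \<omega> in M. ((\<lambda>t. h t \<omega>) \<longlongrightarrow> h_inf \<omega>) at_top"
begin

lemma C_nonneg: "0 \<le> C"
proof -
  obtain \<omega> where "\<omega> \<in> space M" using not_empty by blast
  thus ?thesis using h_le[of 0 \<omega>] by simp
qed

text \<open>\<open>h\<close> frozen at its initial value for negative times, so as to be jointly
  measurable over the whole line.\<close>

definition hh where "hh s \<omega> = h (max 0 s) \<omega>"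

lemma hh_le: "\<omega> \<in> space M \<Longrightarrow> \<bar>hh s \<omega>\<bar> \<le> C" by (simp add: hh_def h_le)

lemma hh_measurable_F_inf: "(\<lambda>(s, \<omega>). hh s \<omega>) \<in> borel_measurable (borel \<Otimes>\<^sub>M F_inf)"
  using predictable_measurable_pair[OF h_predictable[unfolded predictable_process_def]]
  by (simp add: hh_def split_beta')

lemma hh_measurable [measurable]: "(\<lambda>(s, \<omega>). hh s \<omega>) \<in> borel_measurable (borel \<Otimes>\<^sub>M M)"
  by (rule measurable_F_inf_pair[OF hh_measurable_F_inf])

lemma hh_path_measurable: "\<omega> \<in> space M \<Longrightarrow> (\<lambda>s. hh s \<omega>) \<in> borel_measurable borel"
  using measurable_compose[OF _ hh_measurable, of "\<lambda>s. (s, \<omega>)" borel] by simp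

lemma hh_at_measurable_F_inf: "hh s \<in> borel_measurable F_inf"
  using measurable_compose[OF _ hh_measurable_F_inf, of "\<lambda>\<omega>. (s, \<omega>)" F_inf] by simp

lemma hh_at_measurable: "hh s \<in> borel_measurable M"
  using measurable_compose[OF _ hh_measurable, of "\<lambda>\<omega>. (s, \<omega>)" M] by simp

lemma AE_h_inf_le: "AE \<omega> in M. \<bar>h_inf \<omega>\<bar> \<le> C"
  using h_lim AE_space
proof eventually_elim
  case (elim \<omega>)
  show ?case
  proof (rule tendsto_upperbound[OF tendsto_rabs[OF elim(1)]])
    show "\<forall>\<^sub>F t in at_top. \<bar>h t \<omega>\<bar> \<le> C"
      using eventually_ge_at_top[of 0] by eventually_elim (use h_le elim(2) in auto)
  qed simp
qed

lemma AE_Z: "AE \<omega> in M. \<forall>t\<ge>0. Z t \<omega> = z t"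
  by (rule AE_Z_eq[OF Z])

lemma AE_Z_inf: "AE \<omega> in M. Z_inf \<omega> = p"
  using AE_Z Z_lim
proof eventually_elim
  case (elim \<omega>)
  have "(\<lambda>n. Z (real n) \<omega>) \<longlonglongrightarrow> Z_inf \<omega>"
    using elim(2) filterlim_real_sequentially by (rule filterlim_compose)
  moreover have "Z (real n) \<omega> = z (real n)" for n using elim(1) by simp
  ultimately show ?case using z_tendsto_p LIMSEQ_unique by fastforce
qed

lemma hh_set_integrable:
  assumes "\<omega> \<in> space M" "A \<in> sets borel"
  shows "set_integrable (LS_measure a) A (\<lambda>s. hh s \<omega>)"
proof -
  interpret LSa: finite_measure "LS_measure a" by (rule finite_measure_LS_a)
  show ?thesis
  proof (rule set_integrable_bounded[where K = C])
    show "emeasure (LS_measure a) A < \<infinity>" by (simp add: LSa.emeasure_eq_measure)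
  qed (use assms hh_le[OF assms(1)] hh_path_measurable[OF assms(1)] in \<open>auto simp: set_borel_measurable_def\<close>)
qed

lemma hh_set_integral_le:
  assumes w: "\<omega> \<in> space M" and A: "A \<in> sets borel"
  shows "\<bar>LINT s:A|LS_measure a. hh s \<omega>\<bar> \<le> C"
proof -
  interpret LSa: finite_measure "LS_measure a" by (rule finite_measure_LS_a)
  have "\<bar>LINT s:A|LS_measure a. hh s \<omega>\<bar> \<le> (LINT s:UNIV|LS_measure a. \<bar>hh s \<omega>\<bar>)"
    by (rule set_integral_abs_le[OF hh_set_integrable[OF w]]) (use A in auto)
  also have "\<dots> \<le> (\<integral>s. C \<partial>LS_measure a)"
    unfolding set_lebesgue_integral_def
    using set_integrable_abs[OF hh_set_integrable[OF w, of UNIV]] hh_le[OF w]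
    by (intro integral_mono) (auto simp: set_integrable_def)
  also have "\<dots> = C * (1 - p)" by (simp add: measure_LS_a_UNIV)
  also have "\<dots> \<le> C" using C_nonneg p_nonneg by (simp add: algebra_simps)
  finally show ?thesis .
qed

lemma hh_set_integral_measurable:
  assumes [measurable]: "A \<in> sets borel"
  shows "(\<lambda>\<omega>. LINT s:A|LS_measure a. hh s \<omega>) \<in> borel_measurable M"
proof -
  interpret LSa: finite_measure "LS_measure a" by (rule finite_measure_LS_a)
  show ?thesis unfolding set_lebesgue_integral_def
    by (rule LSa.borel_measurable_lebesgue_integral) measurable
qed

definition elapsed where "elapsed t \<omega> = (LINT s:{0<..t}|LS_measure a. hh s \<omega>)"

text \<open>Measurability for \<open>F t\<close>, not merely for \<open>F_inf\<close>: replacing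
  \<open>s\<close> by \<open>min s t\<close> does not affect an integral over \<open>(0,t]\<close>,
  and progressive measurability applies.\<close>

lemma elapsed_measurable_F:
  assumes t: "0 \<le> t"
  shows "elapsed t \<in> borel_measurable (F t)"
proof -
  interpret LSa: finite_measure "LS_measure a" by (rule finite_measure_LS_a)
  let ?g = "\<lambda>(s, \<omega>). h (max 0 (min s t)) \<omega>"
  have "?g \<in> borel_measurable (borel \<Otimes>\<^sub>M F t)"
    using measurable_compose[OF predictable_progressive[OF t] h_predictable[unfolded predictable_process_def]]
    by (simp add: split_beta')
  hence "(\<lambda>(\<omega>, s). indicat_real {0<..t} s * h (max 0 (min s t)) \<omega>) \<in> borel_measurable (F t \<Otimes>\<^sub>M LS_measure a)"
    by measurable
  hence "(\<lambda>\<omega>. \<integral>s. indicat_real {0<..t} s * h (max 0 (min s t)) \<omega> \<partial>LS_measure a) \<in> borel_measurable (F t)"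
    by (rule LSa.borel_measurable_lebesgue_integral)
  also have "(\<lambda>\<omega>. \<integral>s. indicat_real {0<..t} s * h (max 0 (min s t)) \<omega> \<partial>LS_measure a) = elapsed t"
    unfolding elapsed_def set_lebesgue_integral_def
    by (intro ext Bochner_Integration.integral_cong) (auto simp: hh_def indicator_def min_def)
  finally show ?thesis .
qed

lemma elapsed_tendsto_right: "\<omega> \<in> space M \<Longrightarrow> 0 \<le> t \<Longrightarrow> ((\<lambda>u. elapsed u \<omega>) \<longlongrightarrow> elapsed t \<omega>) (at_right t)"
  unfolding elapsed_def
  by (rule set_integral_Ioc_tendsto_right[of _ "t + 1"]) (auto intro: hh_set_integrable)

text \<open>The variable conditioned upon in the definition of \<open>X\<close>, with
  \<open>Ap\<close> and \<open>Z_inf\<close> replaced by their deterministic values.\<close>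

definition payoff where "payoff t \<omega> = (LINT s:{t<..}|LS_measure a. hh s \<omega>) + h_inf \<omega> * p"

lemma payoff_measurable [measurable]: "payoff t \<in> borel_measurable M"
  using hh_set_integral_measurable[of "{t<..}"] unfolding payoff_def[abs_def] by measurable

lemma AE_payoff_le: "AE \<omega> in M. \<bar>payoff t \<omega>\<bar> \<le> 2 * C"
  using AE_h_inf_le AE_space
proof eventually_elim
  case (elim \<omega>)
  have "p \<le> 1" using p_le_z[of 0] z_le1[of 0] by simp
  hence "\<bar>h_inf \<omega> * p\<bar> \<le> C * 1"
    unfolding abs_mult using elim(1) p_nonneg by (intro mult_mono) auto
  thus ?case using hh_set_integral_le[OF elim(2), of "{t<..}"] unfolding payoff_def by simp
qed

lemma payoff_integrable: "integrable M (payoff t)"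
  by (rule integrable_const_bound[where B = "2 * C"]) (use AE_payoff_le in auto)

lemma payoff_decompose:
  assumes w: "\<omega> \<in> space M" and t: "0 \<le> t"
  shows "payoff 0 \<omega> = elapsed t \<omega> + payoff t \<omega>"
proof -
  have "(LINT s:{0<..t} \<union> {t<..}|LS_measure a. hh s \<omega>) = elapsed t \<omega> + (LINT s:{t<..}|LS_measure a. hh s \<omega>)"
    unfolding elapsed_def by (rule set_integral_Un) (auto intro: hh_set_integrable[OF w])
  moreover have "{0<..t} \<union> {t<..} = {0<..}" using t by auto
  ultimately show ?thesis by (simp add: payoff_def)
qed

lemma elapsed_integrable: "0 \<le> t \<Longrightarrow> integrable M (elapsed t)"
  by (rule integrable_const_bound[where B = C])
    (use hh_set_integral_le hh_set_integral_measurable[of "{0<..t}"] in \<open>auto simp: elapsed_def[abs_def]\<close>)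

text \<open>Conditional expectations respect almost sure equality between measurable variables;
  measurability of \<open>\<xi>\<close> is where the kernel lemma is used.\<close>

lemma given_payoff:
  assumes t: "0 \<le> t"
  defines "\<xi> \<equiv> \<lambda>\<omega>. (LINT s:{t<..}|LS_measure (\<lambda>u. Ap u \<omega>). h s \<omega>) + h_inf \<omega> * Z_inf \<omega>"
  shows "\<xi> \<in> borel_measurable M" "AE \<omega> in M. \<xi> \<omega> = payoff t \<omega>"
proof -
  have eq: "(LINT s:{t<..}|m. h s \<omega>) = (LINT s:{t<..}|m. hh s \<omega>)" for m \<omega>
    unfolding set_lebesgue_integral_def
    by (rule Bochner_Integration.integral_cong) (use t in \<open>auto simp: hh_def indicator_def\<close>)
  have "(\<lambda>\<omega>. LINT s:{t<..}|LS_measure (\<lambda>u. Ap u \<omega>). hh s \<omega>) \<in> borel_measurable M"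
    unfolding set_lebesgue_integral_def by (rule integral_kernel_measurable) measurable
  thus "\<xi> \<in> borel_measurable M" unfolding \<xi>_def eq by measurable
  show "AE \<omega> in M. \<xi> \<omega> = payoff t \<omega>"
    using AE_LS_measure_Ap AE_Z_inf by eventually_elim (simp add: \<xi>_def eq payoff_def)
qed

lemma AE_cond_exp_payoff:
  assumes "0 \<le> t" "0 \<le> s"
  defines "\<xi> \<equiv> \<lambda>\<omega>. (LINT s:{s<..}|LS_measure (\<lambda>u. Ap u \<omega>). h s \<omega>) + h_inf \<omega> * Z_inf \<omega>"
  shows "AE \<omega> in M. real_cond_exp M (F t) \<xi> \<omega> = real_cond_exp M (F t) (payoff s) \<omega>"
proof -
  interpret S: sigma_finite_subalgebra M "F t" by (rule sigma_finite_subalgebra_F[OF assms(1)])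
  show ?thesis
    using given_payoff[OF assms(2)] unfolding \<xi>_def by (intro S.real_cond_exp_cong) auto
qed

end

locale value_processes = terminal_payoff +
  fixes X \<mu> :: "real \<Rightarrow> 'a \<Rightarrow> real"
  assumes X: "cadlag_cond_exp M F
      (\<lambda>t \<omega>. (LINT s:{t<..}|LS_measure (\<lambda>u. Ap u \<omega>). h s \<omega>) + h_inf \<omega> * Z_inf \<omega>) X"
    and \<mu>: "cadlag_cond_exp M F
      (\<lambda>t \<omega>. (LINT s:{0<..}|LS_measure (\<lambda>u. Ap u \<omega>). h s \<omega>) + h_inf \<omega> * Z_inf \<omega>) \<mu>"
begin

lemma X_measurable_F: "0 \<le> t \<Longrightarrow> X t \<in> borel_measurable (F t)"
  using X by (simp add: cadlag_cond_exp_def)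

lemma X_measurable: "0 \<le> t \<Longrightarrow> X t \<in> borel_measurable M"
  using X_measurable_F measurable_F_M by blast

lemma AE_X: "0 \<le> t \<Longrightarrow> AE \<omega> in M. X t \<omega> = real_cond_exp M (F t) (payoff t) \<omega>"
  using X AE_cond_exp_payoff[of t t] by (auto simp: cadlag_cond_exp_def)

lemma AE_\<mu>: "0 \<le> t \<Longrightarrow> AE \<omega> in M. \<mu> t \<omega> = real_cond_exp M (F t) (payoff 0) \<omega>"
  using \<mu> AE_cond_exp_payoff[of t 0] by (auto simp: cadlag_cond_exp_def)

lemma AE_X_right: "AE \<omega> in M. \<forall>t\<ge>0. ((\<lambda>u. X u \<omega>) \<longlongrightarrow> X t \<omega>) (at_right t)"
  using X unfolding cadlag_cond_exp_def by (auto dest: cadlagD elim!: eventually_mono)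

text \<open>The payoff at time 0 is \<open>elapsed t + payoff t\<close>, and the first summand is
  known at time \<open>t\<close>. The resulting decomposition into a martingale and a path of finite
  variation holds for all times at once by right-continuity.\<close>

lemma AE_X_eq: "AE \<omega> in M. \<forall>t\<ge>0. X t \<omega> = \<mu> t \<omega> - elapsed t \<omega>"
proof (rule AE_right_continuous_eq)
  fix t :: real assume t: "0 \<le> t"
  interpret S: sigma_finite_subalgebra M "F t" by (rule sigma_finite_subalgebra_F[OF t])
  have "AE \<omega> in M. real_cond_exp M (F t) (payoff 0) \<omega> = real_cond_exp M (F t) (\<lambda>\<omega>. elapsed t \<omega> + payoff t \<omega>) \<omega>"
    using payoff_decompose t by (intro S.real_cond_exp_cong) (auto intro: borel_measurable_integrable elapsed_integrable payoff_integrable)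
  moreover have "AE \<omega> in M. real_cond_exp M (F t) (\<lambda>\<omega>. elapsed t \<omega> + payoff t \<omega>) \<omega> =
      real_cond_exp M (F t) (elapsed t) \<omega> + real_cond_exp M (F t) (payoff t) \<omega>"
    by (rule S.real_cond_exp_add[OF elapsed_integrable[OF t] payoff_integrable])
  moreover have "AE \<omega> in M. real_cond_exp M (F t) (elapsed t) \<omega> = elapsed t \<omega>"
    by (rule S.real_cond_exp_F_meas[OF elapsed_integrable[OF t] elapsed_measurable_F[OF t]])
  ultimately show "AE \<omega> in M. X t \<omega> = \<mu> t \<omega> - elapsed t \<omega>"
    using AE_X[OF t] AE_\<mu>[OF t] by eventually_elim simp
next
  have "AE \<omega> in M. \<forall>t\<ge>0. ((\<lambda>u. \<mu> u \<omega>) \<longlongrightarrow> \<mu> t \<omega>) (at_right t)"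
    using \<mu> unfolding cadlag_cond_exp_def by (auto dest: cadlagD elim!: eventually_mono)
  thus "AE \<omega> in M. \<forall>t\<ge>0. ((\<lambda>u. \<mu> u \<omega> - elapsed u \<omega>) \<longlongrightarrow> \<mu> t \<omega> - elapsed t \<omega>) (at_right t)"
    using AE_space by eventually_elim (auto intro!: tendsto_diff elapsed_tendsto_right)
qed (rule AE_X_right)

lemma AE_X_le: "0 \<le> t \<Longrightarrow> AE \<omega> in M. \<bar>X t \<omega>\<bar> \<le> 2 * C"
proof -
  assume t: "0 \<le> t"
  interpret S: sigma_finite_subalgebra M "F t" by (rule sigma_finite_subalgebra_F[OF t])
  have "AE \<omega> in M. payoff t \<omega> \<le> 2 * C" "AE \<omega> in M. payoff t \<omega> \<ge> - (2 * C)"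
    using AE_payoff_le[of t] by (auto elim!: eventually_mono)
  note le = S.real_cond_exp_le_c[OF payoff_integrable this(1)] S.real_cond_exp_ge_c[OF payoff_integrable this(2)]
  show ?thesis using AE_X[OF t] le by eventually_elim auto
qed

lemma integral_X_F:
  assumes t: "0 \<le> t" and B: "B \<in> sets (F t)"
  shows "(\<integral>\<omega>. indicator B \<omega> * X t \<omega> \<partial>M) = (\<integral>\<omega>. indicator B \<omega> * payoff t \<omega> \<partial>M)"
proof -
  interpret S: sigma_finite_subalgebra M "F t" by (rule sigma_finite_subalgebra_F[OF t])
  note [measurable] = X_measurable[OF t] sets_F_M[OF t B]
  have "(\<integral>\<omega>. indicator B \<omega> * X t \<omega> \<partial>M) = (\<integral>\<omega>. indicator B \<omega> * real_cond_exp M (F t) (payoff t) \<omega> \<partial>M)"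
    using AE_X[OF t] by (intro integral_cong_AE) auto
  thus ?thesis
    using S.real_cond_exp_intA[OF payoff_integrable B, of t] by (simp add: set_lebesgue_integral_def)
qed

text \<open>\<open>B\<close> belongs to \<open>F\<close> at every later time, where the defining
  property of \<open>X\<close> applies. Right-continuity of \<open>X\<close> and of the payoff lets
  these times decrease to \<open>t\<close> under the integral.\<close>

lemma integral_X_F_plus:
  assumes t: "0 \<le> t" and B: "B \<in> F_plus t"
  shows "(\<integral>\<omega>. indicator B \<omega> * X t \<omega> \<partial>M) = (\<integral>\<omega>. indicator B \<omega> * payoff t \<omega> \<partial>M)"
proof -
  define s where "s n = t + 1 / real (Suc n)" for n
  have s: "t < s n" "0 \<le> s n" for n using t by (simp_all add: s_def)
  have s_lim: "s \<longlonglongrightarrow> t"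
    using tendsto_add[OF tendsto_const[of t] LIMSEQ_inverse_real_of_nat] by (simp add: s_def[abs_def] inverse_eq_divide)
  hence s_right: "filterlim s (at_right t) sequentially"
    unfolding filterlim_at using s by (auto intro!: always_eventually)
  have [measurable]: "B \<in> sets M" using F_plusD[OF B s(1)] sets_F_M[OF s(2)] by blast
  note [measurable] = X_measurable[OF t] X_measurable[OF s(2)]
  have "(\<lambda>n. \<integral>\<omega>. indicator B \<omega> * X (s n) \<omega> \<partial>M) \<longlonglongrightarrow> (\<integral>\<omega>. indicator B \<omega> * X t \<omega> \<partial>M)"
  proof (rule integral_dominated_convergence[where w = "\<lambda>_. 2 * C"])
    show "AE \<omega> in M. (\<lambda>n. indicator B \<omega> * X (s n) \<omega>) \<longlonglongrightarrow> indicator B \<omega> * X t \<omega>"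
      using AE_X_right
    proof eventually_elim
      case (elim \<omega>)
      show ?case using filterlim_compose[OF elim[rule_format, OF t] s_right] by (intro tendsto_intros)
    qed
    show "AE \<omega> in M. norm (indicator B \<omega> * X (s n) \<omega>) \<le> 2 * C" for n
      using AE_X_le[OF s(2)[of n]] by eventually_elim (use C_nonneg in \<open>auto simp: indicator_def\<close>)
  qed auto
  moreover have "(\<lambda>n. \<integral>\<omega>. indicator B \<omega> * payoff (s n) \<omega> \<partial>M) \<longlonglongrightarrow> (\<integral>\<omega>. indicator B \<omega> * payoff t \<omega> \<partial>M)"
  proof (rule integral_dominated_convergence[where w = "\<lambda>_. 2 * C"])
    show "AE \<omega> in M. (\<lambda>n. indicator B \<omega> * payoff (s n) \<omega>) \<longlonglongrightarrow> indicator B \<omega> * payoff t \<omega>"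
      using AE_space
    proof eventually_elim
      case (elim \<omega>)
      have eq: "payoff u \<omega> = payoff 0 \<omega> - elapsed u \<omega>" if "0 \<le> u" for u
        using payoff_decompose[OF elim that] by simp
      have "(\<lambda>n. payoff 0 \<omega> - elapsed (s n) \<omega>) \<longlonglongrightarrow> payoff 0 \<omega> - elapsed t \<omega>"
        using filterlim_compose[OF elapsed_tendsto_right[OF elim t] s_right] by (intro tendsto_intros)
      hence "(\<lambda>n. payoff (s n) \<omega>) \<longlonglongrightarrow> payoff t \<omega>" by (simp only: eq[OF s(2)] eq[OF t])
      thus ?case by (rule tendsto_mult_left)
    qed
    show "AE \<omega> in M. norm (indicator B \<omega> * payoff (s n) \<omega>) \<le> 2 * C" for n
      using AE_payoff_le[of "s n"] by eventually_elim (use C_nonneg in \<open>auto simp: indicator_def\<close>)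
  qed auto
  moreover have "(\<integral>\<omega>. indicator B \<omega> * X (s n) \<omega> \<partial>M) = (\<integral>\<omega>. indicator B \<omega> * payoff (s n) \<omega> \<partial>M)" for n
    by (rule integral_X_F[OF s(2) F_plusD[OF B s(1)]])
  ultimately show ?thesis by (simp only:) (rule LIMSEQ_unique)
qed

text \<open>If \<open>z t = 0\<close>, then \<open>p = 0\<close> and \<open>da\<close> has no mass
  after \<open>t\<close>, so that the payoff is 0. As \<open>z\<close> remains 0 after
  \<open>t\<close>, rational times to the right of \<open>t\<close> are of the same kind, which
  yields a common null set.\<close>

lemma AE_X_vanish: "AE \<omega> in M. \<forall>t\<ge>0. z t = 0 \<longrightarrow> X t \<omega> = 0"
proof -
  have each: "AE \<omega> in M. z t = 0 \<longrightarrow> X t \<omega> = 0" if t: "0 \<le> t" for t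
  proof (cases "z t = 0")
    case True
    interpret S: sigma_finite_subalgebra M "F t" by (rule sigma_finite_subalgebra_F[OF t])
    have p: "p = 0" using p_le_z[of t] p_nonneg True by simp
    have "emeasure (LS_measure a) {t<..} = 0"
    proof -
      interpret LSa: finite_measure "LS_measure a" by (rule finite_measure_LS_a)
      have "measure (LS_measure a) {t<..} = measure (LS_measure a) UNIV - measure (LS_measure a) {..t}"
        using LSa.finite_measure_compl[of "{..t}"] by (simp add: Compl_eq_Diff_UNIV[symmetric])
      also have "\<dots> = 0" using emeasure_LS_measure_atMost[OF inc, of t] t True p a_nonneg[OF t]
        by (simp add: measure_LS_a_UNIV Sigma_Algebra.measure_def[of _ "{..t}"] z_def)
      finally show ?thesis by (simp add: LSa.emeasure_eq_measure)
    qed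
    hence "AE s in LS_measure a. s \<notin> {t<..}" by (intro AE_not_in null_setsI) auto
    hence "payoff t \<omega> = 0" for \<omega>
      unfolding payoff_def set_lebesgue_integral_def using p
      by (subst integral_eq_zero_AE) (auto elim!: eventually_mono simp: indicator_def)
    hence "payoff t = (\<lambda>_. 0)" by auto
    moreover have "AE \<omega> in M. real_cond_exp M (F t) (\<lambda>_. 0) \<omega> = 0"
      by (rule S.real_cond_exp_F_meas) auto
    ultimately have "AE \<omega> in M. real_cond_exp M (F t) (payoff t) \<omega> = 0" by simp
    thus ?thesis using AE_X[OF t] by eventually_elim simp
  qed simp
  have "\<forall>q\<in>\<rat> \<inter> {0..}. AE \<omega> in M. z q = 0 \<longrightarrow> X q \<omega> = 0" using each by blast
  hence "AE \<omega> in M. \<forall>q\<in>\<rat> \<inter> {0..}. z q = 0 \<longrightarrow> X q \<omega> = 0"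
    by (rule AE_ball_countable[THEN iffD2, rotated]) (auto intro: countable_Int1 countable_rat)
  thus ?thesis using AE_X_right
  proof eventually_elim
    case (elim \<omega>)
    show ?case
    proof (intro allI impI, rule ccontr)
      fix t :: real assume t: "0 \<le> t" "z t = 0" and ne: "X t \<omega> \<noteq> 0"
      have "\<forall>\<^sub>F u in at_right t. X u \<omega> \<noteq> 0"
        using elim(2) t ne by (intro tendsto_imp_eventually_ne) auto
      then obtain b where b: "t < b" "\<And>u. t < u \<Longrightarrow> u < b \<Longrightarrow> X u \<omega> \<noteq> 0"
        unfolding eventually_at_right[of t "t + 1", simplified] by auto
      obtain q where q: "q \<in> \<rat>" "t < q" "q < b" using Rats_dense_in_real[OF b(1)] by blast
      have "z q = 0" using z_antimono[of t q] z_nonneg[of q] t q by simp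
      thus False using elim(1) q t b(2)[of q] by auto
    qed
  qed
qed

end

section \<open>The payoff at the random time\<close>

context terminal_payoff
begin

definition h\<tau> where "h\<tau> \<omega> = value_at h h_inf \<tau> \<omega>"

lemma h_at_\<tau>_measurable [measurable]: "(\<lambda>\<omega>. hh (enn2real (\<tau> \<omega>)) \<omega>) \<in> borel_measurable M"
proof -
  have "(\<lambda>\<omega>. (enn2real (\<tau> \<omega>), \<omega>)) \<in> measurable M (borel \<Otimes>\<^sub>M M)" by measurable
  from measurable_compose[OF this hh_measurable] show ?thesis by simp
qed

lemma h\<tau>_eq: "h\<tau> \<omega> = (if \<tau> \<omega> < \<top> then hh (enn2real (\<tau> \<omega>)) \<omega> else h_inf \<omega>)"
  by (auto simp: h\<tau>_def value_at_def hh_def less_top)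

lemma h\<tau>_measurable [measurable]: "h\<tau> \<in> borel_measurable M"
  unfolding h\<tau>_eq[abs_def] by measurable

lemma AE_h\<tau>_le: "AE \<omega> in M. \<bar>h\<tau> \<omega>\<bar> \<le> C"
  using AE_h_inf_le AE_space by eventually_elim (auto simp: h\<tau>_eq hh_le)

lemma h\<tau>_integrable: "integrable M h\<tau>"
  by (rule integrable_const_bound[where B = C]) (use AE_h\<tau>_le in auto)

text \<open>\<open>h_inf\<close> is merely an almost sure limit of \<open>F_inf\<close>-measurable
  functions. Independence is therefore applied to \<open>h\<close> at integer times, and the limit
  is taken under the integrals.\<close>

lemma integral_h_inf:
  assumes B: "B \<in> sets F_inf"
  shows "(\<integral>\<omega>. of_bool (\<tau> \<omega> = \<top>) * (indicator B \<omega> * h_inf \<omega>) \<partial>M) = p * (\<integral>\<omega>. indicator B \<omega> * h_inf \<omega> \<partial>M)"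
proof -
  note [measurable] = B hh_at_measurable_F_inf hh_at_measurable
  have [measurable]: "B \<in> sets M" using B by (rule sets_F_inf_M)
  have eq: "(\<integral>\<omega>. of_bool (\<tau> \<omega> = \<top>) * (indicator B \<omega> * hh (real n) \<omega>) \<partial>M) = p * (\<integral>\<omega>. indicator B \<omega> * hh (real n) \<omega> \<partial>M)" for n
  proof -
    define f where "f \<omega> = indicator B \<omega> * hh (real n) \<omega>" for \<omega>
    have [measurable]: "f \<in> borel_measurable F_inf" "f \<in> borel_measurable M" unfolding f_def[abs_def] by measurable
    have f: "\<bar>f \<omega>\<bar> \<le> C" if "\<omega> \<in> space M" for \<omega>
      using hh_le[OF that, of "real n"] C_nonneg by (auto simp: f_def indicator_def)
    have int: "integrable M f" by (rule integrable_const_bound[where B = C]) (use f in auto)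
    have int': "integrable M (\<lambda>\<omega>. of_bool (\<tau> \<omega> < \<top>) * f \<omega>)"
      by (rule Bochner_Integration.integrable_bound[OF int]) auto
    have "(\<integral>\<omega>. of_bool (\<tau> \<omega> < \<top>) * f \<omega> \<partial>M) = (\<integral>\<omega>. (\<integral>s. f \<omega> \<partial>LS_measure a) \<partial>M)"
      by (rule integral_independent[where c = C]) (use f in auto)
    also have "\<dots> = (1 - p) * (\<integral>\<omega>. f \<omega> \<partial>M)" by (simp add: measure_LS_a_UNIV)
    finally have 1: "(\<integral>\<omega>. of_bool (\<tau> \<omega> < \<top>) * f \<omega> \<partial>M) = (1 - p) * (\<integral>\<omega>. f \<omega> \<partial>M)" .
    have "(\<integral>\<omega>. of_bool (\<tau> \<omega> = \<top>) * f \<omega> \<partial>M) = (\<integral>\<omega>. f \<omega> - of_bool (\<tau> \<omega> < \<top>) * f \<omega> \<partial>M)"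
      by (rule Bochner_Integration.integral_cong) (auto simp: less_top)
    also have "\<dots> = (\<integral>\<omega>. f \<omega> \<partial>M) - (1 - p) * (\<integral>\<omega>. f \<omega> \<partial>M)"
      using int int' 1 by (subst Bochner_Integration.integral_diff) auto
    finally show ?thesis by (simp add: f_def algebra_simps)
  qed
  have lim: "AE \<omega> in M. (\<lambda>n. hh (real n) \<omega>) \<longlonglongrightarrow> h_inf \<omega>"
    using h_lim
  proof eventually_elim
    case (elim \<omega>)
    have "(\<lambda>n. h (real n) \<omega>) \<longlonglongrightarrow> h_inf \<omega>" using elim filterlim_real_sequentially by (rule filterlim_compose)
    thus ?case by (simp add: hh_def)
  qed
  have "(\<lambda>n. \<integral>\<omega>. of_bool (\<tau> \<omega> = \<top>) * (indicator B \<omega> * hh (real n) \<omega>) \<partial>M) \<longlonglongrightarrow>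
      (\<integral>\<omega>. of_bool (\<tau> \<omega> = \<top>) * (indicator B \<omega> * h_inf \<omega>) \<partial>M)"
  proof (rule integral_dominated_convergence[where w = "\<lambda>_. C"])
    show "AE \<omega> in M. (\<lambda>n. of_bool (\<tau> \<omega> = \<top>) * (indicator B \<omega> * hh (real n) \<omega>)) \<longlonglongrightarrow> of_bool (\<tau> \<omega> = \<top>) * (indicator B \<omega> * h_inf \<omega>)"
      using lim by eventually_elim (intro tendsto_intros)
    show "AE \<omega> in M. norm (of_bool (\<tau> \<omega> = \<top>) * (indicator B \<omega> * hh (real n) \<omega>)) \<le> C" for n
      using hh_le C_nonneg by (auto intro!: AE_I2 simp: indicator_def)
  qed auto
  moreover have "(\<lambda>n. p * (\<integral>\<omega>. indicator B \<omega> * hh (real n) \<omega> \<partial>M)) \<longlonglongrightarrow> p * (\<integral>\<omega>. indicator B \<omega> * h_inf \<omega> \<partial>M)"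
  proof (rule tendsto_mult_left, rule integral_dominated_convergence[where w = "\<lambda>_. C"])
    show "AE \<omega> in M. (\<lambda>n. indicator B \<omega> * hh (real n) \<omega>) \<longlonglongrightarrow> indicator B \<omega> * h_inf \<omega>"
      using lim by eventually_elim (intro tendsto_intros)
    show "AE \<omega> in M. norm (indicator B \<omega> * hh (real n) \<omega>) \<le> C" for n
      using hh_le C_nonneg by (auto intro!: AE_I2 simp: indicator_def)
  qed auto
  ultimately show ?thesis unfolding eq by (rule LIMSEQ_unique)
qed

text \<open>This explains the shape of \<open>X\<close>: for finite \<open>\<tau>\<close> after
  \<open>t\<close>, integrating out the time gives the integral of \<open>h\<close> against
  \<open>da\<close>, and infinite \<open>\<tau>\<close> gives \<open>h_inf\<close> with the weight
  \<open>p\<close>.\<close>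

lemma integral_h\<tau>_after:
  assumes t: "0 \<le> t" and B: "B \<in> sets F_inf"
  shows "(\<integral>\<omega>. of_bool (ennreal t < \<tau> \<omega>) * (indicator B \<omega> * h\<tau> \<omega>) \<partial>M) = (\<integral>\<omega>. indicator B \<omega> * payoff t \<omega> \<partial>M)"
proof -
  note [measurable] = B hh_measurable_F_inf
  have [measurable]: "B \<in> sets M" using B by (rule sets_F_inf_M)
  define g where "g s \<omega> = indicator {t<..} s * (indicator B \<omega> * hh s \<omega>)" for s \<omega>
  have g: "(\<lambda>(s, \<omega>). g s \<omega>) \<in> borel_measurable (borel \<Otimes>\<^sub>M F_inf)" unfolding g_def by measurable
  have gM: "(\<lambda>\<omega>. of_bool (\<tau> \<omega> < \<top>) * g (enn2real (\<tau> \<omega>)) \<omega>) \<in> borel_measurable M" unfolding g_def by measurable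
  have g_le: "\<bar>g s \<omega>\<bar> \<le> C" if "\<omega> \<in> space M" for s \<omega>
    using hh_le[OF that, of s] C_nonneg by (auto simp: g_def indicator_def)
  have int1: "integrable M (\<lambda>\<omega>. of_bool (\<tau> \<omega> < \<top>) * g (enn2real (\<tau> \<omega>)) \<omega>)"
    by (rule integrable_const_bound[where B = C]) (use g_le C_nonneg gM in auto)
  have int2: "integrable M (\<lambda>\<omega>. of_bool (\<tau> \<omega> = \<top>) * (indicator B \<omega> * h_inf \<omega>))"
  proof (rule integrable_const_bound[where B = C])
    show "AE \<omega> in M. norm (of_bool (\<tau> \<omega> = \<top>) * (indicat_real B \<omega> * h_inf \<omega>)) \<le> C"
      using AE_h_inf_le by eventually_elim (use C_nonneg in \<open>auto simp: indicator_def\<close>)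
  qed measurable
  have int3: "integrable M (\<lambda>\<omega>. indicator B \<omega> * h_inf \<omega>)"
  proof (rule integrable_const_bound[where B = C])
    show "AE \<omega> in M. norm (indicat_real B \<omega> * h_inf \<omega>) \<le> C"
      using AE_h_inf_le by eventually_elim (use C_nonneg in \<open>auto simp: indicator_def\<close>)
  qed measurable
  have meas: "(\<lambda>\<omega>. indicator B \<omega> * (LINT s:{t<..}|LS_measure a. hh s \<omega>)) \<in> borel_measurable M"
    using hh_set_integral_measurable[of "{t<..}"] by measurable
  have int4: "integrable M (\<lambda>\<omega>. indicator B \<omega> * (LINT s:{t<..}|LS_measure a. hh s \<omega>))"
    by (rule integrable_const_bound[where B = C])
      (use hh_set_integral_le[of _ "{t<..}"] C_nonneg meas in \<open>auto simp: indicator_def intro!: AE_I2\<close>)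
  have "(\<integral>\<omega>. of_bool (ennreal t < \<tau> \<omega>) * (indicator B \<omega> * h\<tau> \<omega>) \<partial>M) =
      (\<integral>\<omega>. of_bool (\<tau> \<omega> < \<top>) * g (enn2real (\<tau> \<omega>)) \<omega> + of_bool (\<tau> \<omega> = \<top>) * (indicator B \<omega> * h_inf \<omega>) \<partial>M)"
  proof (rule Bochner_Integration.integral_cong)
    fix \<omega>
    show "of_bool (ennreal t < \<tau> \<omega>) * (indicator B \<omega> * h\<tau> \<omega>) =
        of_bool (\<tau> \<omega> < \<top>) * g (enn2real (\<tau> \<omega>)) \<omega> + of_bool (\<tau> \<omega> = \<top>) * (indicator B \<omega> * h_inf \<omega>)"
      using t by (cases "\<tau> \<omega>") (auto simp: h\<tau>_eq g_def ennreal_less_iff)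
  qed simp
  also have "\<dots> = (\<integral>\<omega>. of_bool (\<tau> \<omega> < \<top>) * g (enn2real (\<tau> \<omega>)) \<omega> \<partial>M) +
      (\<integral>\<omega>. of_bool (\<tau> \<omega> = \<top>) * (indicator B \<omega> * h_inf \<omega>) \<partial>M)"
    by (rule Bochner_Integration.integral_add[OF int1 int2])
  also have "(\<integral>\<omega>. of_bool (\<tau> \<omega> < \<top>) * g (enn2real (\<tau> \<omega>)) \<omega> \<partial>M) = (\<integral>\<omega>. (\<integral>s. g s \<omega> \<partial>LS_measure a) \<partial>M)"
    by (rule integral_independent[OF g g_le])
  also have "\<dots> = (\<integral>\<omega>. indicator B \<omega> * (LINT s:{t<..}|LS_measure a. hh s \<omega>) \<partial>M)"
  proof (rule Bochner_Integration.integral_cong)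
    fix \<omega>
    have "g s \<omega> = indicator B \<omega> * (indicator {t<..} s *\<^sub>R hh s \<omega>)" for s by (simp add: g_def)
    thus "(\<integral>s. g s \<omega> \<partial>LS_measure a) = indicator B \<omega> * (LINT s:{t<..}|LS_measure a. hh s \<omega>)"
      unfolding set_lebesgue_integral_def by simp
  qed simp
  also have "(\<integral>\<omega>. of_bool (\<tau> \<omega> = \<top>) * (indicator B \<omega> * h_inf \<omega>) \<partial>M) = (\<integral>\<omega>. p * (indicator B \<omega> * h_inf \<omega>) \<partial>M)"
    using integral_h_inf[OF B] by simp
  also have "(\<integral>\<omega>. indicator B \<omega> * (LINT s:{t<..}|LS_measure a. hh s \<omega>) \<partial>M) + (\<integral>\<omega>. p * (indicator B \<omega> * h_inf \<omega>) \<partial>M)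
      = (\<integral>\<omega>. indicator B \<omega> * (LINT s:{t<..}|LS_measure a. hh s \<omega>) + p * (indicator B \<omega> * h_inf \<omega>) \<partial>M)"
    by (rule Bochner_Integration.integral_add[symmetric, OF int4]) (use int3 in simp)
  also have "\<dots> = (\<integral>\<omega>. indicator B \<omega> * payoff t \<omega> \<partial>M)"
    by (rule Bochner_Integration.integral_cong) (auto simp: payoff_def algebra_simps)
  finally show ?thesis .
qed

text \<open>\<open>min \<tau> t\<close> is a stopping time of the enlargement, so that a predictable
  process evaluated there is known at time \<open>t\<close>. The minimum agrees with
  \<open>\<tau>\<close> on \<open>{\<tau> \<le> t}\<close>, the only event on which the value is
  used.\<close>

lemma h\<tau>_measurable_enlargement:
  assumes t: "0 \<le> t"
  shows "(\<lambda>\<omega>. hh (enn2real (min (\<tau> \<omega>) (ennreal t))) \<omega>) \<in> borel_measurable (progressive_enlargement M F \<tau> t)"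
    (is "_ \<in> borel_measurable ?G")
proof -
  have sp [simp]: "space ?G = space M" by (rule space_progressive_enlargement[OF t])
  let ?T = "\<lambda>\<omega>. enn2real (min (\<tau> \<omega>) (ennreal t))"
  have T_less: "s < ?T \<omega> \<longleftrightarrow> s < t \<and> ennreal s < \<tau> \<omega>" if "0 \<le> s" for s \<omega>
    using t that by (cases "\<tau> \<omega>") (auto simp: min_def ennreal_less_iff top_unique)
  have less: "{\<omega>\<in>space M. ennreal s < \<tau> \<omega>} \<in> sets ?G" if "0 \<le> s" "s \<le> t" for s
  proof -
    have "{\<omega>\<in>space M. ennreal s < \<tau> \<omega>} = space ?G - {\<omega>\<in>space M. \<tau> \<omega> \<le> ennreal s}" by auto
    thus ?thesis using \<tau>_enlargement[OF that] by (simp only: sets.compl_sets)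
  qed
  have T: "?T \<in> borel_measurable ?G"
  proof (rule borel_measurableI_greater)
    fix s :: real
    show "{\<omega>\<in>space ?G. s < ?T \<omega>} \<in> sets ?G"
    proof (cases "0 \<le> s")
      case True
      show ?thesis unfolding T_less[OF True] sp using less[OF True] by (cases "s < t") auto
    next
      case False
      hence "{\<omega>\<in>space ?G. s < ?T \<omega>} = space ?G" by (auto intro: less_le_trans[of s 0])
      thus ?thesis by (simp only: sets.top)
    qed
  qed
  have "(\<lambda>\<omega>. (?T \<omega>, \<omega>)) \<in> measurable ?G (predictable_sigma M F)"
  proof (rule measurable_predictable[OF sub])
    note [measurable] = T
    fix B s
    { assume "B \<in> sets (F 0)"
      hence [measurable]: "B \<in> sets ?G" using F_enlargement[of 0 t B] t by simp
      show "{\<omega>\<in>space ?G. ?T \<omega> = 0 \<and> \<omega> \<in> B} \<in> sets ?G" by measurable }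
    { assume B: "B \<in> sets (F s)" "0 \<le> s"
      show "{\<omega>\<in>space ?G. s < ?T \<omega> \<and> \<omega> \<in> B} \<in> sets ?G"
      proof (cases "s < t")
        case True
        hence "B \<in> sets ?G" using F_enlargement[of s t B] B by simp
        moreover have "{\<omega>\<in>space ?G. s < ?T \<omega> \<and> \<omega> \<in> B} = {\<omega>\<in>space M. ennreal s < \<tau> \<omega>} \<inter> B"
          using T_less[OF B(2)] True sets.sets_into_space[OF calculation] by auto
        ultimately show ?thesis using less[of s] B True by auto
      next
        case False
        thus ?thesis using T_less[OF B(2)] by simp
      qed }
  qed (use T in auto)
  from measurable_compose[OF this h_predictable[unfolded predictable_process_def]]
  have "(\<lambda>\<omega>. h (?T \<omega>) \<omega>) \<in> borel_measurable ?G" by simp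
  thus ?thesis by (simp add: hh_def)
qed

end

section \<open>The conditional expectation given the enlargement\<close>

context value_processes
begin

text \<open>The explicit version of \<open>Y\<close>. If \<open>z t = 0\<close>, the second branch
  concerns only the null event \<open>{t < \<tau>}\<close>.\<close>

definition R where "R t \<omega> = (if \<tau> \<omega> \<le> ennreal t then hh (enn2real (\<tau> \<omega>)) \<omega> else X t \<omega> / z t)"

lemma R_measurable_enlargement:
  assumes t: "0 \<le> t"
  shows "R t \<in> borel_measurable (progressive_enlargement M F \<tau> t)" (is "_ \<in> borel_measurable ?G")
proof -
  have sp [simp]: "space ?G = space M" by (rule space_progressive_enlargement[OF t])
  have "subalgebra ?G (F t)"
    using F_enlargement[OF t order_refl] t by (auto simp: subalgebra_def)
  from measurable_from_subalg[OF this X_measurable_F[OF t]]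
  have [measurable]: "X t \<in> borel_measurable ?G" .
  note [measurable] = h\<tau>_measurable_enlargement[OF t]
  have [measurable]: "Measurable.pred ?G (\<lambda>\<omega>. \<tau> \<omega> \<le> ennreal t)"
    using \<tau>_enlargement[OF t order_refl] by (simp add: pred_def)
  have "(\<lambda>\<omega>. if \<tau> \<omega> \<le> ennreal t then hh (enn2real (min (\<tau> \<omega>) (ennreal t))) \<omega> else X t \<omega> / z t) \<in> borel_measurable ?G"
    by measurable
  also have "(\<lambda>\<omega>. if \<tau> \<omega> \<le> ennreal t then hh (enn2real (min (\<tau> \<omega>) (ennreal t))) \<omega> else X t \<omega> / z t) = R t"
    by (auto simp: R_def fun_eq_iff min_def)
  finally show ?thesis .
qed

lemma R_measurable: "0 \<le> t \<Longrightarrow> R t \<in> borel_measurable M"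
  using measurable_from_subalg[OF subalgebra_enlargement R_measurable_enlargement] .

lemma R_integrable:
  assumes t: "0 \<le> t"
  shows "integrable M (R t)"
proof (rule integrable_const_bound[where B = "C + 2 * C / z t"])
  show "AE \<omega> in M. norm (R t \<omega>) \<le> C + 2 * C / z t"
    using AE_X_le[OF t] AE_space
  proof eventually_elim
    case (elim \<omega>)
    have "\<bar>X t \<omega> / z t\<bar> \<le> 2 * C / z t"
      using elim(1) z_nonneg[OF t] by (auto simp: abs_divide intro!: divide_right_mono)
    moreover have "\<bar>hh (enn2real (\<tau> \<omega>)) \<omega>\<bar> \<le> C" by (rule hh_le[OF elim(2)])
    moreover have "0 \<le> 2 * C / z t" using C_nonneg z_nonneg[OF t] by simp
    ultimately show ?case using C_nonneg by (auto simp: R_def)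
  qed
qed (rule R_measurable[OF t])

text \<open>By independence the event \<open>{t < \<tau>}\<close> contributes the factor
  \<open>z t\<close>, which the denominator removes; what remains is the integral of
  \<open>X t\<close> over \<open>B\<close>, that is, of the payoff.\<close>

lemma integral_X_after:
  assumes t: "0 \<le> t" and B: "B \<in> F_plus t"
  shows "(\<integral>\<omega>. of_bool (ennreal t < \<tau> \<omega>) * (indicator B \<omega> * (X t \<omega> / z t)) \<partial>M) =
    (\<integral>\<omega>. of_bool (ennreal t < \<tau> \<omega>) * (indicator B \<omega> * h\<tau> \<omega>) \<partial>M)"
proof -
  have B': "B \<in> sets F_inf" using F_plus_F_inf[OF t B] .
  have [measurable]: "B \<in> sets M" using B' by (rule sets_F_inf_M)
  note [measurable] = X_measurable[OF t]
  show ?thesis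
  proof (cases "z t = 0")
    case True
    hence "AE \<omega> in M. \<not> ennreal t < \<tau> \<omega>"
      by (intro AE_I[where N = "{\<omega>\<in>space M. ennreal t < \<tau> \<omega>}"]) (auto simp: z_eq emeasure_eq_measure)
    thus ?thesis by (intro integral_cong_AE) auto
  next
    case False
    \<comment> \<open>\<open>X t\<close> is bounded by \<open>2 * C\<close> only almost surely,
      whereas \<open>integral_less_\<tau>\<close> asks for a bound everywhere; the truncation
      changes it on a null set only.\<close>
    define f where "f \<omega> = indicator B \<omega> * max (- (2 * C)) (min (2 * C) (X t \<omega>))" for \<omega>
    have X_F_inf: "X t \<in> borel_measurable F_inf"
    proof -
      have "subalgebra F_inf (F t)" using sets_F_F_inf[OF t] t by (auto simp: subalgebra_def)
      thus ?thesis using X_measurable_F[OF t] by (rule measurable_from_subalg)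
    qed
    have f: "f \<in> borel_measurable F_inf" unfolding f_def[abs_def] using X_F_inf B' by measurable
    have [measurable]: "f \<in> borel_measurable M" unfolding f_def[abs_def] by measurable
    have f_le: "\<bar>f \<omega>\<bar> \<le> 2 * C" for \<omega> using C_nonneg by (auto simp: f_def indicator_def)
    have f_X: "AE \<omega> in M. f \<omega> = indicator B \<omega> * X t \<omega>"
      using AE_X_le[OF t] by eventually_elim (auto simp: f_def indicator_def)
    have "(\<integral>\<omega>. of_bool (ennreal t < \<tau> \<omega>) * (indicator B \<omega> * (X t \<omega> / z t)) \<partial>M) =
        (\<integral>\<omega>. of_bool (ennreal t < \<tau> \<omega>) * f \<omega> / z t \<partial>M)"
    proof (rule integral_cong_AE)
      show "AE \<omega> in M. of_bool (ennreal t < \<tau> \<omega>) * (indicator B \<omega> * (X t \<omega> / z t)) = of_bool (ennreal t < \<tau> \<omega>) * f \<omega> / z t"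
        using f_X by eventually_elim simp
    qed auto
    also have "\<dots> = (\<integral>\<omega>. of_bool (ennreal t < \<tau> \<omega>) * f \<omega> \<partial>M) / z t" by simp
    also have "\<dots> = (\<integral>\<omega>. f \<omega> \<partial>M)" using integral_less_\<tau>[OF f f_le t] False by simp
    also have "\<dots> = (\<integral>\<omega>. indicator B \<omega> * X t \<omega> \<partial>M)" using f_X by (intro integral_cong_AE) auto
    also have "\<dots> = (\<integral>\<omega>. of_bool (ennreal t < \<tau> \<omega>) * (indicator B \<omega> * h\<tau> \<omega>) \<partial>M)"
      unfolding integral_X_F_plus[OF t B] integral_h\<tau>_after[OF t B'] ..
    finally show ?thesis .
  qed
qed

text \<open>On \<open>{\<tau> \<le> t}\<close> the payoff and \<open>R t\<close> coincide. On
  \<open>{t < \<tau>}\<close> a set of the enlargement can be traded for one of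
  \<open>F_{t+}\<close>, to which \<open>integral_X_after\<close> applies.\<close>

lemma AE_cond_exp_enlargement:
  assumes t: "0 \<le> t"
  shows "AE \<omega> in M. real_cond_exp M (progressive_enlargement M F \<tau> t) (value_at h h_inf \<tau>) \<omega> = R t \<omega>"
proof -
  let ?G = "progressive_enlargement M F \<tau> t"
  interpret S: sigma_finite_subalgebra M ?G
    by (intro finite_measure_subalgebra_is_sigma_finite)
      (auto simp: finite_measure_subalgebra_def finite_measure_subalgebra_axioms_def finite_measure_axioms subalgebra_enlargement t)
  have h\<tau>': "h\<tau> = value_at h h_inf \<tau>" by (rule ext) (simp add: h\<tau>_def)
  have "AE \<omega> in M. real_cond_exp M ?G h\<tau> \<omega> = R t \<omega>"
  proof (rule S.real_cond_exp_charact)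
    fix A assume A: "A \<in> sets ?G"
    hence [measurable]: "A \<in> sets M" using subalgebra_enlargement[OF t] by (auto simp: subalgebra_def)
    obtain B where B: "B \<in> F_plus t" "\<And>\<omega>. \<omega> \<in> space M \<Longrightarrow> ennreal t < \<tau> \<omega> \<Longrightarrow> \<omega> \<in> A \<longleftrightarrow> \<omega> \<in> B"
      using enlargement_trace[OF t A] by (auto simp: trace_sets_def)
    have split: "(\<integral>\<omega>\<in>A. f \<omega> \<partial>M) = (\<integral>\<omega>. of_bool (\<tau> \<omega> \<le> ennreal t) * (indicator A \<omega> * hh (enn2real (\<tau> \<omega>)) \<omega>) \<partial>M) +
        (\<integral>\<omega>. of_bool (ennreal t < \<tau> \<omega>) * (indicator B \<omega> * f' \<omega>) \<partial>M)"
      if int: "integrable M f" and f: "\<And>\<omega>. f \<omega> = (if \<tau> \<omega> \<le> ennreal t then hh (enn2real (\<tau> \<omega>)) \<omega> else f' \<omega>)"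
      for f f' :: "'a \<Rightarrow> real"
    proof -
      note [measurable] = borel_measurable_integrable[OF int]
      have "(\<integral>\<omega>\<in>A. f \<omega> \<partial>M) = (\<integral>\<omega>. of_bool (\<tau> \<omega> \<le> ennreal t) * (indicator A \<omega> * f \<omega>) + of_bool (ennreal t < \<tau> \<omega>) * (indicator A \<omega> * f \<omega>) \<partial>M)"
        unfolding set_lebesgue_integral_def
        by (rule Bochner_Integration.integral_cong) (auto simp: not_le)
      also have "\<dots> = (\<integral>\<omega>. of_bool (\<tau> \<omega> \<le> ennreal t) * (indicator A \<omega> * f \<omega>) \<partial>M) + (\<integral>\<omega>. of_bool (ennreal t < \<tau> \<omega>) * (indicator A \<omega> * f \<omega>) \<partial>M)"
        by (intro Bochner_Integration.integral_add; rule Bochner_Integration.integrable_bound[OF int])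
          (auto simp: indicator_def)
      also have "(\<integral>\<omega>. of_bool (\<tau> \<omega> \<le> ennreal t) * (indicator A \<omega> * f \<omega>) \<partial>M) =
          (\<integral>\<omega>. of_bool (\<tau> \<omega> \<le> ennreal t) * (indicator A \<omega> * hh (enn2real (\<tau> \<omega>)) \<omega>) \<partial>M)"
        by (rule Bochner_Integration.integral_cong) (auto simp: f)
      also have "(\<integral>\<omega>. of_bool (ennreal t < \<tau> \<omega>) * (indicator A \<omega> * f \<omega>) \<partial>M) =
          (\<integral>\<omega>. of_bool (ennreal t < \<tau> \<omega>) * (indicator B \<omega> * f' \<omega>) \<partial>M)"
        by (rule Bochner_Integration.integral_cong) (use B(2) in \<open>auto simp: f indicator_def\<close>)
      finally show ?thesis .
    qed
    have "h\<tau> \<omega> = (if \<tau> \<omega> \<le> ennreal t then hh (enn2real (\<tau> \<omega>)) \<omega> else h\<tau> \<omega>)" for \<omega>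
      by (auto simp: h\<tau>_eq le_less_trans)
    note 1 = split[OF h\<tau>_integrable this]
    have "R t \<omega> = (if \<tau> \<omega> \<le> ennreal t then hh (enn2real (\<tau> \<omega>)) \<omega> else X t \<omega> / z t)" for \<omega>
      by (simp add: R_def)
    note 2 = split[OF R_integrable[OF t] this]
    show "(\<integral>\<omega>\<in>A. h\<tau> \<omega> \<partial>M) = (\<integral>\<omega>\<in>A. R t \<omega> \<partial>M)"
      unfolding 1 2 integral_X_after[OF t B(1)] ..
  qed (use h\<tau>_integrable R_integrable[OF t] R_measurable_enlargement[OF t] in auto)
  thus ?thesis by (simp add: h\<tau>')
qed

text \<open>What remains is right-continuity of \<open>R\<close>: from \<open>\<tau>\<close> on the
  process is constant, and before \<open>\<tau>\<close> the denominator \<open>z t\<close> is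
  positive.\<close>

lemma AE_Y_eq:
  assumes Y: "cadlag_cond_exp M (progressive_enlargement M F \<tau>) (\<lambda>t. value_at h h_inf \<tau>) Y"
  shows "AE \<omega> in M. \<forall>t\<ge>0. Y t \<omega> = R t \<omega>"
proof (rule AE_right_continuous_eq)
  fix t :: real assume t: "0 \<le> t"
  have "AE \<omega> in M. Y t \<omega> = real_cond_exp M (progressive_enlargement M F \<tau> t) (value_at h h_inf \<tau>) \<omega>"
    using Y t by (simp add: cadlag_cond_exp_def)
  thus "AE \<omega> in M. Y t \<omega> = R t \<omega>" using AE_cond_exp_enlargement[OF t] by eventually_elim simp
next
  show "AE \<omega> in M. \<forall>t\<ge>0. ((\<lambda>u. Y u \<omega>) \<longlongrightarrow> Y t \<omega>) (at_right t)"
    using Y unfolding cadlag_cond_exp_def by (auto dest: cadlagD elim!: eventually_mono)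
  show "AE \<omega> in M. \<forall>t\<ge>0. ((\<lambda>u. R u \<omega>) \<longlongrightarrow> R t \<omega>) (at_right t)"
    using AE_X_right AE_z_pos
  proof eventually_elim
    case (elim \<omega>)
    show ?case
    proof (intro allI impI)
      fix t :: real assume t: "0 \<le> t"
      show "((\<lambda>u. R u \<omega>) \<longlongrightarrow> R t \<omega>) (at_right t)"
      proof (cases "\<tau> \<omega> \<le> ennreal t")
        case True
        have "\<forall>\<^sub>F u in at_right t. R t \<omega> = R u \<omega>"
          unfolding eventually_at_right[of t "t + 1", simplified]
          using True by (intro exI[of _ "t + 1"]) (auto simp: R_def dest: order_trans[OF _ ennreal_leI[OF less_imp_le]])
        thus ?thesis by (rule Lim_transform_eventually[OF tendsto_const])
      next
        case False
        hence "((\<lambda>u. X u \<omega> / z u) \<longlongrightarrow> X t \<omega> / z t) (at_right t)"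
          using elim t by (intro tendsto_divide z_tendsto_right) (auto simp: not_le)
        moreover have R: "R u \<omega> = of_bool (\<tau> \<omega> \<le> ennreal u) * hh (enn2real (\<tau> \<omega>)) \<omega>
            + (1 - of_bool (\<tau> \<omega> \<le> ennreal u)) * (X u \<omega> / z u)" for u
          by (simp add: R_def)
        ultimately show ?thesis
          unfolding R using increasing_pathD(3)[OF increasing_path_jump t, of "\<tau> \<omega>"]
          by (intro tendsto_add tendsto_mult tendsto_diff tendsto_const)
      qed
    qed
  qed
qed

end

section \<open>Jumps of the Poisson process\<close>

lemma
  assumes M: "prob_space M" and N: "\<And>t. 0 \<le> t \<Longrightarrow> N t \<in> measurable M (count_space UNIV)"
  defines "F \<equiv> completed_natural_filtration M N"
  shows subalgebra_completed_natural_filtration: "0 \<le> t \<Longrightarrow> subalgebra M (F t)"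
    and completed_natural_filtration_mono: "s \<le> t \<Longrightarrow> sets (F s) \<subseteq> sets (F t)"
    and null_sets_completed_natural_filtration: "null_sets M \<subseteq> sets (F t)"
    and measurable_completed_natural_filtration: "0 \<le> t \<Longrightarrow> N t \<in> measurable (F t) (count_space UNIV)"
proof -
  define E where "E t = {N u -` B \<inter> space M | u B. 0 \<le> u \<and> u \<le> t}" for t
  have E: "E t \<subseteq> Pow (space M)" for t by (auto simp: E_def)
  have nat: "sets (natural_filtration M N t) = sigma_sets (space M) (E t)" for t
    unfolding natural_filtration_def E_def[symmetric] using E by (rule sets_measure_of)
  have sub: "sigma_sets (space M) (E t) \<union> null_sets M \<subseteq> Pow (space M)" for t
    using sigma_sets_into_sp[OF E] sets.sets_into_space by blast
  have F: "sets (F t) = sigma_sets (space M) (sigma_sets (space M) (E t) \<union> null_sets M)" "space (F t) = space M" for t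
    unfolding F_def completed_natural_filtration_def nat using sub
    by (simp_all add: sets_measure_of space_measure_of_conv)
  show "subalgebra M (F t)" if "0 \<le> t" for t
  proof -
    have "E t \<subseteq> sets M" using measurable_sets[OF N] by (auto simp: E_def)
    hence "sigma_sets (space M) (E t) \<union> null_sets M \<subseteq> sets M" using sets.sigma_sets_subset by auto
    thus ?thesis unfolding subalgebra_def F using sets.sigma_sets_subset by (intro conjI refl) blast
  qed
  show "sets (F s) \<subseteq> sets (F t)" if "s \<le> t" for s t
  proof -
    have "E s \<subseteq> E t" using that unfolding E_def by force
    thus ?thesis unfolding F by (intro sigma_sets_mono' Un_mono order_refl)
  qed
  show "null_sets M \<subseteq> sets (F t)" for t unfolding F by auto
  show "N t \<in> measurable (F t) (count_space UNIV)" if "0 \<le> t" for t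
  proof (rule measurableI)
    fix A :: "nat set"
    have "N t -` A \<inter> space M \<in> E t" using that by (auto simp: E_def)
    thus "N t -` A \<inter> space (F t) \<in> sets (F t)" unfolding F by auto
  qed auto
qed

context independent_time
begin

text \<open>Rational end points make the exceptional set of pairs \<open>(s, \<omega>)\<close> a
  countable combination of rectangles. For an increasing path, equal values at \<open>q\<close> and
  \<open>r\<close> mean constancy in between.\<close>

definition no_jump :: "(real \<Rightarrow> 'a \<Rightarrow> nat) \<Rightarrow> real \<Rightarrow> 'a \<Rightarrow> bool" where
  "no_jump N s \<omega> \<longleftrightarrow> (\<exists>q\<in>\<rat> \<inter> {0..}. \<exists>r\<in>\<rat> \<inter> {0..}. q < s \<and> s < r \<and> N q \<omega> = N r \<omega>)"

text \<open>A fixed time carries a jump with probability 0, since short intervals rarely contain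
  one. Fubini's theorem extends this to \<open>da\<close>-almost all times, and independence to the
  random time \<open>\<tau>\<close>.\<close>

lemma AE_no_jump:
  assumes N_F: "\<And>t. 0 \<le> t \<Longrightarrow> N t \<in> measurable (F t) (count_space UNIV)"
    and N_prob: "\<And>q r. 0 \<le> q \<Longrightarrow> q < r \<Longrightarrow> prob {\<omega>\<in>space M. N q \<omega> \<noteq> N r \<omega>} \<le> 1 - exp (- (rate * (r - q)))"
    and rate: "0 < rate"
  shows "AE \<omega> in M. AE s in LS_measure a. 0 < s \<longrightarrow> no_jump N s \<omega>"
    and "AE \<omega> in M. \<forall>T>0. \<tau> \<omega> = ennreal T \<longrightarrow> no_jump N T \<omega>"
proof -
  have N_F_inf: "{\<omega>\<in>space M. N q \<omega> = N r \<omega>} \<in> sets F_inf" if "0 \<le> q" "0 \<le> r" for q r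
  proof -
    have "N t \<in> measurable F_inf (count_space UNIV)" if "0 \<le> t" for t
    proof -
      have "subalgebra F_inf (F t)" using sets_F_F_inf[OF that] that by (auto simp: subalgebra_def)
      thus ?thesis using N_F[OF that] by (rule measurable_from_subalg)
    qed
    from this[OF that(1)] this[OF that(2)] have [measurable]: "N q \<in> measurable F_inf (count_space UNIV)" "N r \<in> measurable F_inf (count_space UNIV)" .
    have "{\<omega>\<in>space F_inf. real (N q \<omega>) = real (N r \<omega>)} \<in> sets F_inf" by measurable
    thus ?thesis by simp
  qed
  define D where "D = {0<..} \<times> space M - (\<Union>q\<in>\<rat> \<inter> {0..}. \<Union>r\<in>\<rat> \<inter> {0..}. {q<..<r} \<times> {\<omega>\<in>space M. N q \<omega> = N r \<omega>})"
  have D_iff: "(s, \<omega>) \<in> D \<longleftrightarrow> 0 < s \<and> \<not> no_jump N s \<omega>" if "\<omega> \<in> space M" for s \<omega>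
    using that by (auto simp: D_def no_jump_def)
  have D: "D \<in> sets (borel \<Otimes>\<^sub>M F_inf)"
    unfolding D_def
  proof (intro sets.Diff sets.countable_UN'' pair_measureI N_F_inf)
    show "countable (\<rat> \<inter> {0::real..})" "countable (\<rat> \<inter> {0::real..})" by (auto intro: countable_Int1 countable_rat)
    show "space M \<in> sets F_inf" using sets.top[of F_inf] by simp
  qed auto
  have D_M: "D \<in> sets (borel \<Otimes>\<^sub>M M)"
  proof -
    have "(\<lambda>x. (fst x, snd x)) \<in> measurable (borel \<Otimes>\<^sub>M M) (borel \<Otimes>\<^sub>M F_inf)"
      by (intro measurable_Pair measurable_fst measurable_compose[OF measurable_snd measurable_M_F_inf])
    from measurable_sets[OF this D] have "(\<lambda>x. x) -` D \<inter> space (borel \<Otimes>\<^sub>M M) \<in> sets (borel \<Otimes>\<^sub>M M)" by simp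
    moreover have "(\<lambda>x. x) -` D \<inter> space (borel \<Otimes>\<^sub>M M) = D" by (auto simp: D_def space_pair_measure)
    ultimately show ?thesis by simp
  qed
  note [measurable] = D D_M
  have slice_meas: "{\<omega>\<in>space M. (s, \<omega>) \<in> D} \<in> sets M" for s by measurable
  have slice: "emeasure M {\<omega>\<in>space M. (s, \<omega>) \<in> D} = 0" for s
  proof (cases "0 < s")
    case True
    have "prob {\<omega>\<in>space M. (s, \<omega>) \<in> D} \<le> 0 + e" if e: "0 < e" for e :: real
    proof -
      have "((\<lambda>d. 1 - exp (- (rate * d))) \<longlongrightarrow> 1 - exp (- (rate * 0))) (at_right 0)"
        by (intro tendsto_intros)
      hence "\<forall>\<^sub>F d in at_right 0. 1 - exp (- (rate * d)) < e"
        using e by (intro order_tendstoD(2)) auto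
      then obtain b where b: "0 < b" "\<And>d. 0 < d \<Longrightarrow> d < b \<Longrightarrow> 1 - exp (- (rate * d)) < e"
        unfolding eventually_at_right[of 0 "1::real", simplified] by auto
      \<comment> \<open>With both margins below \<open>b / 2\<close>, the window has length
        \<open>r - q < b\<close>.\<close>
      obtain q where q: "q \<in> \<rat>" "max 0 (s - b / 2) < q" "q < s"
        using Rats_dense_in_real[of "max 0 (s - b / 2)" s] True b by auto
      obtain r where r: "r \<in> \<rat>" "s < r" "r < s + b / 2"
        using Rats_dense_in_real[of s "s + b / 2"] b by auto
      have "{\<omega>\<in>space M. (s, \<omega>) \<in> D} \<subseteq> {\<omega>\<in>space M. N q \<omega> \<noteq> N r \<omega>}"
        using D_iff q r True by (force simp: no_jump_def)
      hence "prob {\<omega>\<in>space M. (s, \<omega>) \<in> D} \<le> prob {\<omega>\<in>space M. N q \<omega> \<noteq> N r \<omega>}"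
      proof (intro finite_measure_mono)
        have "{\<omega>\<in>space M. N q \<omega> \<noteq> N r \<omega>} = space M - {\<omega>\<in>space M. N q \<omega> = N r \<omega>}" by auto
        also have "\<dots> \<in> events" using N_F_inf[of q r] q r by (intro sets.Diff sets_F_inf_M sets.top) auto
        finally show "{\<omega>\<in>space M. N q \<omega> \<noteq> N r \<omega>} \<in> events" .
      qed
      also have "\<dots> \<le> 1 - exp (- (rate * (r - q)))" using q r by (intro N_prob) auto
      also have "\<dots> < e" using q r by (intro b(2)) auto
      finally show ?thesis by simp
    qed
    hence "prob {\<omega>\<in>space M. (s, \<omega>) \<in> D} \<le> 0" by (rule field_le_epsilon)
    thus ?thesis by (simp add: emeasure_eq_measure measure_le_0_iff)
  next
    case False
    hence empty: "{\<omega>\<in>space M. (s, \<omega>) \<in> D} = {}" using D_iff by auto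
    show ?thesis unfolding empty by (rule emeasure_empty)
  qed
  have "(\<integral>\<^sup>+\<omega>. (\<integral>\<^sup>+s. indicator D (s, \<omega>) \<partial>LS_measure a) \<partial>M) = (\<integral>\<^sup>+s. (\<integral>\<^sup>+\<omega>. indicator D (s, \<omega>) \<partial>M) \<partial>LS_measure a)"
  proof -
    interpret LSa: sigma_finite_measure "LS_measure a" by (rule sigma_finite_LS_measure[OF inc])
    interpret pair_sigma_finite "LS_measure a" M ..
    have "(\<lambda>x. indicator D x :: ennreal) \<in> borel_measurable (LS_measure a \<Otimes>\<^sub>M M)" by measurable
    thus ?thesis by (intro Fubini') auto
  qed
  also have "\<dots> = (\<integral>\<^sup>+s. 0 \<partial>LS_measure a)"
  proof (rule nn_integral_cong)
    fix s
    have "(\<integral>\<^sup>+\<omega>. indicator D (s, \<omega>) \<partial>M) = (\<integral>\<^sup>+\<omega>. indicator {\<omega>\<in>space M. (s, \<omega>) \<in> D} \<omega> \<partial>M)"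
      by (intro nn_integral_cong) (auto simp: indicator_def)
    thus "(\<integral>\<^sup>+\<omega>. indicator D (s, \<omega>) \<partial>M) = 0" using slice slice_meas by simp
  qed
  finally have zero: "(\<integral>\<^sup>+\<omega>. (\<integral>\<^sup>+s. indicator D (s, \<omega>) \<partial>LS_measure a) \<partial>M) = 0" by simp
  have sec: "(\<lambda>s. indicator D (s, \<omega>) :: ennreal) \<in> borel_measurable (LS_measure a)" if "\<omega> \<in> space M" for \<omega>
  proof -
    have "(\<lambda>s. (s, \<omega>)) \<in> measurable borel (borel \<Otimes>\<^sub>M M)" using that by simp
    from measurable_compose[OF this borel_measurable_indicator[OF D_M]]
    have "(\<lambda>s. indicator D (s, \<omega>) :: ennreal) \<in> borel_measurable borel" .
    thus ?thesis by simp
  qed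
  have "(\<lambda>\<omega>. \<integral>\<^sup>+s. indicator D (s, \<omega>) \<partial>LS_measure a) \<in> borel_measurable M"
  proof -
    interpret LSa: sigma_finite_measure "LS_measure a" by (rule sigma_finite_LS_measure[OF inc])
    show ?thesis by (rule LSa.borel_measurable_nn_integral) measurable
  qed
  hence "AE \<omega> in M. (\<integral>\<^sup>+s. indicator D (s, \<omega>) \<partial>LS_measure a) = 0"
    using zero by (simp add: nn_integral_0_iff_AE)
  thus "AE \<omega> in M. AE s in LS_measure a. 0 < s \<longrightarrow> no_jump N s \<omega>"
    using AE_space
  proof eventually_elim
    case (elim \<omega>)
    hence "AE s in LS_measure a. indicator D (s, \<omega>) = (0::ennreal)"
      using sec by (simp add: nn_integral_0_iff_AE)
    thus ?case by eventually_elim (use D_iff elim(2) in \<open>auto simp: indicator_def split: if_splits\<close>)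
  qed
  have "(\<integral>\<^sup>+\<omega>. indicator D (enn2real (\<tau> \<omega>), \<omega>) * indicator {\<omega>. \<tau> \<omega> < \<top>} \<omega> \<partial>M) = 0"
    using nn_integral_independent[of "indicator D"] zero by simp
  moreover have "(\<lambda>\<omega>. indicator D (enn2real (\<tau> \<omega>), \<omega>) * indicator {\<omega>. \<tau> \<omega> < \<top>} \<omega> :: ennreal) \<in> borel_measurable M"
  proof -
    have "(\<lambda>\<omega>. (enn2real (\<tau> \<omega>), \<omega>)) \<in> measurable M (borel \<Otimes>\<^sub>M M)" by measurable
    from measurable_compose[OF this borel_measurable_indicator[OF D_M]]
    have [measurable]: "(\<lambda>\<omega>. indicator D (enn2real (\<tau> \<omega>), \<omega>) :: ennreal) \<in> borel_measurable M" .
    show ?thesis by measurable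
  qed
  ultimately have "AE \<omega> in M. indicator D (enn2real (\<tau> \<omega>), \<omega>) * indicator {\<omega>. \<tau> \<omega> < \<top>} \<omega> = (0::ennreal)"
    by (simp add: nn_integral_0_iff_AE)
  thus "AE \<omega> in M. \<forall>T>0. \<tau> \<omega> = ennreal T \<longrightarrow> no_jump N T \<omega>"
    using AE_space
  proof eventually_elim
    case (elim \<omega>)
    show ?case
    proof (intro allI impI)
      fix T :: real assume T: "0 < T" "\<tau> \<omega> = ennreal T"
      hence "(T, \<omega>) \<notin> D" using elim(1) by (auto simp: indicator_def split: if_splits)
      thus "no_jump N T \<omega>" using D_iff[OF elim(2)] T by auto
    qed
  qed
qed

lemma no_jump_continuous:
  assumes "no_jump N s \<omega>" "increasing_path (\<lambda>t. real (N t \<omega>))"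
  shows "((\<lambda>u. compensated_poisson N rate u \<omega>) \<longlongrightarrow> compensated_poisson N rate s \<omega>) (at_left s)"
proof -
  obtain q r where qr: "0 \<le> q" "q < s" "s < r" "N q \<omega> = N r \<omega>" using assms(1) by (auto simp: no_jump_def)
  have const: "N u \<omega> = N s \<omega>" if "q < u" "u < s" for u
    using increasing_pathD(2)[OF assms(2), of q u] increasing_pathD(2)[OF assms(2), of u s]
      increasing_pathD(2)[OF assms(2), of s r] qr that by auto
  have "((\<lambda>u. real (N s \<omega>) - rate * u) \<longlongrightarrow> real (N s \<omega>) - rate * s) (at_left s)"
    by (intro tendsto_intros)
  moreover have "\<forall>\<^sub>F u in at_left s. real (N s \<omega>) - rate * u = compensated_poisson N rate u \<omega>"
    unfolding eventually_at_left[OF qr(2)] using const qr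
    by (intro exI[of _ q]) (auto simp: compensated_poisson_def)
  ultimately show ?thesis unfolding compensated_poisson_def[of N rate s] by (rule Lim_transform_eventually)
qed

end

lemma left_lim_jump_process:
  assumes s: "0 < s"
  shows "left_lim (\<lambda>u. jump_process \<tau> u \<omega>) s = of_bool (\<tau> \<omega> < ennreal s)"
proof (rule left_lim_eq)
  show "((\<lambda>u. jump_process \<tau> u \<omega>) \<longlongrightarrow> of_bool (\<tau> \<omega> < ennreal s)) (at_left s)"
  proof (cases "\<tau> \<omega> < ennreal s")
    case True
    then obtain T where T: "\<tau> \<omega> = ennreal T" "0 \<le> T" by (cases "\<tau> \<omega>") auto
    hence "T < s" using True by (simp add: ennreal_less_iff)
    hence "\<forall>\<^sub>F u in at_left s. of_bool (\<tau> \<omega> < ennreal s) = jump_process \<tau> u \<omega>"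
      unfolding eventually_at_left[OF \<open>T < s\<close>]
      using T True by (intro exI[of _ T]) (auto simp: jump_process_def ennreal_leI)
    thus ?thesis by (rule Lim_transform_eventually[OF tendsto_const])
  next
    case False
    hence "\<forall>\<^sub>F u in at_left s. of_bool (\<tau> \<omega> < ennreal s) = jump_process \<tau> u \<omega>"
      unfolding eventually_at_left[OF s]
      using s by (intro exI[of _ 0]) (auto simp: jump_process_def dest: le_less_trans[OF _ ennreal_lessI[OF s]])
    thus ?thesis by (rule Lim_transform_eventually[OF tendsto_const])
  qed
qed

lemma poisson_increment_prob:
  assumes M: "prob_space M" and rate: "0 < rate" and N: "poisson_process M N rate" and qr: "0 \<le> q" "q < r"
  shows "measure M {\<omega>\<in>space M. N q \<omega> \<noteq> N r \<omega>} \<le> 1 - exp (- (rate * (r - q)))"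
proof -
  interpret prob_space M by fact
  have [measurable]: "N q \<in> measurable M (count_space UNIV)" "N r \<in> measurable M (count_space UNIV)"
    using N qr by (auto simp: poisson_process_def)
  have d: "distr M (count_space UNIV) (\<lambda>\<omega>. N r \<omega> - N q \<omega>) = measure_pmf (poisson_pmf (rate * (r - q)))"
    using N qr by (simp add: poisson_process_def)
  have "measure M {\<omega>\<in>space M. N r \<omega> - N q \<omega> = 0} = measure (distr M (count_space UNIV) (\<lambda>\<omega>. N r \<omega> - N q \<omega>)) {0}"
    by (subst measure_distr) (auto intro!: arg_cong[where f = "measure M"])
  also have "\<dots> = exp (- (rate * (r - q)))"
    unfolding d using rate qr by (simp add: measure_pmf_single)
  finally have e: "measure M {\<omega>\<in>space M. N r \<omega> - N q \<omega> = 0} = exp (- (rate * (r - q)))" .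
  \<comment> \<open>Subtraction on \<open>nat\<close> is truncated: a zero difference means equality
    only because the path is increasing.\<close>
  have "{\<omega>\<in>space M. N q \<omega> \<noteq> N r \<omega>} \<subseteq> space M - {\<omega>\<in>space M. N r \<omega> - N q \<omega> = 0}"
  proof
    fix \<omega> assume w: "\<omega> \<in> {\<omega>\<in>space M. N q \<omega> \<noteq> N r \<omega>}"
    hence "increasing_path (\<lambda>t. real (N t \<omega>))" using N by (auto simp: poisson_process_def)
    hence "N q \<omega> \<le> N r \<omega>" using increasing_pathD(2)[of "\<lambda>t. real (N t \<omega>)" q r] qr by simp
    thus "\<omega> \<in> space M - {\<omega>\<in>space M. N r \<omega> - N q \<omega> = 0}" using w by auto
  qed
  hence "measure M {\<omega>\<in>space M. N q \<omega> \<noteq> N r \<omega>} \<le> measure M (space M - {\<omega>\<in>space M. N r \<omega> - N q \<omega> = 0})"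
    by (intro finite_measure_mono) measurable
  also have "\<dots> = 1 - exp (- (rate * (r - q)))" using e
  proof -
    have "{\<omega>\<in>space M. real (N r \<omega> - N q \<omega>) = 0} \<in> events" by measurable
    hence "{\<omega>\<in>space M. N r \<omega> - N q \<omega> = 0} \<in> events" by (simp only: of_nat_eq_0_iff)
    thus ?thesis using e by (simp only: prob_compl)
  qed
  finally show ?thesis .
qed

theorem corollary3p2:
  fixes M :: "'a measure" and N :: "real \<Rightarrow> 'a \<Rightarrow> nat" and rate :: real
    and \<tau> :: "'a \<Rightarrow> ennreal"
    and F G :: "real \<Rightarrow> 'a measure"
    and Z Ap h X \<mu> \<phi> Y :: "real \<Rightarrow> 'a \<Rightarrow> real"
    and Z_inf h_inf :: "'a \<Rightarrow> real"
  assumes "prob_space M"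
    and "rate > 0" and "poisson_process M N rate"
    and F_def: "F = completed_natural_filtration M N"
    and "\<tau> \<in> borel_measurable M" and "indep_of_filtration M F \<tau>"
    and G_def: "G = progressive_enlargement M F \<tau>"
    and Z: "cadlag_cond_exp M F (\<lambda>t. indicator {\<omega>. ennreal t < \<tau> \<omega>}) Z"
    and Z_inf: "Z_inf \<in> borel_measurable M"
      "AE \<omega> in M. ((\<lambda>t. Z t \<omega>) \<longlongrightarrow> Z_inf \<omega>) at_top"
    and Ap: "dual_predictable_projection M F (jump_process \<tau>) Ap"
    and h: "predictable_process M F h" "\<exists>C. \<forall>t\<ge>0. \<forall>\<omega>\<in>space M. \<bar>h t \<omega>\<bar> \<le> C"
    and h_inf: "h_inf \<in> borel_measurable M"
      "AE \<omega> in M. ((\<lambda>t. h t \<omega>) \<longlongrightarrow> h_inf \<omega>) at_top"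
    and X: "cadlag_cond_exp M F
      (\<lambda>t \<omega>. (LINT s:{t<..}|LS_measure (\<lambda>u. Ap u \<omega>). h s \<omega>) + h_inf \<omega> * Z_inf \<omega>) X"
    and \<mu>: "cadlag_cond_exp M F
      (\<lambda>t \<omega>. (LINT s:{0<..}|LS_measure (\<lambda>u. Ap u \<omega>). h s \<omega>) + h_inf \<omega> * Z_inf \<omega>) \<mu>"
    and \<phi>: "predictable_process M F \<phi>"
      "AE \<omega> in M. \<forall>t\<ge>0. has_LS_integral (\<lambda>s. compensated_poisson N rate s \<omega>) (\<lambda>s. \<phi> s \<omega>) t
        (\<mu> t \<omega> - \<mu> 0 \<omega>)"
    and Y: "cadlag_cond_exp M G (\<lambda>t. value_at h h_inf \<tau>) Y"
  shows "AE \<omega> in M. \<forall>t\<ge>0. \<exists>I J.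
    has_LS_integral (\<lambda>s. compensated_jump \<tau> Z Ap s \<omega>)
      (\<lambda>s. let Zl = left_lim (\<lambda>u. Z u \<omega>) s;
               Xl = left_lim (\<lambda>u. X u \<omega>) s;
               dAp = Ap s \<omega> - left_lim (\<lambda>u. Ap u \<omega>) s
           in Zl / (Zl - dAp) * (h s \<omega> - Xl / Zl)) t I \<and>
    has_LS_integral (\<lambda>s. compensated_poisson N rate s \<omega>)
      (\<lambda>s. (1 - left_lim (\<lambda>u. jump_process \<tau> u \<omega>) s) / left_lim (\<lambda>u. Z u \<omega>) s * \<phi> s \<omega>) t J \<and>
    Y t \<omega> = Y 0 \<omega> + I + J"
proof -
  obtain C where C: "\<And>t \<omega>. 0 \<le> t \<Longrightarrow> \<omega> \<in> space M \<Longrightarrow> \<bar>h t \<omega>\<bar> \<le> C" using h(2) by blast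
  have N: "\<And>t. 0 \<le> t \<Longrightarrow> N t \<in> measurable M (count_space UNIV)"
    and N_inc: "\<And>\<omega>. \<omega> \<in> space M \<Longrightarrow> increasing_path (\<lambda>t. real (N t \<omega>))"
    using \<open>poisson_process M N rate\<close> by (auto simp: poisson_process_def)
  interpret prob_space M by fact
  interpret S: value_processes M F \<tau> Ap Z h Z_inf h_inf C X \<mu>
  proof unfold_locales
    show "\<And>t. 0 \<le> t \<Longrightarrow> subalgebra M (F t)"
      unfolding F_def by (rule subalgebra_completed_natural_filtration[OF assms(1) N])
    show "\<And>s t. 0 \<le> s \<Longrightarrow> s \<le> t \<Longrightarrow> sets (F s) \<subseteq> sets (F t)"
      unfolding F_def by (rule completed_natural_filtration_mono[OF assms(1) N])
    show "\<And>t. 0 \<le> t \<Longrightarrow> null_sets M \<subseteq> sets (F t)"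
      unfolding F_def by (rule null_sets_completed_natural_filtration[OF assms(1) N])
  qed (use assms C in auto)
  have N_F: "\<And>t. 0 \<le> t \<Longrightarrow> N t \<in> measurable (F t) (count_space UNIV)"
    unfolding F_def by (rule measurable_completed_natural_filtration[OF assms(1) N])
  have N_prob: "\<And>q r. 0 \<le> q \<Longrightarrow> q < r \<Longrightarrow> prob {\<omega>\<in>space M. N q \<omega> \<noteq> N r \<omega>} \<le> 1 - exp (- (rate * (r - q)))"
    by (rule poisson_increment_prob[OF assms(1-3)])
  have no_jump: "AE \<omega> in M. AE s in LS_measure S.a. 0 < s \<longrightarrow> S.no_jump N s \<omega>"
    using N_F N_prob assms(2) by (rule S.AE_no_jump(1))
  have no_jump_\<tau>: "AE \<omega> in M. \<forall>T>0. \<tau> \<omega> = ennreal T \<longrightarrow> S.no_jump N T \<omega>"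
    using N_F N_prob assms(2) by (rule S.AE_no_jump(2))
  \<comment> \<open>All null sets are discarded before \<open>t\<close> is fixed, since each of
    these facts holds for all times simultaneously.\<close>
  show ?thesis
    using S.AE_Z S.AE_Ap_eq S.AE_X_eq S.AE_X_vanish S.AE_Y_eq[OF Y[unfolded G_def]] S.AE_survival no_jump no_jump_\<tau> \<phi>(2) AE_space
  proof eventually_elim
    case (elim \<omega>)
    note w = elim(10)
    show ?case
    proof (intro allI impI)
      fix t :: real assume t: "0 \<le> t"
      let ?V = "\<lambda>s. compensated_poisson N rate s \<omega>"
      \<comment> \<open>The decomposition belonging to the final time \<open>t\<close> is used at
        every \<open>u \<le> t\<close>, so that the whole trajectory refers to one pair.\<close>
      obtain P Q where P: "increasing_path P" and Q: "increasing_path Q" and V: "\<And>s. 0 \<le> s \<Longrightarrow> ?V s = P s - Q s"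
        and int: "set_integrable (LS_measure P) {0<..t} (\<lambda>s. \<phi> s \<omega>)" "set_integrable (LS_measure Q) {0<..t} (\<lambda>s. \<phi> s \<omega>)"
        using elim(9) t unfolding has_LS_integral_def by blast
      interpret killed_path S.a "\<tau> \<omega>" by (rule elim(6))
      interpret K: killed_jump_path S.a "\<tau> \<omega>" t C "\<lambda>s. X s \<omega>" ?V "\<lambda>s. \<phi> s \<omega>" "\<lambda>s. S.hh s \<omega>" P Q "\<lambda>s. Y s \<omega>"
      proof unfold_locales
        fix u assume u: "0 \<le> u" "u \<le> t"
        have "\<mu> u \<omega> - \<mu> 0 \<omega> = (LINT s:{0<..u}|LS_measure P. \<phi> s \<omega>) - (LINT s:{0<..u}|LS_measure Q. \<phi> s \<omega>)"
          by (rule has_LS_integral_decomposition[OF _ P Q V int u(2)]) (use elim(9) u in auto)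
        moreover have "X u \<omega> = \<mu> u \<omega> - S.elapsed u \<omega>" "X 0 \<omega> = \<mu> 0 \<omega>"
          using elim(3) u by (auto simp: S.elapsed_def set_lebesgue_integral_def)
        ultimately show "X u \<omega> = X 0 \<omega> + (LINT s:{0<..u}|LS_measure P. \<phi> s \<omega>) -
           (LINT s:{0<..u}|LS_measure Q. \<phi> s \<omega>) - (LINT s:{0<..u}|LS_measure S.a. S.hh s \<omega>)"
          by (simp add: S.elapsed_def)
        show "Y u \<omega> = (if \<tau> \<omega> \<le> ennreal u then S.hh (enn2real (\<tau> \<omega>)) \<omega> else X u \<omega> / S.z u)"
          using elim(5) u by (simp add: S.R_def)
      next
        show "set_borel_measurable borel {0..} (\<lambda>s. S.hh s \<omega>)"
          using S.hh_path_measurable[OF w] by (auto simp: set_borel_measurable_def)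
        show "AE s in LS_measure S.a. 0 < s \<longrightarrow> (?V \<longlongrightarrow> ?V s) (at_left s)"
          using elim(7) by eventually_elim (auto intro: S.no_jump_continuous N_inc[OF w])
        show "(?V \<longlongrightarrow> ?V T) (at_left T)" if "0 < T" "\<tau> \<omega> = ennreal T" for T
          using elim(8) that by (intro S.no_jump_continuous N_inc[OF w]) auto
        show "X T \<omega> = 0" if "0 < T" "T \<le> t" "\<tau> \<omega> = ennreal T" "S.z T = 0" for T
          using elim(4) that by auto
      qed (use t P Q V int S.hh_le[OF w] in auto)
      have Zl: "left_lim (\<lambda>u. Z u \<omega>) s = S.z_left s" if "0 < s" for s
        using left_lim_cong[OF that, of "\<lambda>u. Z u \<omega>" S.z] elim(1) S.left_lim_z[OF that] by simp
      have LS: "LS_measure (\<lambda>u. Ap u \<omega>) = LS_measure S.a" by (rule LS_measure_cong) (use elim(2) in auto)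
      \<comment> \<open>Exchange of the given processes for their deterministic versions. Integrands
        matter at positive times only, where left limits depend on values at nonnegative times
        alone.\<close>
      have "has_LS_integral (\<lambda>u. of_bool (\<tau> \<omega> \<le> ennreal u) - B u) K.H t K.I =
        has_LS_integral (\<lambda>s. compensated_jump \<tau> Z Ap s \<omega>)
          (\<lambda>s. let Zl = left_lim (\<lambda>u. Z u \<omega>) s; Xl = left_lim (\<lambda>u. X u \<omega>) s;
               dAp = Ap s \<omega> - left_lim (\<lambda>u. Ap u \<omega>) s
           in Zl / (Zl - dAp) * (h s \<omega> - Xl / Zl)) t K.I"
      proof (rule has_LS_integral_cong)
        fix s :: real assume s: "0 \<le> s"
        have "B s = (LINT r:{r. 0 < r \<and> r \<le> s \<and> ennreal r \<le> \<tau> \<omega>}|LS_measure S.a. 1 / left_lim (\<lambda>u. Z u \<omega>) r)"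
          unfolding B_def set_lebesgue_integral_def
          by (rule Bochner_Integration.integral_cong) (auto simp: Zl indicator_def)
        thus "of_bool (\<tau> \<omega> \<le> ennreal s) - B s = compensated_jump \<tau> Z Ap s \<omega>"
          using s by (simp add: compensated_jump_def jump_process_def LS)
      next
        fix s :: real assume s: "0 < s" "s \<le> t"
        have "left_lim (\<lambda>u. Ap u \<omega>) s = left_lim S.a s" by (rule left_lim_cong[OF s(1)]) (use elim(2) in auto)
        moreover have "Ap s \<omega> = S.a s" using elim(2) s by simp
        ultimately have "S.z_left s - (Ap s \<omega> - left_lim (\<lambda>u. Ap u \<omega>) s) = S.z s"
          using S.z_left_eq[OF s(1)] by (simp add: S.z_def)
        moreover have "S.hh s \<omega> = h s \<omega>" using s by (simp add: S.hh_def)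
        ultimately show "K.H s = (let Zl = left_lim (\<lambda>u. Z u \<omega>) s; Xl = left_lim (\<lambda>u. X u \<omega>) s;
               dAp = Ap s \<omega> - left_lim (\<lambda>u. Ap u \<omega>) s
           in Zl / (Zl - dAp) * (h s \<omega> - Xl / Zl))"
          using Zl[OF s(1)] K.left_lim_X[OF s] by (simp add: K.H_def Let_def)
      qed
      moreover have "has_LS_integral ?V (\<lambda>s. of_bool (ennreal s \<le> \<tau> \<omega>) / S.z_left s * \<phi> s \<omega>) t K.J =
        has_LS_integral ?V (\<lambda>s. (1 - left_lim (\<lambda>u. jump_process \<tau> u \<omega>) s) / left_lim (\<lambda>u. Z u \<omega>) s * \<phi> s \<omega>) t K.J"
      proof (rule has_LS_integral_cong)
        fix s :: real assume s: "0 < s" "s \<le> t"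
        have "left_lim (\<lambda>u. jump_process \<tau> u \<omega>) s = of_bool (\<tau> \<omega> < ennreal s)"
          by (rule left_lim_jump_process[OF s(1)])
        hence "1 - left_lim (\<lambda>u. jump_process \<tau> u \<omega>) s = of_bool (ennreal s \<le> \<tau> \<omega>)"
          by (auto simp: not_less)
        thus "of_bool (ennreal s \<le> \<tau> \<omega>) / S.z_left s * \<phi> s \<omega> =
            (1 - left_lim (\<lambda>u. jump_process \<tau> u \<omega>) s) / left_lim (\<lambda>u. Z u \<omega>) s * \<phi> s \<omega>"
          using Zl[OF s(1)] by simp
      qed simp
      ultimately show "\<exists>I J.
        has_LS_integral (\<lambda>s. compensated_jump \<tau> Z Ap s \<omega>)
          (\<lambda>s. let Zl = left_lim (\<lambda>u. Z u \<omega>) s; Xl = left_lim (\<lambda>u. X u \<omega>) s;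
               dAp = Ap s \<omega> - left_lim (\<lambda>u. Ap u \<omega>) s
           in Zl / (Zl - dAp) * (h s \<omega> - Xl / Zl)) t I \<and>
        has_LS_integral ?V
          (\<lambda>s. (1 - left_lim (\<lambda>u. jump_process \<tau> u \<omega>) s) / left_lim (\<lambda>u. Z u \<omega>) s * \<phi> s \<omega>) t J \<and>
        Y t \<omega> = Y 0 \<omega> + I + J"
        using K.has_integral_I K.has_integral_J K.martingale_formula by (intro exI[of _ K.I] exI[of _ K.J]) simp
    qed
  qed
qed

end
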